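(* Let $(g,\Gamma)$ be a Gårding polynomial of degree $N\ge1$ with its Gårding cone on a finite-dimensional real inner product space $W$, let $X$ be a finite-dimensional real inner product space and $L:X\to W$ a linear map with transpose $L^t:W\to X$. Let $g_L(x)=g(Lx)$ and $\Gamma_L=L^{-1}(\Gamma)$ be the pull back pair, and assume $\Gamma_L\ne\emptyset$. Let $E$, $E_L$ be the edges of $\Gamma$, $\Gamma_L$, and let $F=D\log g$ on $\Gamma$ and $F_L=D\log g_L$ on $\Gamma_L$. Then the dual pair $(g_L^*,\Gamma_L^* )$ of $(g_L,\Gamma_L)$ is determined by the dual pair $(g^*,\Gamma^* )$ of $(g,\Gamma)$ as follows. (1) (Polar cones) $(\Gamma_L)^*=L^t\,\Gamma^*$, or equivalently $(\Gamma_L)^0=L^t\,\Gamma^0$. (2) (Gradient maps) (a) $D_xg_L=L^tD_{Lx}g$ for all $x\in\Gamma_L$. (b) $F_L(x)=D_x\log g_L=L^tD_{Lx}\log g=(L^t\circ F\circ L)(x)$ for all $x\in\Gamma_L$. This factors the gradient diffeomorphism $F_L:\Gamma_L/E_L\to\Gamma_L^*$ into (c) a diffeomorphism $F\circ L:\Gamma_L/E_L\to\Sigma=\{F(Lx):x\in\Gamma_L\}$, followed by (d) a diffeomorphism $L^t:\Sigma\to\Gamma_L^*$. (3) (Dual function) $g_L^*(y)=g^*\bigl((L^t)^{-1}(y)\bigr)$ for all $y\in\Gamma_L^*$, where $(L^t)^{-1}:\Gamma_L^*\to\Sigma$ denotes the inverse of the diffeomorphism in (d). (4) (Ellipticity)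 The pair $(g_L^*,\Gamma_L^* )$ is elliptic if and only if: Case 1 ($X=\mathbb{R}^n$): $L(\mathbb{R}^n_{>0})\supset\Gamma$, or equivalently $\mathbb{R}^n_{>0}\subset L^t\,\Gamma^*$; Case 2 ($X=S(n)$): $L(\mathrm{Int}\,\mathcal P)\supset\Gamma$, or equivalently $\mathrm{Int}\,\mathcal P\subset L^t\,\Gamma^*$.
   Context: A Gårding polynomial of degree $N$ on a finite-dimensional real vector space $V$ is a homogeneous real polynomial $g$ of degree $N$ on $V$ together with a connected component $\Gamma$ of $\{g>0\}$ (the Gårding cone) such that for some $e\in\Gamma$ and every $v\in V$ the polynomial $t\mapsto g(te+v)$ has exactly $N$ real roots counted with multiplicity. The cone $\Gamma$ is then open and convex. Its edge is the linear subspace $E=\overline\Gamma\cap(-\overline\Gamma)$, and $g(x+v)=g(x)$ for all $x\in V$, $v\in E$. Inner product spaces are identified with their duals, so derivatives are gradients. For an open convex cone $\Gamma\subset V$, $\Gamma^0=\{y\in V:\langle y,x\rangle\ge0\ \forall x\in\Gamma\}$, and the open polar $\Gamma^*$ is the interior of $\Gamma^0$ relative to its linear span (which is $E^\perp$). The gradient map $F(x)=D_x\log g$ depends only on $x$ modulo $E$ and induces a diffeomorphism $\Gamma/E\to\Gamma^*$, where $\Gamma/E$ is the image of $\Gamma$ in $V/E$. The dual Gårding function is $g^*(y)=1/g(x)$ for $y\in\Gamma^*$, where $x\in\Gamma$ is any point with $F(x)=y$. If $\Gamma_L\ne\emptyset$ (equivalently $L(X)\cap\Gamma\ne\emptyset$),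 the pull back $g_L$ is a Gårding polynomial of degree $N$ on $X$ with Gårding cone $\Gamma_L$ and edge $E_L=L^{-1}(E)$, so the notions $F_L$, $\Gamma_L^*$, $g_L^*$ are defined for it. The set $\Sigma$ equals $F(\Gamma\cap L(X))$ and is a submanifold of $\Gamma^*$. $S(n)$ is the space of real symmetric $n\times n$ matrices with inner product $\mathrm{tr}(AB)$, $\mathcal P=\{A\in S(n):A\ge0\}$ and $\mathrm{Int}\,\mathcal P=\{A>0\}$. In the case $X=\mathbb{R}^n$ (standard inner product), a pair with cone $C\subset X$ is called elliptic if $C\supset\mathbb{R}^n_{>0}=\{x:x_i>0\ \forall i\}$. In the case $X=S(n)$, it is called elliptic if $C\supset\mathrm{Int}\,\mathcal P$. For $(g_L^*,\Gamma_L^* )$ this is applied with $C=\Gamma_L^*$. In both cases of (4), $n$ refers to the space $X$ only, and $W$ is arbitrary.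
   Formalization: In (4) the first form, L(ℝⁿ_{>0})⊃Γ (resp. L(Int P)⊃Γ), is false for general L (e.g. L(x)=x₁+x₂, g(w)=w); it is replaced by "L injective and Γ∩L(X)⊂L(ℝⁿ_{>0})" (resp. L(Int P)), and the printed form is stated for bijective L. *)

theory Defs
  imports "HOL-Analysis.Analysis" "HOL-Computational_Algebra.Polynomial"
begin

section \<open>Garding polynomials\<close>

text \<open>
  A finite-dimensional real inner product space is a type of class \<^class>\<open>euclidean_space\<close>.  The
  dimension is then at least one; a Garding polynomial of degree at least one does not exist on
  the zero space, so nothing is lost.  For the last condition: the real polynomial
  \<open>t \<mapsto> g (t e + v)\<close> is nonzero, and the multiplicities of its real roots add up to \<open>N\<close>.
\<close>

definition garding_pair :: "nat \<Rightarrow> ('v::euclidean_space \<Rightarrow> real) \<Rightarrow> 'v set \<Rightarrow> bool" where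
  "garding_pair N g \<Gamma> \<longleftrightarrow>
     real_polynomial_function g \<and>
     (\<forall>t x. g (t *\<^sub>R x) = t ^ N * g x) \<and>
     \<Gamma> \<in> components {x. g x > 0} \<and>
     (\<exists>e\<in>\<Gamma>. \<forall>v. \<exists>p :: real poly.
        (\<forall>t. poly p t = g (t *\<^sub>R e + v)) \<and> p \<noteq> 0 \<and> (\<Sum>t | poly p t = 0. order t p) = N)"

definition edge :: "'v::euclidean_space set \<Rightarrow> 'v set" where
  "edge \<Gamma> = closure \<Gamma> \<inter> uminus ` closure \<Gamma>"

definition polar :: "'v::euclidean_space set \<Rightarrow> 'v set" where
  "polar \<Gamma> = {y. \<forall>x\<in>\<Gamma>. y \<bullet> x \<ge> 0}"

definition open_polar :: "'v::euclidean_space set \<Rightarrow> 'v set" where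
  "open_polar \<Gamma> = top_of_set (span (polar \<Gamma>)) interior_of polar \<Gamma>"

definition grad :: "('v::euclidean_space \<Rightarrow> real) \<Rightarrow> 'v \<Rightarrow> 'v" where
  "grad f x = (THE D. GDERIV f x :> D)"

definition grad_log :: "('v::euclidean_space \<Rightarrow> real) \<Rightarrow> 'v \<Rightarrow> 'v" where
  "grad_log g = grad (\<lambda>x. ln (g x))"

text \<open>
  The value is that of \<open>1 / g x\<close> at any \<open>x\<close> in the cone whose logarithmic gradient is \<open>y\<close>; as a
  definite description it makes sense only because this value does not depend on \<open>x\<close>.
\<close>

definition dual_fun :: "('v::euclidean_space \<Rightarrow> real) \<Rightarrow> 'v set \<Rightarrow> 'v \<Rightarrow> real" where
  "dual_fun g \<Gamma> y = (THE r. \<exists>x\<in>\<Gamma>. grad_log g x = y \<and> r = 1 / g x)"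


section \<open>Smooth maps, submanifolds and diffeomorphisms\<close>

fun Ck_on :: "nat \<Rightarrow> 'a::euclidean_space set \<Rightarrow> ('a \<Rightarrow> 'b::euclidean_space) \<Rightarrow> bool" where
  "Ck_on 0 U f \<longleftrightarrow> continuous_on U f"
| "Ck_on (Suc k) U f \<longleftrightarrow>
     (\<forall>x\<in>U. f differentiable (at x)) \<and> (\<forall>v. Ck_on k U (\<lambda>x. frechet_derivative f (at x) v))"

text \<open>
  On a subset that need not be open, smooth means: locally the restriction of a smooth map on an
  open set of the ambient space.  For maps on embedded submanifolds this is the usual notion.
\<close>

definition smooth_map_on :: "'a::euclidean_space set \<Rightarrow> ('a \<Rightarrow> 'b::euclidean_space) \<Rightarrow> bool" where
  "smooth_map_on A f \<longleftrightarrow>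
     (\<forall>x\<in>A. \<exists>U \<phi>. open U \<and> x \<in> U \<and> (\<forall>k. Ck_on k U \<phi>) \<and> (\<forall>y\<in>A \<inter> U. f y = \<phi> y))"

definition diffeomorphism ::
  "'a::euclidean_space set \<Rightarrow> 'b::euclidean_space set \<Rightarrow> ('a \<Rightarrow> 'b) \<Rightarrow> bool" where
  "diffeomorphism A B f \<longleftrightarrow>
     bij_betw f A B \<and> smooth_map_on A f \<and> smooth_map_on B (inv_into A f)"

text \<open>
  Every point has a relatively open neighbourhood diffeomorphic to an open subset of a
  \<open>d\<close>-dimensional linear space.
\<close>

definition submanifold :: "'a::euclidean_space set \<Rightarrow> bool" where
  "submanifold S \<longleftrightarrow>
     (\<exists>d. \<forall>p\<in>S. \<exists>U T O' (\<phi> :: 'a \<Rightarrow> 'a). open U \<and> p \<in> U \<and> subspace T \<and> dim T = d \<and>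
        openin (top_of_set T) O' \<and> diffeomorphism O' (S \<inter> U) \<phi>)"

text \<open>
  For a linear subspace \<open>E\<close>, \<open>U // modulo E\<close> is the image \<open>U/E\<close> of \<open>U\<close> in the quotient space.
\<close>

definition modulo :: "'a::euclidean_space set \<Rightarrow> 'a rel" where
  "modulo E = {(x, y). x - y \<in> E}"

text \<open>
  \<open>f\<close> factors through a diffeomorphism \<open>h\<close> from \<open>U/E\<close> (for \<open>U\<close> open) onto \<open>S\<close>.  Here \<open>h\<close> is smooth
  iff its composition with the projection (which is \<open>f\<close>) is smooth, as the projection is a
  submersion; a map into the quotient space is smooth iff it has a smooth lift, as the projection
  has a linear right inverse.
\<close>

definition induces_diffeomorphism ::
  "'a::euclidean_space set \<Rightarrow> 'a set \<Rightarrow> 'b::euclidean_space set \<Rightarrow> ('a \<Rightarrow> 'b) \<Rightarrow> bool" where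
  "induces_diffeomorphism U E S f \<longleftrightarrow>
     (\<exists>h :: 'a set \<Rightarrow> 'b.
        (\<forall>x\<in>U. h (modulo E `` {x}) = f x) \<and>
        bij_betw h (U // modulo E) S \<and>
        smooth_map_on U f \<and>
        (\<exists>s. smooth_map_on S s \<and> (\<forall>y\<in>S. s y \<in> inv_into (U // modulo E) h y)))"


section \<open>The space of real symmetric matrices\<close>

typedef (overloaded) 'n symmat = "{A :: real^'n^'n::finite. transpose A = A}"
  morphisms mat_of Symmat
  by (rule exI[of _ 0]) (simp add: transpose_def vec_eq_iff)

setup_lifting type_definition_symmat

instantiation symmat :: (finite) real_vector
begin
lift_definition zero_symmat :: "'a symmat" is 0
  by (simp add: transpose_def vec_eq_iff)
lift_definition plus_symmat :: "'a symmat \<Rightarrow> 'a symmat \<Rightarrow> 'a symmat" is "(+)"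
  by (simp add: transpose_def vec_eq_iff)
lift_definition minus_symmat :: "'a symmat \<Rightarrow> 'a symmat \<Rightarrow> 'a symmat" is "(-)"
  by (simp add: transpose_def vec_eq_iff)
lift_definition uminus_symmat :: "'a symmat \<Rightarrow> 'a symmat" is uminus
  by (simp add: transpose_def vec_eq_iff)
lift_definition scaleR_symmat :: "real \<Rightarrow> 'a symmat \<Rightarrow> 'a symmat" is scaleR
  by (simp add: transpose_def vec_eq_iff)
instance
  by standard (transfer; simp add: algebra_simps)+
end

lemma trace_mult_symmetric:
  fixes A B :: "real^'n^'n"
  assumes "transpose B = B"
  shows "trace (A ** B) = A \<bullet> B"
proof -
  have "B $ k $ i = B $ i $ k" for i k
    using assms by (metis transpose_def vec_lambda_beta)
  then show ?thesis
    by (simp add: trace_def matrix_matrix_mult_def inner_vec_def)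
qed

instantiation symmat :: (finite) real_inner
begin
definition inner_symmat :: "'a symmat \<Rightarrow> 'a symmat \<Rightarrow> real" where
  "inner_symmat A B = trace (mat_of A ** mat_of B)"
definition norm_symmat :: "'a symmat \<Rightarrow> real" where
  "norm_symmat A = sqrt (A \<bullet> A)"
definition sgn_symmat :: "'a symmat \<Rightarrow> 'a symmat" where
  "sgn_symmat A = A /\<^sub>R norm A"
definition dist_symmat :: "'a symmat \<Rightarrow> 'a symmat \<Rightarrow> real" where
  "dist_symmat A B = norm (A - B)"
definition uniformity_symmat :: "('a symmat \<times> 'a symmat) filter" where
  "uniformity_symmat = (INF e\<in>{0<..}. principal {(x, y). dist x y < e})"
definition open_symmat :: "'a symmat set \<Rightarrow> bool" where
  "open_symmat U \<longleftrightarrow> (\<forall>x\<in>U. \<forall>\<^sub>F (x', y) in uniformity. x' = x \<longrightarrow> y \<in> U)"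

lemma inner_symmat_eq: "A \<bullet> B = mat_of A \<bullet> mat_of B"
  using mat_of[of B] by (simp add: inner_symmat_def trace_mult_symmetric)

instance
proof
  fix A B C :: "'a symmat" and r :: real and U :: "'a symmat set"
  show "dist A B = norm (A - B)" "sgn A = A /\<^sub>R norm A" "norm A = sqrt (A \<bullet> A)"
    by (fact dist_symmat_def sgn_symmat_def norm_symmat_def)+
  show "uniformity = (INF e\<in>{0<..}. principal {(x :: 'a symmat, y). dist x y < e})"
    by (fact uniformity_symmat_def)
  show "open U \<longleftrightarrow> (\<forall>x\<in>U. \<forall>\<^sub>F (x', y) in uniformity. x' = x \<longrightarrow> y \<in> U)"
    by (fact open_symmat_def)
  show "A \<bullet> B = B \<bullet> A" "0 \<le> A \<bullet> A"
    by (simp_all add: inner_symmat_eq inner_commute)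
  show "(A + B) \<bullet> C = A \<bullet> C + B \<bullet> C"
    by (simp add: inner_symmat_eq plus_symmat.rep_eq inner_add_left)
  show "(r *\<^sub>R A) \<bullet> B = r * (A \<bullet> B)"
    by (simp add: inner_symmat_eq scaleR_symmat.rep_eq)
  show "A \<bullet> A = 0 \<longleftrightarrow> A = 0"
    by (simp add: inner_symmat_eq zero_symmat.rep_eq flip: mat_of_inject)
qed
end

lemma subspace_symmetric: "subspace {A :: real^'n^'n. transpose A = A}"
  by (simp add: subspace_def transpose_def vec_eq_iff)

lemma ex_orthonormal_basis_symmat:
  "\<exists>B :: 'n::finite symmat set. B \<noteq> {} \<and> finite B \<and>
     (\<forall>u\<in>B. \<forall>v\<in>B. u \<bullet> v = (if u = v then 1 else 0)) \<and>
     (\<forall>x. (\<forall>u\<in>B. x \<bullet> u = 0) \<longleftrightarrow> x = 0)"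
proof -
  obtain B :: "(real^'n^'n) set" where B: "B \<subseteq> {A. transpose A = A}" "pairwise orthogonal B"
      "\<And>x. x \<in> B \<Longrightarrow> norm x = 1" "independent B" "span B = {A. transpose A = A}"
    by (rule orthonormal_basis_subspace[OF subspace_symmetric]) blast
  have rep: "mat_of (Symmat A) = A" if "A \<in> B" for A
    using that B(1) by (intro Symmat_inverse) auto
  have zero: "(\<forall>u\<in>Symmat ` B. x \<bullet> u = 0) \<longleftrightarrow> x = 0" for x :: "'n symmat"
  proof
    assume "\<forall>u\<in>Symmat ` B. x \<bullet> u = 0"
    then have "\<forall>u\<in>B. orthogonal (mat_of x) u"
      by (auto simp: inner_symmat_eq rep orthogonal_def)
    moreover have "mat_of x \<in> span B"
      using mat_of B(5) by blast
    ultimately have "orthogonal (mat_of x) (mat_of x)"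
      using orthogonal_to_span by blast
    then show "x = 0"
      by (simp add: orthogonal_def zero_symmat.rep_eq flip: mat_of_inject)
  qed simp
  have "Symmat (mat 1 :: real^'n^'n) \<noteq> 0"
  proof
    assume "Symmat (mat 1 :: real^'n^'n) = 0"
    then have "(mat 1 :: real^'n^'n) = 0"
      using Symmat_inverse[of "mat 1 :: real^'n^'n"] by (simp add: zero_symmat.rep_eq)
    then have "(mat 1 :: real^'n^'n) $ undefined $ undefined = 0"
      by simp
    then show False
      by (simp add: mat_def)
  qed
  then have "Symmat ` B \<noteq> {}"
    using zero[of "Symmat (mat 1)"] by auto
  moreover have "finite (Symmat ` B)"
    using independent_imp_finite[OF B(4)] by (rule finite_imageI)
  moreover have "u \<bullet> v = (if u = v then 1 else 0)"
    if uv: "u \<in> Symmat ` B" "v \<in> Symmat ` B" for u v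
  proof -
    obtain a b where ab: "a \<in> B" "b \<in> B" "u = Symmat a" "v = Symmat b"
      using uv by blast
    have "u \<bullet> v = a \<bullet> b"
      unfolding ab(3,4) inner_symmat_eq rep[OF ab(1)] rep[OF ab(2)] ..
    moreover have "u = v \<longleftrightarrow> a = b"
      unfolding ab(3,4) by (metis rep[OF ab(1)] rep[OF ab(2)])
    moreover have "a \<bullet> b = (if a = b then 1 else 0)"
    proof (cases "a = b")
      case True
      then show ?thesis using B(3)[OF ab(1)] by (simp add: norm_eq_1)
    next
      case False
      then show ?thesis using B(2) ab(1,2) by (simp add: pairwise_def orthogonal_def)
    qed
    ultimately show ?thesis by simp
  qed
  ultimately show ?thesis
    using zero by (intro exI[of _ "Symmat ` B"] conjI ballI allI)
qed

instantiation symmat :: (finite) euclidean_space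
begin
text \<open>The choice of the orthonormal basis is immaterial.\<close>
definition Basis_symmat :: "'a symmat set" where
  "Basis_symmat = (SOME B. B \<noteq> {} \<and> finite B \<and>
     (\<forall>u\<in>B. \<forall>v\<in>B. u \<bullet> v = (if u = v then 1 else 0)) \<and>
     (\<forall>x. (\<forall>u\<in>B. x \<bullet> u = 0) \<longleftrightarrow> x = 0))"
instance
proof
  note * = someI_ex[OF ex_orthonormal_basis_symmat[where 'n='a], folded Basis_symmat_def]
  show "(Basis :: 'a symmat set) \<noteq> {}"
    by (rule *[THEN conjunct1])
  show "finite (Basis :: 'a symmat set)"
    by (rule *[THEN conjunct2, THEN conjunct1])
  show "u \<bullet> v = (if u = v then 1 else 0)" if "u \<in> Basis" "v \<in> Basis" for u v :: "'a symmat"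
    by (rule *[THEN conjunct2, THEN conjunct2, THEN conjunct1, THEN bspec, THEN bspec]) (fact that)+
  show "(\<forall>u\<in>Basis. x \<bullet> u = 0) \<longleftrightarrow> x = 0" for x :: "'a symmat"
    by (rule *[THEN conjunct2, THEN conjunct2, THEN conjunct2, THEN spec])
qed
end


section \<open>Ellipticity\<close>

definition pos_orthant :: "(real^'n) set" where
  "pos_orthant = {x. \<forall>i. x $ i > 0}"

definition pos_def_cone :: "('n::finite symmat) set" where
  "pos_def_cone = {A. \<forall>v. v \<noteq> 0 \<longrightarrow> v \<bullet> (mat_of A *v v) > 0}"

text \<open>Ellipticity of a pair depends on its cone only.\<close>

definition elliptic_vec :: "(real^'n) set \<Rightarrow> bool" where
  "elliptic_vec C \<longleftrightarrow> pos_orthant \<subseteq> C"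

definition elliptic_mat :: "('n::finite symmat) set \<Rightarrow> bool" where
  "elliptic_mat C \<longleftrightarrow> pos_def_cone \<subseteq> C"

end

theory Submission
  imports Defs "HOL-Computational_Algebra.Fundamental_Theorem_Algebra"
begin

text \<open>
  Everything rests on Garding's theorem: each point \<open>a\<close> of the cone \<open>\<Gamma>\<close> is itself a hyperbolic direction, that is,
  \<open>t \<mapsto> g (a + t v)\<close> is \<open>g a\<close> times a product of \<open>N\<close> real factors \<open>1 + t \<mu>\<^sub>i\<close>, and \<open>\<Gamma>\<close> is convex.  The
  roots in the direction \<open>a\<close> are shown to be real by a homotopy of complex polynomials whose roots, before
  its end, never meet the real axis (\<open>hyperbolic_transfer\<close>).  That \<open>\<Gamma>\<close>, given as a connected component, consists of
  the \<open>x\<close> with only negative roots of \<open>t \<mapsto> g (t e + x)\<close>, holds because for real-rooted polynomials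
  this condition can be read off the signs of the coefficients
  (\<open>hyperbolicity_cone_component\<close>); convexity follows as \<open>\<Gamma>\<close> is then star-shaped about each of its
  points.  The locale \<open>garding_cone\<close> collects these properties, which pass to linear pull backs at once.

  Along a line, the first two derivatives of \<open>log g\<close> are the sum of the \<open>\<mu>\<^sub>i\<close> and minus the sum of
  their squares, and all \<open>\<mu>\<^sub>i\<close> vanish iff \<open>v\<close> lies in the edge.  Hence the gradient map \<open>F\<close> of
  \<open>log g\<close> is injective exactly modulo the edge, takes values in the open polar, and has a derivative
  that is definite transversally to the edge.  It is onto the open polar because \<open>g\<close> attains a maximum on
  slices of the closed cone (\<open>F_surjective\<close>), and the inverse function theorem gives a smooth
  section (\<open>smooth_section\<close>).

  For a pull back the chain rule reads \<open>F\<^sub>L = L\<^sup>t \<circ> F \<circ> L\<close>.  Applying the above to both \<open>g\<close> and \<open>g \<circ> L\<close>,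
  each map in the factorization and its inverse are composed of linear maps, \<open>F\<close>
  and the two smooth sections (\<open>gradient_factorization\<close>).  The open polar of \<open>L -` \<Gamma>\<close> lies in
  the image of that of \<open>\<Gamma>\<close> by the chain rule and surjectivity; the converse holds because a member of the
  polar belongs to the open polar iff it vanishes, on the closed cone, only in the edge (\<open>open_polarI\<close>,
  \<open>open_polar_zero\<close>).  The statement on closed polars follows by a limit.  Finally, the positive orthant and the
  cone of positive definite matrices are self-dual, so the open polar of the pulled back cone
  contains such a test cone iff \<open>L\<close> is injective and the pulled back cone lies in the test cone
  (\<open>subset_open_polar_iff\<close>).
\<close>

section \<open>Calculus of smooth maps\<close>

lemma Ck_on_cong:
  assumes "open U" "\<And>x. x \<in> U \<Longrightarrow> f x = g x" "Ck_on k U f"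
  shows "Ck_on k U g"
  using assms(2,3)
proof (induction k arbitrary: f g)
  case 0
  then show ?case
    by (metis Ck_on.simps(1) continuous_on_cong)
next
  case (Suc k)
  have der: "(g has_derivative frechet_derivative f (at x)) (at x)" if "x \<in> U" for x
  proof -
    have "(f has_derivative frechet_derivative f (at x)) (at x)"
      using Suc.prems that by (simp add: frechet_derivative_works)
    then show ?thesis
      using has_derivative_transform_within_open assms(1) that Suc.prems(1) by metis
  qed
  have eq: "frechet_derivative g (at x) = frechet_derivative f (at x)" if "x \<in> U" for x
    using frechet_derivative_at[OF der[OF that]] by simp
  have "Ck_on k U (\<lambda>x. frechet_derivative g (at x) v)" for v
    by (rule Suc.IH[of "\<lambda>x. frechet_derivative f (at x) v"]) (use eq Suc.prems in auto)
  moreover have "\<forall>x\<in>U. g differentiable at x"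
    using der differentiable_def by blast
  ultimately show ?case by simp
qed

lemma Ck_on_SucI:
  assumes "open U" "\<And>x. x \<in> U \<Longrightarrow> (f has_derivative f' x) (at x)"
    and "\<And>v. Ck_on k U (\<lambda>x. f' x v)"
  shows "Ck_on (Suc k) U f"
proof -
  have "Ck_on k U (\<lambda>x. frechet_derivative f (at x) v)" for v
    by (rule Ck_on_cong[OF assms(1) _ assms(3)]) (use frechet_derivative_at[OF assms(2)] in simp)
  moreover have "\<forall>x\<in>U. f differentiable at x"
    using assms(2) differentiable_def by blast
  ultimately show ?thesis by simp
qed

lemma Ck_on_SucD:
  assumes "Ck_on (Suc k) U f" "x \<in> U"
  shows "(f has_derivative frechet_derivative f (at x)) (at x)"
  using assms by (simp add: frechet_derivative_works)

lemma Ck_on_Suc_imp: "Ck_on (Suc k) U f \<Longrightarrow> Ck_on k U f"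
proof (induction k arbitrary: f)
  case 0
  then show ?case
    by (auto intro!: continuous_at_imp_continuous_on differentiable_imp_continuous_within)
next
  case (Suc k)
  then show ?case
    using Ck_on.simps(2) by blast
qed

lemma Ck_on_imp_continuous_on: "Ck_on k U f \<Longrightarrow> continuous_on U f"
  by (induction k) (use Ck_on_Suc_imp in auto)

lemma Ck_on_subset: "Ck_on k U f \<Longrightarrow> V \<subseteq> U \<Longrightarrow> Ck_on k V f"
  by (induction k arbitrary: f) (auto intro: continuous_on_subset)

lemma Ck_on_const: "open U \<Longrightarrow> Ck_on k U (\<lambda>x. c)"
proof (induction k arbitrary: c)
  case (Suc k)
  show ?case
    by (rule Ck_on_SucI[where f' = "\<lambda>x v. 0"]) (use Suc in auto)
qed simp

lemma Ck_on_add: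
  "open U \<Longrightarrow> Ck_on k U f \<Longrightarrow> Ck_on k U g \<Longrightarrow> Ck_on k U (\<lambda>x. f x + g x)"
proof (induction k arbitrary: f g)
  case 0
  then show ?case by (simp add: continuous_on_add)
next
  case (Suc k)
  show ?case
  proof (rule Ck_on_SucI[OF Suc.prems(1)])
    show "((\<lambda>x. f x + g x) has_derivative
        (\<lambda>v. frechet_derivative f (at x) v + frechet_derivative g (at x) v)) (at x)" if "x \<in> U" for x
      using Ck_on_SucD Suc.prems that by (intro has_derivative_add) blast+
    fix v
    show "Ck_on k U (\<lambda>x. frechet_derivative f (at x) v + frechet_derivative g (at x) v)"
      by (rule Suc.IH[OF Suc.prems(1)]) (use Suc.prems in simp_all)
  qed
qed

lemma Ck_on_linear_compose:
  "open U \<Longrightarrow> linear l \<Longrightarrow> Ck_on k U f \<Longrightarrow> Ck_on k U (\<lambda>x. l (f x))"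
proof (induction k arbitrary: f)
  case 0
  then show ?case
    by (simp add: linear_continuous_on_compose)
next
  case (Suc k)
  have l: "bounded_linear l"
    using Suc.prems(2) linear_conv_bounded_linear by blast
  show ?case
  proof (rule Ck_on_SucI[OF Suc.prems(1)])
    show "((\<lambda>x. l (f x)) has_derivative (\<lambda>v. l (frechet_derivative f (at x) v))) (at x)" if "x \<in> U" for x
      using Ck_on_SucD[OF Suc.prems(3) that] by (rule bounded_linear.has_derivative[OF l])
    fix v
    show "Ck_on k U (\<lambda>x. l (frechet_derivative f (at x) v))"
      by (rule Suc.IH[OF Suc.prems(1,2)]) (use Suc.prems in simp)
  qed
qed

lemma Ck_on_linear:
  assumes "open U" "linear l" shows "Ck_on k U l"
proof -
  have "Ck_on k U (\<lambda>x. x)"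
  proof (cases k)
    case (Suc m)
    then show ?thesis
      using assms(1) by (auto intro!: Ck_on_SucI Ck_on_const)
  qed simp
  then show ?thesis
    using Ck_on_linear_compose[OF assms] by blast
qed

lemma Ck_on_bilinear:
  assumes "open U" "bounded_bilinear p"
  shows "Ck_on k U f \<Longrightarrow> Ck_on k U g \<Longrightarrow> Ck_on k U (\<lambda>x. p (f x) (g x))"
proof (induction k arbitrary: f g)
  case 0
  then show ?case
    using bounded_bilinear.continuous_on[OF assms(2)] by auto
next
  case (Suc k)
  show ?case
  proof (rule Ck_on_SucI[OF assms(1)])
    show "((\<lambda>x. p (f x) (g x)) has_derivative
        (\<lambda>v. p (f x) (frechet_derivative g (at x) v) + p (frechet_derivative f (at x) v) (g x))) (at x)"
      if "x \<in> U" for x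
      using Ck_on_SucD[OF Suc.prems(1) that] Ck_on_SucD[OF Suc.prems(2) that]
      by (rule bounded_bilinear.FDERIV[OF assms(2)])
    fix v
    show "Ck_on k U (\<lambda>x. p (f x) (frechet_derivative g (at x) v) + p (frechet_derivative f (at x) v) (g x))"
      by (intro Ck_on_add assms Suc.IH) (use Suc.prems Ck_on_Suc_imp in auto)
  qed
qed

lemmas Ck_on_mult = Ck_on_bilinear[OF _ bounded_bilinear_mult]
  and Ck_on_scaleR = Ck_on_bilinear[OF _ bounded_bilinear_scaleR]
  and Ck_on_inner = Ck_on_bilinear[OF _ bounded_bilinear_inner]

lemma Ck_on_sum:
  assumes "open U" "\<And>i. i \<in> I \<Longrightarrow> Ck_on k U (f i)"
  shows "Ck_on k U (\<lambda>x. \<Sum>i\<in>I. f i x)"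
  using assms(2)
  by (induction I rule: infinite_finite_induct) (auto intro: Ck_on_const Ck_on_add assms(1))

text \<open>
  The directional derivative of \<open>f \<circ> g\<close> is expanded in the coordinates of that of \<open>g\<close>, because
  \<^const>\<open>Ck_on\<close> speaks about the derivative of \<open>f\<close> in one fixed direction at a time.
\<close>

lemma Ck_on_compose:
  assumes "open U" "open V" "g ` U \<subseteq> V"
  shows "Ck_on k U g \<Longrightarrow> Ck_on k V f \<Longrightarrow> Ck_on k U (\<lambda>x. f (g x))"
proof (induction k arbitrary: f)
  case 0
  then show ?case
    using assms continuous_on_compose2 by auto
next
  case (Suc k)
  let ?Dg = "\<lambda>x. frechet_derivative g (at x)" and ?Df = "\<lambda>y. frechet_derivative f (at y)"
  show ?case
  proof (rule Ck_on_SucI[OF assms(1)])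
    fix x assume x: "x \<in> U"
    have g: "(g has_derivative ?Dg x) (at x)" and f: "(f has_derivative ?Df (g x)) (at (g x))"
      using Suc.prems x assms(3) Ck_on_SucD by blast+
    have "?Df (g x) w = (\<Sum>b\<in>Basis. (w \<bullet> b) *\<^sub>R ?Df (g x) b)" for w
    proof -
      have lin: "linear (?Df (g x))"
        using f has_derivative_linear by blast
      have "?Df (g x) (\<Sum>b\<in>Basis. (w \<bullet> b) *\<^sub>R b) = (\<Sum>b\<in>Basis. (w \<bullet> b) *\<^sub>R ?Df (g x) b)"
        by (simp add: linear_sum[OF lin] linear_cmul[OF lin])
      then show ?thesis by (simp add: euclidean_representation)
    qed
    then show "((\<lambda>x. f (g x)) has_derivative
        (\<lambda>v. \<Sum>b\<in>Basis. (?Dg x v \<bullet> b) *\<^sub>R ?Df (g x) b)) (at x)"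
      by (intro has_derivative_eq_rhs[OF has_derivative_compose[OF g f]] ext)
  next
    fix v
    show "Ck_on k U (\<lambda>x. \<Sum>b\<in>Basis. (?Dg x v \<bullet> b) *\<^sub>R ?Df (g x) b)"
    proof (intro Ck_on_sum Ck_on_scaleR assms(1))
      fix b :: 'b assume "b \<in> Basis"
      show "Ck_on k U (\<lambda>x. ?Dg x v \<bullet> b)"
        by (rule Ck_on_inner[OF assms(1)]) (use Suc.prems Ck_on_const assms(1) in auto)
      show "Ck_on k U (\<lambda>x. ?Df (g x) b)"
        by (rule Suc.IH) (use Suc.prems Ck_on_Suc_imp in auto)
    qed
  qed
qed

lemma Ck_on_inverse:
  fixes f :: "'a::euclidean_space \<Rightarrow> real"
  assumes "open U" "\<And>x. x \<in> U \<Longrightarrow> f x \<noteq> 0"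
  shows "Ck_on k U f \<Longrightarrow> Ck_on k U (\<lambda>x. inverse (f x))"
proof (induction k)
  case 0
  then show ?case using assms by (simp add: continuous_on_inverse)
next
  case (Suc k)
  show ?case
  proof (rule Ck_on_SucI[OF assms(1)])
    show "((\<lambda>x. inverse (f x)) has_derivative
        (\<lambda>v. - (inverse (f x) * frechet_derivative f (at x) v * inverse (f x)))) (at x)" if "x \<in> U" for x
      using assms(2)[OF that] Ck_on_SucD[OF Suc.prems that] by (rule Deriv.has_derivative_inverse)
    fix v
    have "Ck_on k U (\<lambda>x. -1 * (inverse (f x) * frechet_derivative f (at x) v * inverse (f x)))"
      by (intro Ck_on_mult Ck_on_const Suc.IH assms(1)) (use Suc.prems Ck_on_Suc_imp in auto)
    then show "Ck_on k U (\<lambda>x. - (inverse (f x) * frechet_derivative f (at x) v * inverse (f x)))"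
      by simp
  qed
qed

lemma Ck_on_real_polynomial_function:
  fixes g :: "'a::euclidean_space \<Rightarrow> real"
  assumes "open U"
  shows "real_polynomial_function g \<Longrightarrow> Ck_on k U g"
  by (induction rule: real_polynomial_function.induct)
    (auto intro: Ck_on_linear Ck_on_const Ck_on_add Ck_on_mult assms bounded_linear.linear)

text \<open>
  \<open>H v x\<close> is the solution \<open>u\<close> of \<open>M x u = v\<close>.  Its differentiability in \<open>x\<close> comes from the
  inverse function theorem for \<open>(x, u) \<mapsto> (x, M x u)\<close>, whose inverse is \<open>(x, v) \<mapsto> (x, H v x)\<close>.
  Differentiating \<open>M x (H v x) = v\<close> then writes the derivative of \<open>H v\<close> through \<open>H\<close> and the
  derivative of \<open>M\<close>, so that one degree of smoothness is gained at a time.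
\<close>

lemma Ck_on_linear_solution:
  fixes M :: "'a::euclidean_space \<Rightarrow> 'b::euclidean_space \<Rightarrow> 'b"
  assumes U: "open U" and M: "\<And>u k. Ck_on k U (\<lambda>x. M x u)"
    and lin: "\<And>x. x \<in> U \<Longrightarrow> linear (M x)"
    and MH: "\<And>x v. x \<in> U \<Longrightarrow> M x (H v x) = v"
    and HM: "\<And>x v. x \<in> U \<Longrightarrow> H (M x v) x = v"
  shows "Ck_on k U (H v)"
proof -
  define DM where "DM x w u = (\<Sum>c\<in>Basis. (u \<bullet> c) *\<^sub>R frechet_derivative (\<lambda>x. M x c) (at x) w)" for x w u
  have Mexp: "M x u = (\<Sum>c\<in>Basis. (u \<bullet> c) *\<^sub>R M x c)" if "x \<in> U" for x u
  proof -
    have "M x (\<Sum>c\<in>Basis. (u \<bullet> c) *\<^sub>R c) = (\<Sum>c\<in>Basis. (u \<bullet> c) *\<^sub>R M x c)"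
      by (simp add: linear_sum[OF lin[OF that]] linear_cmul[OF lin[OF that]])
    then show ?thesis by (simp add: euclidean_representation)
  qed
  have linH: "linear (\<lambda>v. H v x)" if "x \<in> U" for x
  proof (rule linearI)
    show "H (a + b) x = H a x + H b x" for a b
      using HM[OF that, of "H a x + H b x"] MH[OF that] linear_add[OF lin[OF that]] by simp
    show "H (r *\<^sub>R a) x = r *\<^sub>R H a x" for r a
      using HM[OF that, of "r *\<^sub>R H a x"] MH[OF that] linear_cmul[OF lin[OF that]] by simp
  qed
  have derM: "((\<lambda>x. M x c) has_derivative frechet_derivative (\<lambda>x. M x c) (at x)) (at x)" if "x \<in> U" for x c
    using Ck_on_SucD[OF M that] .
  define f where "f = (\<lambda>z. (fst z, \<Sum>c\<in>Basis. (snd z \<bullet> c) *\<^sub>R M (fst z) c))"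
  define h where "h = (\<lambda>z. (fst z, H (snd z) (fst z)))"
  let ?S = "U \<times> (UNIV :: 'b set)"
  have f_eq: "f (x, u) = (x, M x u)" if "x \<in> U" for x u
    by (simp add: f_def flip: Mexp[OF that])
  have derf: "(f has_derivative (\<lambda>(w, z). (w, DM x w u + M x z))) (at (x, u))" if x: "x \<in> U" for x u
  proof -
    have 1: "((\<lambda>z. M (fst z) c) has_derivative (\<lambda>z. frechet_derivative (\<lambda>x. M x c) (at x) (fst z))) (at (x, u))" for c
      using has_derivative_compose[of fst fst "(x,u)" UNIV "\<lambda>x. M x c"] derM[OF x, of c]
      by (simp add: has_derivative_fst)
    have "(f has_derivative (\<lambda>z. (fst z, \<Sum>c\<in>Basis. (u \<bullet> c) *\<^sub>R frechet_derivative (\<lambda>x. M x c) (at x) (fst z)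
        + (snd z \<bullet> c) *\<^sub>R M x c))) (at (x, u))"
      unfolding f_def by (auto intro!: derivative_eq_intros 1)
    moreover have "(\<lambda>z. (fst z, \<Sum>c\<in>Basis. (u \<bullet> c) *\<^sub>R frechet_derivative (\<lambda>x. M x c) (at x) (fst z)
        + (snd z \<bullet> c) *\<^sub>R M x c)) = (\<lambda>(w, z). (w, DM x w u + M x z))"
      by (simp add: fun_eq_iff split_def DM_def sum.distrib flip: Mexp[OF x])
    ultimately show ?thesis by simp
  qed
  have contf: "continuous_on ?S f"
    using derf by (intro continuous_at_imp_continuous_on) (auto dest: has_derivative_continuous)
  have derh: "(h has_derivative (\<lambda>(w, z). (w, H (z - DM x w (H v x)) x))) (at (x, v))" if x: "x \<in> U" for x v
  proof -
    have "(h has_derivative (\<lambda>(w, z). (w, H (z - DM x w (H v x)) x))) (at (f (x, H v x)))"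
    proof (rule has_derivative_inverse_strong[OF _ _ contf _ derf[OF x]])
      show "open ?S" using U by (simp add: open_Times)
      show "h (f z) = z" if "z \<in> ?S" for z
        using that by (cases z) (simp add: f_eq h_def HM)
      show "(\<lambda>(w, z). (w, DM x w (H v x) + M x z)) \<circ> (\<lambda>(w, z). (w, H (z - DM x w (H v x)) x)) = id"
        by (auto simp: fun_eq_iff MH[OF x])
    qed (use x in auto)
    then show ?thesis by (simp add: f_eq x MH)
  qed
  have derH: "(H v has_derivative (\<lambda>w. - H (DM x w (H v x)) x)) (at x)" if x: "x \<in> U" for x v
  proof -
    have "((\<lambda>x. h (x, v)) has_derivative (\<lambda>w. (\<lambda>(w, z). (w, H (z - DM x w (H v x)) x)) (w, 0))) (at x)"
      by (rule has_derivative_compose[of "\<lambda>x. (x, v)" "\<lambda>w. (w, 0)", OF _ derh[OF x]])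
        (auto intro!: derivative_eq_intros)
    then have "((\<lambda>x. snd (h (x, v))) has_derivative (\<lambda>w. snd ((\<lambda>(w, z). (w, H (z - DM x w (H v x)) x)) (w, 0)))) (at x)"
      by (rule has_derivative_snd)
    moreover have "H (0 - y) x = - H y x" for y
      using linear_neg[OF linH[OF x]] by simp
    ultimately show ?thesis by (simp add: h_def)
  qed
  have "Ck_on k U (H v)" for v
  proof (induction k arbitrary: v)
    case 0
    show ?case
      using derH by (auto intro!: continuous_at_imp_continuous_on dest: has_derivative_continuous)
  next
    case (Suc k)
    show ?case
    proof (rule Ck_on_SucI[OF U])
      fix x assume x: "x \<in> U"
      have Hexp: "H y x = (\<Sum>b\<in>Basis. (y \<bullet> b) *\<^sub>R H b x)" for y
      proof -
        have "H (\<Sum>b\<in>Basis. (y \<bullet> b) *\<^sub>R b) x = (\<Sum>b\<in>Basis. (y \<bullet> b) *\<^sub>R H b x)"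
          by (simp add: linear_sum[OF linH[OF x]] linear_cmul[OF linH[OF x]])
        then show ?thesis by (simp add: euclidean_representation)
      qed
      show "(H v has_derivative (\<lambda>w. -1 *\<^sub>R (\<Sum>b\<in>Basis. (DM x w (H v x) \<bullet> b) *\<^sub>R H b x))) (at x)"
        by (rule has_derivative_eq_rhs[OF derH[OF x, of v]])
          (simp add: Hexp[of "DM x _ (H v x)"] fun_eq_iff)
    next
      fix w
      have DM: "Ck_on k U (\<lambda>x. DM x w (H v x))"
        unfolding DM_def
        by (intro Ck_on_sum Ck_on_scaleR Ck_on_inner Ck_on_const U Suc.IH)
          (use M[of "Suc k"] in auto)
      show "Ck_on k U (\<lambda>x. -1 *\<^sub>R (\<Sum>b\<in>Basis. (DM x w (H v x) \<bullet> b) *\<^sub>R H b x))"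
        by (intro Ck_on_sum Ck_on_scaleR Ck_on_inner Ck_on_const U Suc.IH DM)
    qed
  qed
  then show ?thesis .
qed

text \<open>
  The derivative of the inverse at \<open>y\<close> solves a linear equation whose coefficients are smooth
  functions of the inverse at \<open>y\<close>, so each order of smoothness of the inverse yields the next.
\<close>

lemma Ck_on_inverse_function:
  fixes f :: "'a::euclidean_space \<Rightarrow> 'a"
  assumes U: "open U" and f: "\<And>k. Ck_on k U f" and inj: "inj_on f U"
    and inj': "\<And>x. x \<in> U \<Longrightarrow> inj (frechet_derivative f (at x))"
  shows "open (f ` U) \<and> Ck_on k (f ` U) (inv_into U f)"
proof -
  let ?D = "\<lambda>x. frechet_derivative f (at x)" and ?g = "inv_into U f"
  have cont: "continuous_on U f"
    using f Ck_on_imp_continuous_on by blast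
  have op: "open (f ` U)"
    using invariance_of_domain[OF cont U inj] .
  have der: "(f has_derivative ?D x) (at x)" if "x \<in> U" for x
    using Ck_on_SucD[OF f that] .
  have lin: "linear (?D x)" if "x \<in> U" for x
    using der[OF that] has_derivative_linear by blast
  have surj: "surj (?D x)" if "x \<in> U" for x
    using lin[OF that] inj'[OF that] linear_injective_imp_surjective by blast
  have inv1: "?D x (inv (?D x) v) = v" if "x \<in> U" for x v
    using surj[OF that] by (simp add: surj_f_inv_f)
  have inv2: "inv (?D x) (?D x v) = v" if "x \<in> U" for x v
    using inj'[OF that] by simp
  have sm: "Ck_on k U (\<lambda>x. inv (?D x) v)" for k v
    by (rule Ck_on_linear_solution[where M = ?D, OF U _ lin])
      (use f[of "Suc _"] inv1 inv2 in auto)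
  have gU: "?g ` (f ` U) \<subseteq> U"
    by (auto intro: inv_into_into)
  have derg: "(?g has_derivative inv (?D (?g y))) (at y)" if "y \<in> f ` U" for y
  proof -
    obtain x where x: "x \<in> U" "y = f x" using \<open>y \<in> f ` U\<close> by blast
    have "(?g has_derivative inv (?D x)) (at (f x))"
      by (rule has_derivative_inverse_strong[OF U x(1) cont _ der[OF x(1)]])
        (use inj inv1[OF x(1)] in \<open>auto simp: fun_eq_iff\<close>)
    then show ?thesis using x inj by simp
  qed
  have "Ck_on k (f ` U) ?g"
  proof (induction k)
    case 0
    show ?case
      using derg by (auto intro!: continuous_at_imp_continuous_on dest: has_derivative_continuous)
  next
    case (Suc k)
    show ?case
      by (rule Ck_on_SucI[OF op derg]) (auto intro!: Ck_on_compose[OF op U gU Suc sm])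
  qed
  then show ?thesis using op by blast
qed

lemma smooth_map_onI:
  "open U \<Longrightarrow> A \<subseteq> U \<Longrightarrow> (\<And>k. Ck_on k U f) \<Longrightarrow> smooth_map_on A f"
  unfolding smooth_map_on_def by blast

lemma smooth_map_on_linear: "linear f \<Longrightarrow> smooth_map_on A f"
  using smooth_map_onI[of UNIV A f] Ck_on_linear by blast

lemma smooth_map_onE:
  assumes "smooth_map_on A f" "x \<in> A"
  obtains U \<phi> where "open U" "x \<in> U" "\<forall>k. Ck_on k U \<phi>" "\<forall>y\<in>A \<inter> U. f y = \<phi> y"
proof -
  have "\<exists>U \<phi>. open U \<and> x \<in> U \<and> (\<forall>k. Ck_on k U \<phi>) \<and> (\<forall>y\<in>A \<inter> U. f y = \<phi> y)"
    using assms unfolding smooth_map_on_def by (rule bspec)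
  then obtain U \<phi> where "open U \<and> x \<in> U \<and> (\<forall>k. Ck_on k U \<phi>) \<and> (\<forall>y\<in>A \<inter> U. f y = \<phi> y)"
    by (elim exE)
  then show ?thesis
    by (intro that[of U \<phi>]) simp_all
qed

lemma smooth_map_on_cong:
  assumes f: "smooth_map_on B f" and AB: "A \<subseteq> B" and g: "\<And>x. x \<in> A \<Longrightarrow> g x = f x"
  shows "smooth_map_on A g"
  unfolding smooth_map_on_def
proof
  fix x assume "x \<in> A"
  then have xB: "x \<in> B" using AB by blast
  obtain U \<phi> where U: "open U" "x \<in> U" "\<forall>k. Ck_on k U \<phi>" "\<forall>y\<in>B \<inter> U. f y = \<phi> y"
    by (rule smooth_map_onE[OF f xB])
  have "\<forall>y\<in>A \<inter> U. g y = \<phi> y"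
    using U(4) AB g by auto
  then show "\<exists>U \<phi>. open U \<and> x \<in> U \<and> (\<forall>k. Ck_on k U \<phi>) \<and> (\<forall>y\<in>A \<inter> U. g y = \<phi> y)"
    by (intro exI[of _ U] exI[of _ \<phi>] conjI allI U)
qed

lemma smooth_map_on_compose:
  assumes f: "smooth_map_on A f" and g: "smooth_map_on B g" and AB: "f ` A \<subseteq> B"
  shows "smooth_map_on A (\<lambda>x. g (f x))"
  unfolding smooth_map_on_def
proof
  fix x assume x: "x \<in> A"
  obtain U \<phi> where U: "open U" "x \<in> U" "\<forall>k. Ck_on k U \<phi>" "\<forall>y\<in>A \<inter> U. f y = \<phi> y"
    by (rule smooth_map_onE[OF f x])
  have fx: "f x \<in> B" using x AB by blast
  obtain V \<psi> where V: "open V" "f x \<in> V" "\<forall>k. Ck_on k V \<psi>" "\<forall>y\<in>B \<inter> V. g y = \<psi> y"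
    by (rule smooth_map_onE[OF g fx])
  let ?U = "U \<inter> \<phi> -` V"
  have "open ?U"
    using continuous_open_preimage[OF Ck_on_imp_continuous_on[OF spec[OF U(3)]] U(1) V(1)] .
  moreover have "x \<in> ?U" using U x V by auto
  moreover have "Ck_on k ?U (\<lambda>x. \<psi> (\<phi> x))" for k
    by (rule Ck_on_compose[OF \<open>open ?U\<close> V(1) _ Ck_on_subset[OF spec[OF U(3)]] spec[OF V(3)]]) auto
  moreover have "\<forall>y\<in>A \<inter> ?U. g (f y) = \<psi> (\<phi> y)"
    using U(4) V(4) AB by fastforce
  ultimately show "\<exists>U \<phi>. open U \<and> x \<in> U \<and> (\<forall>k. Ck_on k U \<phi>) \<and> (\<forall>y\<in>A \<inter> U. g (f y) = \<phi> y)"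
    by (intro exI[of _ ?U] exI[of _ "\<lambda>x. \<psi> (\<phi> x)"] conjI allI)
qed

section \<open>Polynomials along lines\<close>

lemma real_polynomial_function_along_line:
  fixes g :: "'v::euclidean_space \<Rightarrow> real"
  assumes "real_polynomial_function g"
  shows "\<exists>P :: 'v \<Rightarrow> real poly. (\<forall>v t. poly (P v) t = g (t *\<^sub>R e + v)) \<and>
           (\<forall>k. continuous_on UNIV (\<lambda>v. coeff (P v) k))"
  using assms
proof (induction rule: real_polynomial_function.induct)
  case (linear f)
  interpret bounded_linear f by fact
  show ?case
  proof (intro exI[of _ "\<lambda>v. [:f v, f e:]"] conjI allI)
    fix k
    show "continuous_on UNIV (\<lambda>v. coeff [:f v, f e:] k)"
      using continuous_on_id by (cases k) (auto simp: coeff_pCons split: nat.split intro: continuous_on)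
  qed (simp add: add scaleR)
next
  case (const c)
  show ?case by (intro exI[of _ "\<lambda>v. [:c:]"]) auto
next
  case (add f g)
  then obtain P Q where "\<forall>v t. poly (P v) t = f (t *\<^sub>R e + v)" "\<forall>k. continuous_on UNIV (\<lambda>v. coeff (P v) k)"
    "\<forall>v t. poly (Q v) t = g (t *\<^sub>R e + v)" "\<forall>k. continuous_on UNIV (\<lambda>v. coeff (Q v) k)" by blast
  then show ?case
    by (intro exI[of _ "\<lambda>v. P v + Q v"]) (auto intro: continuous_on_add)
next
  case (mult f g)
  then obtain P Q where "\<forall>v t. poly (P v) t = f (t *\<^sub>R e + v)" "\<forall>k. continuous_on UNIV (\<lambda>v. coeff (P v) k)"
    "\<forall>v t. poly (Q v) t = g (t *\<^sub>R e + v)" "\<forall>k. continuous_on UNIV (\<lambda>v. coeff (Q v) k)" by blast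
  then show ?case
    by (intro exI[of _ "\<lambda>v. P v * Q v"])
      (auto simp: coeff_mult intro!: continuous_on_sum continuous_on_mult)
qed

lemma poly_eqI_except_zero:
  fixes p q :: "'a::field_char_0 poly"
  assumes "\<And>t. t \<noteq> 0 \<Longrightarrow> poly p t = poly q t"
  shows "p = q"
proof (rule ccontr)
  assume "p \<noteq> q"
  then have "finite {t. poly (p - q) t = 0}"
    using poly_roots_finite[of "p - q"] by simp
  moreover have "- {0} \<subseteq> {t. poly (p - q) t = 0}"
    using assms by auto
  ultimately have "finite (- {0::'a})"
    using finite_subset by blast
  then show False
    by (metis Compl_eq_Diff_UNIV finite.emptyI finite_Diff2 finite_insert infinite_UNIV_char_0)
qed

text \<open>
  For a homogeneous \<open>g\<close> this applies to \<open>p t = g (t e + v)\<close> and \<open>q t = g (e + t v)\<close>: up to a power of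
  the variable, the coefficients of \<open>p\<close> are those of \<open>q\<close> in reverse order, and \<open>q 0 = g e\<close>.
\<close>

lemma degree_of_reversed:
  fixes p q :: "'a::field_char_0 poly"
  assumes pq: "\<And>t. t \<noteq> 0 \<Longrightarrow> poly p t = t ^ N * poly q (1 / t)" and q0: "poly q 0 \<noteq> 0"
  shows "degree p = N \<and> lead_coeff p = poly q 0"
proof -
  let ?r = "reflect_poly p"
  have "poly (monom 1 N * ?r) t = poly (monom 1 (degree p) * q) t" if "t \<noteq> 0" for t
    using pq[of "1 / t"] that by (simp add: poly_reflect_poly_nz poly_monom field_simps)
  then have eq: "monom 1 N * ?r = monom 1 (degree p) * q"
    by (rule poly_eqI_except_zero)
  have "q \<noteq> 0" using q0 by auto
  then have "p \<noteq> 0"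
    using eq by auto
  then have "poly ?r 0 \<noteq> 0" by simp
  have "order 0 (monom 1 N * ?r) = N"
    using \<open>p \<noteq> 0\<close> \<open>poly ?r 0 \<noteq> 0\<close> by (subst order_mult) (auto simp: order_0I)
  moreover have "order 0 (monom 1 (degree p) * q) = degree p"
    using \<open>q \<noteq> 0\<close> q0 by (subst order_mult) (auto simp: order_0I)
  ultimately have "degree p = N" using eq by simp
  then have "?r = q" using eq by simp
  then show ?thesis
    using \<open>degree p = N\<close> by (metis poly_reflect_poly_0)
qed

lemma poly_split_of_all_roots:
  fixes p :: "'a::field poly"
  assumes "p \<noteq> 0" "size (proots p) = degree p"
  shows "p = smult (lead_coeff p) (\<Prod>x\<in>#proots p. [:-x, 1:])"
  using assms
proof (induction "degree p" arbitrary: p)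
  case 0
  then show ?case
    by (auto elim!: degree_eq_zeroE)
next
  case (Suc n)
  then have "proots p \<noteq> {#}" by auto
  then obtain x where "x \<in># proots p" by blast
  then have "[:-x, 1:] dvd p"
    using Suc.prems by (simp add: poly_eq_0_iff_dvd)
  then obtain q where p: "p = [:-x, 1:] * q" by blast
  then have "q \<noteq> 0" using Suc.prems by auto
  then have deg: "degree p = Suc (degree q)"
    unfolding p by (subst degree_mult_eq) auto
  have roots: "proots p = add_mset x (proots q)"
    using \<open>q \<noteq> 0\<close> unfolding p by (subst proots_mult) auto
  have q: "q = smult (lead_coeff q) (\<Prod>x\<in>#proots q. [:-x, 1:])"
    using Suc deg roots \<open>q \<noteq> 0\<close> by auto
  have lead: "lead_coeff p = lead_coeff q"
    unfolding p lead_coeff_mult by simp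
  have "smult (lead_coeff p) (\<Prod>x\<in>#proots p. [:-x, 1:]) =
      [:-x, 1:] * smult (lead_coeff q) (\<Prod>x\<in>#proots q. [:-x, 1:])"
    by (simp only: lead roots image_mset_add_mset prod_mset.add_mset mult_smult_right)
  also have "\<dots> = p"
    by (simp only: q[symmetric] p)
  finally show ?case ..
qed

lemma indexed_multisetE:
  assumes "size A = N"
  obtains \<mu> :: "nat \<Rightarrow> 'a" where "A = mset (map \<mu> [0..<N])"
proof -
  obtain xs where xs: "A = mset xs" using ex_mset by metis
  then have "length xs = N" using assms by simp
  then have "map (\<lambda>i. xs ! i) [0..<N] = xs"
    using map_nth by blast
  then show ?thesis using that xs by metis
qed


section \<open>Hyperbolic directions\<close>

text \<open>If \<open>g a \<noteq> 0\<close>, the numbers \<open>- \<mu> i\<close> are the roots of \<open>t \<mapsto> g (t a + v)\<close>, repeated according to multiplicity.\<close>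

definition hyperbolic :: "nat \<Rightarrow> ('v::euclidean_space \<Rightarrow> real) \<Rightarrow> 'v \<Rightarrow> bool" where
  "hyperbolic N g a \<longleftrightarrow> (\<forall>v. \<exists>\<mu>. \<forall>t. g (t *\<^sub>R a + v) = g a * (\<Prod>i<N. t + \<mu> i))"

text \<open>
  By homogeneity \<open>p\<close> has degree \<open>N\<close>, so its real roots account for all of it.
\<close>

lemma hyperbolicI_real_rooted:
  fixes g :: "'v::euclidean_space \<Rightarrow> real"
  assumes poly: "real_polynomial_function g" and hom: "\<And>t x. g (t *\<^sub>R x) = t ^ N * g x"
    and ge: "g e \<noteq> 0"
    and roots: "\<And>v. \<exists>p :: real poly. (\<forall>t. poly p t = g (t *\<^sub>R e + v)) \<and> p \<noteq> 0 \<and>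
                  (\<Sum>t | poly p t = 0. order t p) = N"
  shows "hyperbolic N g e"
  unfolding hyperbolic_def
proof
  fix v
  obtain p where p: "\<And>t. poly p t = g (t *\<^sub>R e + v)" "p \<noteq> 0" "(\<Sum>t | poly p t = 0. order t p) = N"
    using roots by blast
  obtain Q where Q: "\<And>w t. poly (Q w) t = g (t *\<^sub>R v + w)"
    using real_polynomial_function_along_line[OF poly] by blast
  have "poly p t = t ^ N * poly (Q e) (1 / t)" if "t \<noteq> 0" for t
    using that by (simp add: p(1) Q scaleR_add_right add.commute flip: hom)
  then have deg: "degree p = N" "lead_coeff p = g e"
    using degree_of_reversed[of p N "Q e"] ge Q[of e 0] by auto
  have "size (proots p) = N"
    using p(2,3) by (simp add: size_multiset_overloaded_eq)
  then obtain \<mu> where \<mu>: "proots p = mset (map \<mu> [0..<N])"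
    by (rule indexed_multisetE)
  have "p = smult (g e) (\<Prod>x\<in>#proots p. [:-x, 1:])"
    using poly_split_of_all_roots[OF p(2)] deg \<open>size (proots p) = N\<close> by auto
  then have "poly p t = poly (smult (g e) (\<Prod>x\<in>#proots p. [:-x, 1:])) t" for t
    by (rule arg_cong)
  then have "poly p t = g e * (\<Prod>x\<in>#proots p. t - x)" for t
    by (simp add: poly_prod_mset image_mset.compositionality comp_def)
  then have "g (t *\<^sub>R e + v) = g e * (\<Prod>i<N. t + - \<mu> i)" for t
    unfolding p(1)[symmetric] \<mu>
    by (simp add: prod_mset_prod_list prod.list_conv_set_nth lessThan_atLeast0 flip: mset_map)
  then show "\<exists>\<mu>. \<forall>t. g (t *\<^sub>R e + v) = g e * (\<Prod>i<N. t + \<mu> i)"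
    by (intro exI[of _ "\<lambda>i. - \<mu> i"] allI)
qed

lemma hyperbolic_scaled:
  assumes "hyperbolic N g a" and hom: "\<And>t x. g (t *\<^sub>R x) = t ^ N * g x"
  shows "\<exists>\<mu>. (\<forall>t. g (t *\<^sub>R a + v) = g a * (\<Prod>i<N. t + \<mu> i)) \<and>
             (\<forall>t s. g (t *\<^sub>R a + s *\<^sub>R v) = g a * (\<Prod>i<N. t + s * \<mu> i))"
proof -
  obtain \<mu> where \<mu>: "\<And>t. g (t *\<^sub>R a + v) = g a * (\<Prod>i<N. t + \<mu> i)"
    using assms(1) unfolding hyperbolic_def by metis
  have "g (t *\<^sub>R a + s *\<^sub>R v) = g a * (\<Prod>i<N. t + s * \<mu> i)" for t s
  proof (cases "s = 0")
    case True
    then show ?thesis by (simp add: hom)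
  next
    case False
    have "g (t *\<^sub>R a + s *\<^sub>R v) = g (s *\<^sub>R ((t / s) *\<^sub>R a + v))"
      using False by (simp add: scaleR_add_right)
    also have "\<dots> = g a * (s ^ N * (\<Prod>i<N. t / s + \<mu> i))"
      by (simp only: hom \<mu> mult.left_commute)
    also have "s ^ N * (\<Prod>i<N. t / s + \<mu> i) = (\<Prod>i<N. s * (t / s + \<mu> i))"
      by (simp add: prod.distrib)
    also have "\<dots> = (\<Prod>i<N. t + s * \<mu> i)"
      using False by (simp add: distrib_left)
    finally show ?thesis .
  qed
  then show ?thesis using \<mu> by blast
qed

text \<open>
  For hyperbolic \<open>e\<close> with \<open>g e > 0\<close> these are the \<open>x\<close> for which all roots of \<open>t \<mapsto> g (t e + x)\<close> are
  negative.
\<close>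

definition hyperbolicity_cone :: "('v::euclidean_space \<Rightarrow> real) \<Rightarrow> 'v \<Rightarrow> 'v set" where
  "hyperbolicity_cone g e = {x. \<forall>t\<ge>0. g (t *\<^sub>R e + x) > 0}"

lemma coeff_prod_linear_factors:
  fixes \<mu> :: "nat \<Rightarrow> real"
  assumes "\<And>i. i < N \<Longrightarrow> \<mu> i > 0"
  shows "coeff (\<Prod>i<N. [:\<mu> i, 1:]) k \<ge> 0 \<and> (k \<le> N \<longrightarrow> coeff (\<Prod>i<N. [:\<mu> i, 1:]) k > 0)"
  using assms
proof (induction N arbitrary: k)
  case 0
  then show ?case by (simp add: coeff_1)
next
  case (Suc N)
  let ?q = "\<Prod>i<N. [:\<mu> i, 1:]"
  have \<mu>: "\<mu> N > 0" and IH: "coeff ?q k \<ge> 0" "k \<le> N \<Longrightarrow> coeff ?q k > 0" for k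
    using Suc by auto
  have "(\<Prod>i<Suc N. [:\<mu> i, 1:]) = smult (\<mu> N) ?q + pCons 0 ?q"
    by (simp add: mult.commute)
  then have c: "coeff (\<Prod>i<Suc N. [:\<mu> i, 1:]) k = \<mu> N * coeff ?q k + (case k of 0 \<Rightarrow> 0 | Suc j \<Rightarrow> coeff ?q j)"
    by (simp add: coeff_pCons)
  have nonneg: "\<mu> N * coeff ?q k \<ge> 0"
    using \<mu> IH(1) by simp
  show ?case
  proof (cases k)
    case 0
    then show ?thesis using \<mu> IH(1)[of 0] IH(2)[of 0] c by simp
  next
    case (Suc j)
    then show ?thesis using c nonneg IH(1)[of j] IH(2)[of j] by auto
  qed
qed

text \<open>
  All roots of the real-rooted polynomial \<open>t \<mapsto> g (t e + x)\<close> are negative iff its coefficients are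
  all positive; where its constant coefficient \<open>g x\<close> is positive, nonnegative coefficients
  suffice.  As the coefficients are continuous in \<open>x\<close>, the hyperbolicity cone is open, and it is
  closed in \<open>{g > 0}\<close>.  It is also star-shaped, so it is a whole connected component.
\<close>

lemma hyperbolicity_cone_component:
  fixes g :: "'v::euclidean_space \<Rightarrow> real"
  assumes poly: "real_polynomial_function g" and hom: "\<And>t x. g (t *\<^sub>R x) = t ^ N * g x"
    and hyp: "hyperbolic N g e" and comp: "\<Gamma> \<in> components {x. g x > 0}" and e: "e \<in> \<Gamma>"
  shows "\<Gamma> = hyperbolicity_cone g e" "open \<Gamma>" "\<And>x. x \<in> \<Gamma> \<Longrightarrow> closed_segment e x \<subseteq> \<Gamma>"
proof -
  let ?C = "hyperbolicity_cone g e"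
  have \<Gamma>pos: "\<Gamma> \<subseteq> {x. g x > 0}" and \<Gamma>con: "connected \<Gamma>"
    using comp in_components_subset in_components_connected by blast+
  then have ge: "g e > 0" using e by blast
  have Cpos: "g x > 0" if "x \<in> ?C" for x
    using that unfolding hyperbolicity_cone_def by (auto dest: spec[of _ 0])
  have seg: "closed_segment e x \<subseteq> ?C" if x: "x \<in> ?C" for x
  proof
    fix y assume "y \<in> closed_segment e x"
    then obtain u where u: "0 \<le> u" "u \<le> 1" "y = (1 - u) *\<^sub>R e + u *\<^sub>R x"
      by (auto simp: in_segment)
    have "g (t *\<^sub>R e + y) > 0" if "t \<ge> 0" for t
    proof (cases "u = 0")
      case True
      then have "t *\<^sub>R e + y = (t + 1) *\<^sub>R e"
        using u(3) by (simp add: scaleR_add_left)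
      then show ?thesis using ge that by (simp add: hom)
    next
      case False
      then have "t *\<^sub>R e + y = u *\<^sub>R (((t + (1 - u)) / u) *\<^sub>R e + x)"
        using u(3) by (simp add: scaleR_add_right) (simp add: scaleR_add_left flip: add.assoc)
      moreover have "g (((t + (1 - u)) / u) *\<^sub>R e + x) > 0"
        using x that u unfolding hyperbolicity_cone_def by auto
      ultimately show ?thesis using u False by (simp add: hom)
    qed
    then show "y \<in> ?C" by (simp add: hyperbolicity_cone_def)
  qed
  obtain P where P: "\<And>x t. poly (P x) t = g (t *\<^sub>R e + x)"
    and Pcont: "\<And>k. continuous_on UNIV (\<lambda>x. coeff (P x) k)"
    using real_polynomial_function_along_line[OF poly] by blast
  have split: "\<exists>\<mu>. P x = smult (g e) (\<Prod>i<N. [:\<mu> i, 1:]) \<and> (\<forall>t. g (t *\<^sub>R e + x) = g e * (\<Prod>i<N. t + \<mu> i))" for x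
  proof -
    obtain \<mu> where \<mu>: "\<And>t. g (t *\<^sub>R e + x) = g e * (\<Prod>i<N. t + \<mu> i)"
      using hyp unfolding hyperbolic_def by metis
    then have "poly (P x) t = poly (smult (g e) (\<Prod>i<N. [:\<mu> i, 1:])) t" for t
      by (simp add: P poly_prod add.commute)
    then show ?thesis using \<mu> poly_eq_poly_eq_iff by blast
  qed
  have C1: "coeff (P x) k \<ge> 0 \<and> (k \<le> N \<longrightarrow> coeff (P x) k > 0)" if x: "x \<in> ?C" for x k
  proof -
    obtain \<mu> where \<mu>: "P x = smult (g e) (\<Prod>i<N. [:\<mu> i, 1:])" "\<And>t. g (t *\<^sub>R e + x) = g e * (\<Prod>i<N. t + \<mu> i)"
      using split by blast
    have "\<mu> i > 0" if "i < N" for i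
    proof (rule ccontr)
      assume "\<not> \<mu> i > 0"
      then have "- \<mu> i \<ge> 0" by simp
      moreover have "\<forall>t\<ge>0. g (t *\<^sub>R e + x) > 0"
        using x by (simp add: hyperbolicity_cone_def)
      ultimately have "g ((- \<mu> i) *\<^sub>R e + x) > 0" by blast
      moreover have "(\<Prod>j<N. - \<mu> i + \<mu> j) = 0"
        using that by auto
      ultimately show False
        by (simp only: \<mu>(2) mult_zero_right less_irrefl)
    qed
    then show ?thesis
      using coeff_prod_linear_factors[of N \<mu> k] ge by (simp add: \<mu>(1))
  qed
  have C2: "x \<in> ?C" if x: "g x > 0" and c: "\<And>k. coeff (P x) k \<ge> 0" for x
  proof -
    have "g (t *\<^sub>R e + x) > 0" if "t \<ge> 0" for t
    proof -
      have "poly (P x) t = coeff (P x) 0 + (\<Sum>k\<in>{1..degree (P x)}. coeff (P x) k * t ^ k)"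
        unfolding poly_altdef by (simp add: sum.atLeast_Suc_atMost atMost_atLeast0)
      moreover have "coeff (P x) 0 = g x"
        using P[of x 0] by (simp add: poly_0_coeff_0)
      moreover have "(\<Sum>k\<in>{1..degree (P x)}. coeff (P x) k * t ^ k) \<ge> 0"
        using c that by (intro sum_nonneg) simp
      ultimately show ?thesis using x by (simp add: P)
    qed
    then show ?thesis by (simp add: hyperbolicity_cone_def)
  qed
  have Popen: "open {x. coeff (P x) k > 0}" and Pclosed: "closed {x. coeff (P x) k \<ge> 0}" for k
    using open_Collect_less[of "\<lambda>x. 0" "\<lambda>x. coeff (P x) k"]
      closed_Collect_le[of "\<lambda>x. 0" "\<lambda>x. coeff (P x) k"] Pcont by auto
  have Ceq: "?C = (\<Inter>k\<in>{..N}. {x. coeff (P x) k > 0})"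
  proof (intro subset_antisym subsetI)
    fix x assume x: "x \<in> (\<Inter>k\<in>{..N}. {x. coeff (P x) k > 0})"
    then have xc: "coeff (P x) k > 0" if "k \<le> N" for k
      using that by blast
    obtain \<mu> where \<mu>: "P x = smult (g e) (\<Prod>i<N. [:\<mu> i, 1:])"
      using split by blast
    have "degree (\<Prod>i<N. [:\<mu> i, 1:]) \<le> N"
      using degree_prod_sum_le[of "{..<N}" "\<lambda>i. [:\<mu> i, 1:]"] by simp
    then have "coeff (P x) k = 0" if "k > N" for k
      using that by (auto simp: \<mu> intro!: coeff_eq_0)
    then have "coeff (P x) k \<ge> 0" for k
      using xc[of k] by (cases "k \<le> N") simp_all
    moreover have "g x > 0"
      using xc[of 0] P[of x 0] by (simp add: poly_0_coeff_0)
    ultimately show "x \<in> ?C" by (intro C2)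
  qed (use C1 in blast)
  then have Copen: "open ?C"
    using Popen by (simp add: open_INT)
  have eC: "e \<in> ?C"
  proof -
    have "g (t *\<^sub>R e + e) > 0" if "t \<ge> 0" for t
      using ge that hom[of "t + 1" e] by (simp add: scaleR_add_left)
    then show ?thesis by (simp add: hyperbolicity_cone_def)
  qed
  have "connected ?C"
    using starlike_imp_connected[of ?C] eC seg unfolding starlike_def by blast
  then have 1: "?C \<subseteq> \<Gamma>"
    using components_maximal[OF comp] Cpos eC e by blast
  have "openin (top_of_set \<Gamma>) (\<Gamma> \<inter> ?C)"
    using Copen by (rule openin_open_Int)
  moreover have "\<Gamma> \<inter> ?C = \<Gamma> \<inter> (\<Inter>k. {x. coeff (P x) k \<ge> 0})"
    using C1 C2 \<Gamma>pos by blast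
  then have "closedin (top_of_set \<Gamma>) (\<Gamma> \<inter> ?C)"
    using Pclosed by (simp add: closedin_closed_Int closed_INT)
  ultimately have "\<Gamma> \<inter> ?C = {} \<or> \<Gamma> \<inter> ?C = \<Gamma>"
    using \<Gamma>con connected_clopen by blast
  then show "\<Gamma> = ?C" using e eC 1 by blast
  then show "open \<Gamma>" "\<And>x. x \<in> \<Gamma> \<Longrightarrow> closed_segment e x \<subseteq> \<Gamma>"
    using Copen seg by auto
qed

section \<open>Garding's theorem\<close>

text \<open>
  Being a polynomial in three variables is encoded as being a polynomial along every complex
  line.  This property is stable under sums and products, and it covers each single variable as
  well as the dilations, along which identities are extended from real to complex arguments.
\<close>

definition complexification ::
  "('v::euclidean_space \<Rightarrow> real) \<Rightarrow> 'v \<Rightarrow> 'v \<Rightarrow> 'v \<Rightarrow> (complex \<Rightarrow> complex \<Rightarrow> complex \<Rightarrow> complex) \<Rightarrow> bool" where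
  "complexification g e a v G \<longleftrightarrow>
     (\<forall>r t s. G (of_real r) (of_real t) (of_real s) = of_real (g (r *\<^sub>R e + t *\<^sub>R a + s *\<^sub>R v))) \<and>
     (\<forall>r t s. G (cnj r) (cnj t) (cnj s) = cnj (G r t s)) \<and>
     continuous_on UNIV (\<lambda>z. G (fst z) (fst (snd z)) (snd (snd z))) \<and>
     (\<forall>r r' t t' s s'. \<exists>p. \<forall>w. poly p w = G (r + w * r') (t + w * t') (s + w * s'))"

lemma complexificationI:
  assumes "\<And>r t s. G (of_real r) (of_real t) (of_real s) = of_real (g (r *\<^sub>R e + t *\<^sub>R a + s *\<^sub>R v))"
    and "\<And>r t s. G (cnj r) (cnj t) (cnj s) = cnj (G r t s)"
    and "continuous_on UNIV (\<lambda>z. G (fst z) (fst (snd z)) (snd (snd z)))"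
    and "\<And>r r' t t' s s'. \<exists>p. \<forall>w. poly p w = G (r + w * r') (t + w * t') (s + w * s')"
  shows "complexification g e a v G"
  unfolding complexification_def by (intro conjI allI assms)

lemma complexificationD:
  assumes "complexification g e a v G"
  shows "G (of_real r) (of_real t) (of_real s) = of_real (g (r *\<^sub>R e + t *\<^sub>R a + s *\<^sub>R v))"
    and "G (cnj r') (cnj t') (cnj s') = cnj (G r' t' s')"
    and "continuous_on UNIV (\<lambda>z. G (fst z) (fst (snd z)) (snd (snd z)))"
    and "\<exists>p. \<forall>w. poly p w = G (r1 + w * r2) (t1 + w * t2) (s1 + w * s2)"
proof -
  note * = assms[unfolded complexification_def]
  show "G (of_real r) (of_real t) (of_real s) = of_real (g (r *\<^sub>R e + t *\<^sub>R a + s *\<^sub>R v))"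
    by (rule *[THEN conjunct1, rule_format])
  show "G (cnj r') (cnj t') (cnj s') = cnj (G r' t' s')"
    by (rule *[THEN conjunct2, THEN conjunct1, rule_format])
  show "continuous_on UNIV (\<lambda>z. G (fst z) (fst (snd z)) (snd (snd z)))"
    by (rule *[THEN conjunct2, THEN conjunct2, THEN conjunct1])
  show "\<exists>p. \<forall>w. poly p w = G (r1 + w * r2) (t1 + w * t2) (s1 + w * s2)"
    by (rule *[THEN conjunct2, THEN conjunct2, THEN conjunct2, THEN spec, THEN spec, THEN spec, THEN spec, THEN spec, THEN spec])
qed

lemma real_polynomial_function_complexification:
  fixes g :: "'v::euclidean_space \<Rightarrow> real"
  assumes "real_polynomial_function g"
  shows "\<exists>G. complexification g e a v G"
  using assms
proof (induction rule: real_polynomial_function.induct)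
  case (linear f)
  interpret bounded_linear f by fact
  show ?case
  proof (intro exI[of _ "\<lambda>r t s. r * of_real (f e) + t * of_real (f a) + s * of_real (f v)"] complexificationI)
    show "\<exists>p. \<forall>w. poly p w = (r + w * r') * of_real (f e) + (t + w * t') * of_real (f a) + (s + w * s') * of_real (f v)"
      for r r' t t' s s' :: complex
      by (rule exI[of _ "[:r * of_real (f e) + t * of_real (f a) + s * of_real (f v),
          r' * of_real (f e) + t' * of_real (f a) + s' * of_real (f v):]"]) (simp add: algebra_simps)
  qed (auto simp: add scaleR intro!: continuous_intros)
next
  case (const c)
  show ?case
  proof (intro exI[of _ "\<lambda>r t s. of_real c"] complexificationI)
    show "\<exists>p. \<forall>w :: complex. poly p w = of_real c"
      by (rule exI[of _ "[:of_real c:]"]) simp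
  qed auto
next
  case (add f g)
  obtain F G where F: "complexification f e a v F" and G: "complexification g e a v G"
    using add.IH by blast
  note F = complexificationD[OF F] and G = complexificationD[OF G]
  show ?case
  proof (intro exI[of _ "\<lambda>r t s. F r t s + G r t s"] complexificationI)
    show "\<exists>p. \<forall>w. poly p w = F (r + w * r') (t + w * t') (s + w * s') + G (r + w * r') (t + w * t') (s + w * s')"
      for r r' t t' s s'
    proof -
      obtain p q where "\<forall>w. poly p w = F (r + w * r') (t + w * t') (s + w * s')"
        "\<forall>w. poly q w = G (r + w * r') (t + w * t') (s + w * s')"
        using F(4)[of r r' t t' s s'] G(4)[of r r' t t' s s'] by blast
      then show ?thesis
        by (intro exI[of _ "p + q"]) simp
    qed
  qed (simp_all add: F(1,2) G(1,2) continuous_on_add[OF F(3) G(3)])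
next
  case (mult f g)
  obtain F G where F: "complexification f e a v F" and G: "complexification g e a v G"
    using mult.IH by blast
  note F = complexificationD[OF F] and G = complexificationD[OF G]
  show ?case
  proof (intro exI[of _ "\<lambda>r t s. F r t s * G r t s"] complexificationI)
    show "\<exists>p. \<forall>w. poly p w = F (r + w * r') (t + w * t') (s + w * s') * G (r + w * r') (t + w * t') (s + w * s')"
      for r r' t t' s s'
    proof -
      obtain p q where "\<forall>w. poly p w = F (r + w * r') (t + w * t') (s + w * s')"
        "\<forall>w. poly q w = G (r + w * r') (t + w * t') (s + w * s')"
        using F(4)[of r r' t t' s s'] G(4)[of r r' t t' s s'] by blast
      then show ?thesis
        by (intro exI[of _ "p * q"]) simp
    qed
  qed (simp_all add: F(1,2) G(1,2) continuous_on_mult[OF F(3) G(3)])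
qed

lemma complex_poly_eq_if_eq_on_reals:
  fixes p q :: "complex poly"
  assumes "\<And>x :: real. poly p (of_real x) = poly q (of_real x)"
  shows "p = q"
proof (rule ccontr)
  assume "p \<noteq> q"
  then have "finite {t. poly (p - q) t = 0}"
    using poly_roots_finite[of "p - q"] by simp
  moreover have "range of_real \<subseteq> {t. poly (p - q) t = 0}"
    using assms by auto
  ultimately have "finite (range (of_real :: real \<Rightarrow> complex))"
    using finite_subset by blast
  then show False
    using finite_imageD[of "of_real :: real \<Rightarrow> complex" UNIV] by (auto simp: inj_of_real infinite_UNIV_char_0)
qed

lemma complex_poly_function_eqI:
  assumes "\<exists>p. \<forall>w. poly p w = f w" "\<exists>p. \<forall>w. poly p w = h w" "\<And>x :: real. f (of_real x) = h (of_real x)"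
  shows "f w = (h w :: complex)"
  using assms complex_poly_eq_if_eq_on_reals by metis

text \<open>
  The absolute value at \<open>z\<close> is that of the leading coefficient times the product of the distances from
  \<open>z\<close> to the roots.  For polynomials with a fixed leading coefficient this expresses the continuity of the roots.
\<close>

lemma root_near_small_value:
  fixes p :: "complex poly"
  assumes "p \<noteq> 0" "cmod (poly p z) < cmod (lead_coeff p) * \<delta> ^ degree p" "\<delta> > 0"
  shows "\<exists>w. poly p w = 0 \<and> cmod (z - w) < \<delta>"
proof (rule ccontr)
  assume far: "\<not> ?thesis"
  obtain A where A: "size A = degree p" "p = smult (lead_coeff p) (\<Prod>x\<in>#A. [:-x, 1:])"
    using alg_closed_imp_factorization[OF assms(1)] by blast
  have eval: "poly p w = lead_coeff p * (\<Prod>x\<in>#A. w - x)" for w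
  proof -
    have "poly p w = poly (smult (lead_coeff p) (\<Prod>x\<in>#A. [:-x, 1:])) w"
      using A(2) by (rule arg_cong)
    then show ?thesis by (simp add: poly_prod_mset)
  qed
  have roots: "poly p w = 0" if "w \<in># A" for w
    using that unfolding eval by (auto simp: prod_mset_zero_iff)
  have "\<delta> ^ size B \<le> cmod (\<Prod>x\<in>#B. z - x)" if "B \<subseteq># A" for B
    using that
  proof (induction B)
    case (add x B)
    have "B \<subseteq># A" using add.prems by (meson mset_subset_eq_insertD subset_mset.less_imp_le)
    moreover have "x \<in># A" using add.prems by (meson mset_subset_eq_insertD)
    then have "\<delta> \<le> cmod (z - x)" using far roots by (meson not_less)
    ultimately show ?case
      using add.IH assms(3) by (simp add: norm_mult mult_mono)
  qed simp
  then have "\<delta> ^ degree p \<le> cmod (\<Prod>x\<in>#A. z - x)"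
    using A(1) by (metis subset_mset.order_refl)
  then have "cmod (poly p z) \<ge> cmod (lead_coeff p) * \<delta> ^ degree p"
    by (simp add: eval norm_mult mult_left_mono)
  then show False using assms(2) by linarith
qed

text \<open>
  The claim is that \<open>t \<mapsto> g (t a + v)\<close> has no root \<open>z\<close> with \<open>Im z > 0\<close>.  Deform this polynomial along
  \<open>s \<mapsto> g (\<i> (1 - s) e + t a + s v)\<close>.  For \<open>s < 1\<close> it has no real root \<open>t\<close>, because the roots in the
  direction \<open>e\<close> through the real point \<open>t a + s v\<close> are real and \<open>\<i> (1 - s)\<close> is not.  So no root can
  cross the real axis, and roots in the upper half-plane would persist down to \<open>s = 0\<close>, where all
  roots are \<open>-\<i> / \<mu>\<close> for positive \<open>\<mu>\<close>.
\<close>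

theorem hyperbolic_transfer:
  fixes g :: "'v::euclidean_space \<Rightarrow> real"
  assumes poly: "real_polynomial_function g" and hom: "\<And>t x. g (t *\<^sub>R x) = t ^ N * g x"
    and hyp: "hyperbolic N g e" and ge: "g e > 0" and a: "a \<in> hyperbolicity_cone g e"
  shows "hyperbolic N g a"
  unfolding hyperbolic_def
proof
  fix v
  have ga: "g a > 0"
    using a unfolding hyperbolicity_cone_def by (auto dest: spec[of _ 0])
  obtain G where G: "complexification g e a v G"
    using real_polynomial_function_complexification[OF poly] by blast
  note real = complexificationD(1)[OF G] and cnj = complexificationD(2)[OF G]
    and cont = complexificationD(3)[OF G] and pol = complexificationD(4)[OF G]
  have pol1: "\<exists>p. \<forall>w. poly p w = G w t s" for t s using pol[of 0 1 t 0 s 0] by simp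
  have pol2: "\<exists>p. \<forall>w. poly p w = G r w s" for r s using pol[of r 0 0 1 s 0] by simp
  have mult_pol: "\<exists>p. \<forall>w. poly p w = c * f w" if "\<exists>p. \<forall>w. poly p w = f w" for c f
    using that by (metis poly_smult)
  \<comment> \<open>Homogeneity passes to complex scalars, one variable at a time.\<close>
  have hom1: "G (of_real x * r) (of_real x * t) (of_real x * s) = of_real x ^ N * G r t s" for x r t s
  proof -
    let ?x = "complex_of_real x"
    have real3: "G (?x * of_real r) (?x * of_real t) (?x * of_real s) = ?x ^ N * G (of_real r) (of_real t) (of_real s)" for r t s :: real
    proof -
      have "G (of_real (x * r)) (of_real (x * t)) (of_real (x * s)) = of_real (g (x *\<^sub>R (r *\<^sub>R e + t *\<^sub>R a + s *\<^sub>R v)))"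
        unfolding real by (simp add: scaleR_add_right)
      then show ?thesis by (simp add: hom real)
    qed
    have real2: "G (?x * r) (?x * of_real t) (?x * of_real s) = ?x ^ N * G r (of_real t) (of_real s)" for r and t s :: real
    proof (rule complex_poly_function_eqI[of "\<lambda>r. G (?x * r) (?x * of_real t) (?x * of_real s)"
          "\<lambda>r. ?x ^ N * G r (of_real t) (of_real s)"])
      show "\<exists>p. \<forall>w. poly p w = G (?x * w) (?x * of_real t) (?x * of_real s)"
        using pol[of 0 ?x "?x * of_real t" 0 "?x * of_real s" 0] by (simp add: mult.commute)
    qed (rule mult_pol[OF pol1], rule real3)
    have real1: "G (?x * r) (?x * t) (?x * of_real s) = ?x ^ N * G r t (of_real s)" for r t and s :: real
    proof (rule complex_poly_function_eqI[of "\<lambda>t. G (?x * r) (?x * t) (?x * of_real s)"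
          "\<lambda>t. ?x ^ N * G r t (of_real s)"])
      show "\<exists>p. \<forall>w. poly p w = G (?x * r) (?x * w) (?x * of_real s)"
        using pol[of "?x * r" 0 0 ?x "?x * of_real s" 0] by (simp add: mult.commute)
    qed (rule mult_pol[OF pol2], rule real2)
    show ?thesis
    proof (rule complex_poly_function_eqI[of "\<lambda>s. G (?x * r) (?x * t) (?x * s)" "\<lambda>s. ?x ^ N * G r t s"])
      show "\<exists>p. \<forall>w. poly p w = G (?x * r) (?x * t) (?x * w)"
        using pol[of "?x * r" 0 "?x * t" 0 0 ?x] by (simp add: mult.commute)
      show "\<exists>p. \<forall>w. poly p w = ?x ^ N * G r t w"
        by (rule mult_pol) (use pol[of r 0 t 0 0 1] in simp)
    qed (rule real1)
  qed
  have homG: "G (w * r) (w * t) (w * s) = w ^ N * G r t s" for w r t s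
  proof (rule complex_poly_function_eqI[of "\<lambda>w. G (w * r) (w * t) (w * s)" "\<lambda>w. w ^ N * G r t s"])
    show "\<exists>p. \<forall>w. poly p w = G (w * r) (w * t) (w * s)" using pol[of 0 r 0 t 0 s] by simp
    show "\<exists>p. \<forall>w. poly p w = w ^ N * G r t s"
      by (rule exI[of _ "monom (G r t s) N"]) (simp add: poly_monom)
  qed (rule hom1)
  \<comment> \<open>The real factorisations in the direction \<open>e\<close>, through \<open>t a + s v\<close> and through \<open>t a\<close>.\<close>
  have prod_pol: "\<exists>p. \<forall>w. poly p w = c * (\<Prod>i<N. w * b i + d i)" for c :: complex and b d
    by (rule exI[of _ "smult c (\<Prod>i<N. [:d i, b i:])"]) (simp add: poly_prod add.commute)
  have fact_e: "\<exists>\<mu>. \<forall>r. G r (of_real t) (of_real s) = of_real (g e) * (\<Prod>i<N. r + of_real (\<mu> i))" for t s :: real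
  proof -
    obtain \<mu> where \<mu>: "\<And>r. g (r *\<^sub>R e + (t *\<^sub>R a + s *\<^sub>R v)) = g e * (\<Prod>i<N. r + \<mu> i)"
      using hyp unfolding hyperbolic_def by metis
    have "G r (of_real t) (of_real s) = of_real (g e) * (\<Prod>i<N. r + of_real (\<mu> i))" for r
    proof (rule complex_poly_function_eqI[of "\<lambda>r. G r (of_real t) (of_real s)"
          "\<lambda>r. of_real (g e) * (\<Prod>i<N. r + of_real (\<mu> i))"])
      show "\<exists>p. \<forall>w :: complex. poly p w = of_real (g e) * (\<Prod>i<N. w + of_real (\<mu> i))"
        using prod_pol[of "of_real (g e)" "\<lambda>_. 1" "\<lambda>i. of_real (\<mu> i)"] by simp
      show "G (of_real x) (of_real t) (of_real s) = of_real (g e) * (\<Prod>i<N. of_real x + of_real (\<mu> i))" for x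
        using \<mu>[of x] by (simp add: real add.assoc)
    qed (rule pol1)
    then show ?thesis by blast
  qed
  obtain \<mu> where \<mu>: "\<And>t. g (t *\<^sub>R e + a) = g e * (\<Prod>i<N. t + \<mu> i)"
     "\<And>r t. g (r *\<^sub>R e + t *\<^sub>R a) = g e * (\<Prod>i<N. r + t * \<mu> i)"
    using hyperbolic_scaled[OF hyp hom] by metis
  have \<mu>_pos: "\<mu> i > 0" if "i < N" for i
  proof (rule ccontr)
    assume "\<not> \<mu> i > 0"
    then have "- \<mu> i \<ge> 0" by simp
    moreover have "\<forall>t\<ge>0. g (t *\<^sub>R e + a) > 0"
      using a by (simp add: hyperbolicity_cone_def)
    ultimately have "g ((- \<mu> i) *\<^sub>R e + a) > 0" by blast
    moreover have "(\<Prod>j<N. - \<mu> i + \<mu> j) = 0"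
      using that by auto
    ultimately show False
      by (simp only: \<mu>(1) mult_zero_right less_irrefl)
  qed
  have fact_a: "G r t 0 = of_real (g e) * (\<Prod>i<N. r + t * of_real (\<mu> i))" for r t
  proof -
    have 1: "G (of_real r) t 0 = of_real (g e) * (\<Prod>i<N. of_real r + t * of_real (\<mu> i))" for r :: real and t
    proof (rule complex_poly_function_eqI[of "\<lambda>t. G (of_real r) t 0"
          "\<lambda>t. of_real (g e) * (\<Prod>i<N. of_real r + t * of_real (\<mu> i))"])
      show "\<exists>p. \<forall>w :: complex. poly p w = of_real (g e) * (\<Prod>i<N. of_real r + w * of_real (\<mu> i))"
        using prod_pol[of "of_real (g e)" "\<lambda>i. of_real (\<mu> i)" "\<lambda>_. of_real r"] by (simp add: add.commute)
      show "G (of_real r) (of_real x) 0 = of_real (g e) * (\<Prod>i<N. of_real r + of_real x * of_real (\<mu> i))" for x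
        using real[of r x 0] \<mu>(2)[of r x] by simp
    qed (rule pol2)
    show ?thesis
    proof (rule complex_poly_function_eqI[of "\<lambda>r. G r t 0"
          "\<lambda>r. of_real (g e) * (\<Prod>i<N. r + t * of_real (\<mu> i))"])
      show "\<exists>p. \<forall>w :: complex. poly p w = of_real (g e) * (\<Prod>i<N. w + t * of_real (\<mu> i))"
        using prod_pol[of "of_real (g e)" "\<lambda>_. 1" "\<lambda>i. t * of_real (\<mu> i)"] by simp
    qed (rule pol1, rule 1)
  qed
  define h where "h s t = G (\<i> * of_real (1 - s)) t (of_real s)" for s :: real and t
  have ex_p: "\<exists>p. (\<forall>t. poly p t = h s t) \<and> degree p = N \<and> lead_coeff p = of_real (g a)" for s
  proof -
    obtain p where p: "\<And>t. poly p t = h s t"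
      using pol2 unfolding h_def by metis
    obtain q where q: "\<And>w. poly q w = G (w * (\<i> * of_real (1 - s))) 1 (w * of_real s)"
      using pol[of 0 "\<i> * of_real (1 - s)" 1 0 0 "of_real s"] by auto
    have q0: "poly q 0 = of_real (g a)"
      using real[of 0 1 0] by (simp add: q)
    have "poly p t = t ^ N * poly q (1 / t)" if "t \<noteq> 0" for t
      using that by (simp add: p q h_def flip: homG)
    then show ?thesis
      using degree_of_reversed[of p N q] q0 ga p by auto
  qed
  have root_near: "\<exists>w. h s w = 0 \<and> cmod (z - w) < \<delta>" if "cmod (h s z) < g a * \<delta> ^ N" "\<delta> > 0" for s z \<delta>
  proof -
    obtain p where p: "\<And>t. poly p t = h s t" "degree p = N" "lead_coeff p = of_real (g a)"
      using ex_p by blast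
    then have "p \<noteq> 0" using ga by auto
    then show ?thesis
      using root_near_small_value[of p z \<delta>] that ga p by auto
  qed
  have cont_h: "continuous_on UNIV (\<lambda>x. h (fst x) (snd x))"
  proof -
    have "continuous_on UNIV (\<lambda>x :: real \<times> complex. (\<i> * of_real (1 - fst x), snd x, complex_of_real (fst x)))"
      by (intro continuous_intros)
    from continuous_on_compose2[OF cont this] show ?thesis by (simp add: h_def)
  qed
  have cont_h1: "continuous_on UNIV (\<lambda>s. h s z)" for z
    using continuous_on_compose2[OF cont_h, of UNIV "\<lambda>s. (s, z)"]
    by (simp add: continuous_on_Pair continuous_on_id)
  have no_real_root: "h s (of_real t) \<noteq> 0" if "s < 1" for s t :: real
  proof
    assume "h s (of_real t) = 0"
    then obtain m :: real where "\<i> * of_real (1 - s) + of_real m = 0"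
      using fact_e[of t s] ge unfolding h_def by auto
    then have "Im (\<i> * of_real (1 - s) + of_real m) = 0" by simp
    then show False using that by simp
  qed
  have bounded_roots: "\<exists>R. \<forall>s\<in>{0..1}. \<forall>t. h s t = 0 \<longrightarrow> cmod t \<le> R"
  proof -
    have G010: "cmod (G 0 1 0) > 0"
      using real[of 0 1 0] ga by simp
    then obtain d where d: "d > 0" "\<And>z. dist z (0, 1, 0) < d \<Longrightarrow>
        dist (G (fst z) (fst (snd z)) (snd (snd z))) (G 0 1 0) < cmod (G 0 1 0)"
      using cont[unfolded continuous_on_iff, rule_format, of "(0, 1, 0)" "cmod (G 0 1 0)"] by auto
    have nz: "G z1 1 z2 \<noteq> 0" if "dist (z1, 1 :: complex, z2) (0, 1, 0) < d" for z1 z2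
      using d(2)[OF that] G010 by (auto simp: dist_norm)
    have "cmod t \<le> 2 / d" if s: "s \<in> {0..1}" and t: "h s t = 0" for s t
    proof (rule ccontr)
      assume "\<not> cmod t \<le> 2 / d"
      then have big: "2 < cmod t * d" "t \<noteq> 0"
        using d(1) by (auto simp: field_simps)
      have "t ^ N * G (\<i> * of_real (1 - s) / t) 1 (of_real s / t) = 0"
        using t big(2) by (simp add: h_def flip: homG)
      then have zero: "G (\<i> * of_real (1 - s) / t) 1 (of_real s / t) = 0"
        using big(2) by simp
      have norms: "cmod (\<i> * of_real (1 - s)) = 1 - s" "cmod (of_real s) = s"
        using s by (simp_all only: norm_mult norm_of_real norm_ii) auto
      have "dist (\<i> * of_real (1 - s) / t, 1 :: complex, of_real s / t) (0, 1, 0)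
          \<le> cmod (\<i> * of_real (1 - s) / t) + cmod (of_real s / t)"
        by (simp add: dist_norm norm_Pair sqrt_sum_squares_le_sum)
      also have "\<dots> = 1 / cmod t"
        unfolding norm_divide norms by (simp flip: add_divide_distrib)
      also have "\<dots> < d"
        using big by (simp add: field_simps)
      finally show False using nz zero by blast
    qed
    then show ?thesis by blast
  qed
  have im_le: "Im z \<le> 0" if z: "h 1 z = 0" for z
  proof (rule ccontr)
    assume "\<not> Im z \<le> 0"
    define T where "T = {s \<in> {0..<1}. \<exists>t. h s t = 0 \<and> Im t > 0}"
    have persist: "\<exists>\<delta>>0. \<forall>s'. \<bar>s' - s\<bar> < \<delta> \<longrightarrow> (\<exists>t'. h s' t' = 0 \<and> Im t' > 0)" if t: "h s t = 0" "Im t > 0" for s t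
    proof -
      have pos: "g a * Im t ^ N > 0" using ga t by simp
      then obtain \<delta> where \<delta>: "\<delta> > 0" "\<And>s'. dist s' s < \<delta> \<Longrightarrow> dist (h s' t) (h s t) < g a * Im t ^ N"
        using cont_h1[unfolded continuous_on_iff, rule_format, of s "g a * Im t ^ N"] by auto
      have "\<exists>t'. h s' t' = 0 \<and> Im t' > 0" if "\<bar>s' - s\<bar> < \<delta>" for s'
      proof -
        have "cmod (h s' t) < g a * Im t ^ N"
          using \<delta>(2)[of s'] that t by (simp add: dist_norm)
        then obtain w where w: "h s' w = 0" "cmod (t - w) < Im t"
          using root_near t(2) by blast
        have "\<bar>Im (t - w)\<bar> \<le> cmod (t - w)" by (rule abs_Im_le_cmod)
        then have "Im w > 0" using w(2) by simp
        then show ?thesis using w by blast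
      qed
      then show ?thesis using \<delta>(1) by blast
    qed
    have "T \<noteq> {}"
    proof -
      obtain \<delta> where \<delta>: "\<delta> > 0" "\<And>s'. \<bar>s' - 1\<bar> < \<delta> \<Longrightarrow> \<exists>t'. h s' t' = 0 \<and> Im t' > 0"
        using persist[OF z] \<open>\<not> Im z \<le> 0\<close> by auto
      have "max 0 (1 - \<delta> / 2) \<in> T"
        using \<delta>(1) \<delta>(2)[of "max 0 (1 - \<delta> / 2)"] by (auto simp: T_def)
      then show ?thesis by blast
    qed
    moreover have "openin (top_of_set {0..<1}) T"
      unfolding openin_euclidean_subtopology_iff
    proof (intro conjI ballI)
      fix s assume "s \<in> T"
      then obtain t where "h s t = 0" "Im t > 0" by (auto simp: T_def)
      then obtain \<delta> where "\<delta> > 0" "\<And>s'. \<bar>s' - s\<bar> < \<delta> \<Longrightarrow> \<exists>t'. h s' t' = 0 \<and> Im t' > 0"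
        using persist by blast
      then show "\<exists>e>0. \<forall>x'\<in>{0..<1}. dist x' s < e \<longrightarrow> x' \<in> T"
        by (intro exI[of _ \<delta>]) (auto simp: T_def dist_real_def)
    qed (auto simp: T_def)
    moreover have "closedin (top_of_set {0..<1}) T"
      unfolding closedin_limpt
    proof (intro conjI allI impI)
      fix l assume l: "l islimpt T \<and> l \<in> {0..<1}"
      then obtain x where x: "(\<forall>n. x n \<in> T) \<and> l \<in> {0..<1} \<and> x \<longlonglongrightarrow> l"
        unfolding islimpt_sequential by auto
      then obtain t where t: "\<And>n. h (x n) (t n) = 0" "\<And>n. Im (t n) > 0" "\<And>n. x n \<in> {0..<1}"
        unfolding T_def by simp metis
      obtain R where "\<And>n. cmod (t n) \<le> R"
        using bounded_roots t by (metis atLeastAtMost_iff atLeastLessThan_iff less_imp_le)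
      then have "bounded (range t)" by (auto simp: bounded_iff)
      then obtain l' r where r: "strict_mono r" "(t \<circ> r) \<longlonglongrightarrow> l'"
        using bounded_imp_convergent_subsequence by blast
      have xr: "(\<lambda>n. x (r n)) \<longlonglongrightarrow> l" and tr: "(\<lambda>n. t (r n)) \<longlonglongrightarrow> l'"
        using LIMSEQ_subseq_LIMSEQ[of x l r] x r by (simp_all add: comp_def)
      have "(\<lambda>n. h (x (r n)) (t (r n))) \<longlonglongrightarrow> h l l'"
        using continuous_on_tendsto_compose[OF cont_h tendsto_Pair[OF xr tr]] by simp
      then have root: "h l l' = 0"
        by (simp add: t(1) tendsto_const_iff)
      have "(\<lambda>n. Im (t (r n))) \<longlonglongrightarrow> Im l'"
        using tr by (rule tendsto_Im)
      then have "Im l' \<ge> 0"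
        by (rule LIMSEQ_le_const) (use t(2) less_imp_le in blast)
      moreover have "Im l' \<noteq> 0"
      proof
        assume "Im l' = 0"
        then have "of_real (Re l') = l'" by (simp add: complex_eq_iff)
        then show False using no_real_root[of l "Re l'"] root x by simp
      qed
      ultimately show "l \<in> T" using root x by (auto simp: T_def)
    qed (auto simp: T_def)
    moreover have "connected {0..<1::real}" by simp
    ultimately have "T = {0..<1}"
      using connected_clopen by blast
    then have "0 \<in> T" by simp
    then obtain t where "h 0 t = 0" and im: "Im t > 0"
      by (auto simp: T_def)
    then obtain i where i: "i < N" "\<i> + t * of_real (\<mu> i) = 0"
      using fact_a[of \<i> t] ge by (auto simp: h_def)
    then have "Im (\<i> + t * of_real (\<mu> i)) = 0" by simp
    moreover have "Im t * \<mu> i > 0" using im \<mu>_pos i by simp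
    ultimately show False by simp
  qed
  have real_roots: "Im z = 0" if "h 1 z = 0" for z
  proof -
    have "h 1 (cnj z) = 0"
      using cnj[of 0 z 1] that by (simp add: h_def)
    then show ?thesis using im_le[OF that] im_le[of "cnj z"] by simp
  qed
  obtain p where p: "\<And>t. poly p t = h 1 t" "degree p = N" "lead_coeff p = of_real (g a)"
    using ex_p by blast
  then have "p \<noteq> 0" using ga by auto
  then obtain A where A: "size A = N" "p = smult (of_real (g a)) (\<Prod>x\<in>#A. [:-x, 1:])"
    using alg_closed_imp_factorization[of p] p by auto
  obtain \<nu> where \<nu>: "A = mset (map \<nu> [0..<N])"
    using A(1) by (rule indexed_multisetE)
  have hprod: "h 1 t = of_real (g a) * (\<Prod>i<N. t - \<nu> i)" for t
  proof -
    have "h 1 t = of_real (g a) * (\<Prod>x\<in>#A. t - x)"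
      unfolding p(1)[symmetric] A(2) by (simp add: poly_prod_mset)
    then show ?thesis
      unfolding \<nu> by (simp add: prod_mset_prod_list prod.list_conv_set_nth lessThan_atLeast0 flip: mset_map)
  qed
  have \<nu>_real: "\<nu> i = of_real (Re (\<nu> i))" if "i < N" for i
  proof -
    have "h 1 (\<nu> i) = 0"
      using that unfolding hprod by auto
    then show ?thesis
      using real_roots by (simp add: complex_eq_iff)
  qed
  have "g (t *\<^sub>R a + v) = g a * (\<Prod>i<N. t + - Re (\<nu> i))" for t
  proof -
    have "complex_of_real (g (t *\<^sub>R a + v)) = of_real (g a) * (\<Prod>i<N. of_real t - \<nu> i)"
      using real[of 0 t 1] hprod[of "of_real t"] by (simp add: h_def)
    also have "(\<Prod>i<N. of_real t - \<nu> i) = (\<Prod>i<N. of_real (t + - Re (\<nu> i)))"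
    proof (rule prod.cong[OF refl])
      fix i assume "i \<in> {..<N}"
      then show "of_real t - \<nu> i = of_real (t + - Re (\<nu> i))"
        by (subst \<nu>_real) auto
    qed
    finally have "complex_of_real (g (t *\<^sub>R a + v)) = of_real (g a * (\<Prod>i<N. t + - Re (\<nu> i)))"
      by simp
    then show ?thesis by (simp only: of_real_eq_iff)
  qed
  then show "\<exists>\<mu>. \<forall>t. g (t *\<^sub>R a + v) = g a * (\<Prod>i<N. t + \<mu> i)"
    by (intro exI[of _ "\<lambda>i. - Re (\<nu> i)"] allI)
qed

text \<open>
  The properties of a Garding pair on which everything below rests.  In contrast to the definition
  they mention all directions of the cone at once, and they visibly pass to linear pull backs.
\<close>

locale garding_cone =
  fixes g :: "'v::euclidean_space \<Rightarrow> real" and \<Gamma> :: "'v set" and N :: nat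
  assumes polynomial: "real_polynomial_function g"
    and homogeneous: "g (t *\<^sub>R x) = t ^ N * g x"
    and nonempty: "\<Gamma> \<noteq> {}"
    and open_cone: "open \<Gamma>"
    and convex_cone: "convex \<Gamma>"
    and positive: "x \<in> \<Gamma> \<Longrightarrow> g x > 0"
    and factorization: "a \<in> \<Gamma> \<Longrightarrow> \<exists>\<mu>. \<forall>t. g (a + t *\<^sub>R v) = g a * (\<Prod>i<N. 1 + t * \<mu> i)"
    and reach: "a \<in> \<Gamma> \<Longrightarrow> (\<And>t. 0 \<le> t \<Longrightarrow> t \<le> 1 \<Longrightarrow> g (a + t *\<^sub>R v) > 0) \<Longrightarrow> a + v \<in> \<Gamma>"

text \<open>
  Every \<open>a \<in> \<Gamma>\<close> is a hyperbolic direction, so \<open>\<Gamma>\<close> is star-shaped around each of its points.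
\<close>

theorem garding_pair_imp_garding_cone:
  assumes "garding_pair N g \<Gamma>"
  shows "garding_cone g \<Gamma> N"
proof -
  have poly: "real_polynomial_function g" and hom: "\<And>t x. g (t *\<^sub>R x) = t ^ N * g x"
    and comp: "\<Gamma> \<in> components {x. g x > 0}"
    using assms unfolding garding_pair_def by blast+
  obtain e where e: "e \<in> \<Gamma>" "\<And>v. \<exists>p :: real poly.
        (\<forall>t. poly p t = g (t *\<^sub>R e + v)) \<and> p \<noteq> 0 \<and> (\<Sum>t | poly p t = 0. order t p) = N"
    using assms unfolding garding_pair_def by blast
  have pos: "g x > 0" if "x \<in> \<Gamma>" for x
    using in_components_subset[OF comp] that by blast
  have "g e \<noteq> 0" using pos[OF e(1)] by simp
  then have hyp_e: "hyperbolic N g e"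
    using hyperbolicI_real_rooted[OF poly hom _ e(2)] by blast
  note cone_e = hyperbolicity_cone_component[OF poly hom hyp_e comp e(1)]
  have hyp: "hyperbolic N g a" if "a \<in> \<Gamma>" for a
    using hyperbolic_transfer[OF poly hom hyp_e pos[OF e(1)]] that cone_e(1) by blast
  show ?thesis
  proof
    show "real_polynomial_function g" by fact
    show "g (t *\<^sub>R x) = t ^ N * g x" for t x by (rule hom)
    show "\<Gamma> \<noteq> {}" using e by blast
    show "open \<Gamma>" by (rule cone_e(2))
    show "convex \<Gamma>"
      unfolding convex_contains_segment
      using hyperbolicity_cone_component(3)[OF poly hom hyp comp] by blast
    show "g x > 0" if "x \<in> \<Gamma>" for x by (rule pos[OF that])
    show "\<exists>\<mu>. \<forall>t. g (a + t *\<^sub>R v) = g a * (\<Prod>i<N. 1 + t * \<mu> i)" if "a \<in> \<Gamma>" for a v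
      using hyperbolic_scaled[OF hyp[OF that] hom, of v] by (metis scaleR_one)
    show "a + v \<in> \<Gamma>" if a: "a \<in> \<Gamma>" and seg: "\<And>t. 0 \<le> t \<Longrightarrow> t \<le> 1 \<Longrightarrow> g (a + t *\<^sub>R v) > 0" for a v
    proof -
      have "closed_segment a (a + v) \<subseteq> {x. g x > 0}"
      proof
        fix y assume "y \<in> closed_segment a (a + v)"
        then obtain u where u: "0 \<le> u" "u \<le> 1" "y = (1 - u) *\<^sub>R a + u *\<^sub>R (a + v)"
          by (auto simp: in_segment)
        then have "y = a + u *\<^sub>R v" by (simp add: algebra_simps)
        then show "y \<in> {x. g x > 0}" using seg u by simp
      qed
      then have "closed_segment a (a + v) \<subseteq> \<Gamma>"
        using components_maximal[OF comp connected_segment(1)] a by blast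
      then show ?thesis by auto
    qed
  qed
qed

section \<open>Gradients\<close>

lemma grad_eqI: "GDERIV f x :> D \<Longrightarrow> grad f x = D"
  unfolding grad_def
proof (rule the_equality)
  fix D' assume "GDERIV f x :> D" "GDERIV f x :> D'"
  then have "(\<lambda>h. h \<bullet> D') = (\<lambda>h. h \<bullet> D)"
    unfolding gderiv_def by (rule has_derivative_unique[rotated])
  then show "D' = D"
    by (metis vector_eq_ldot)
qed

lemma GDERIV_frechet:
  fixes f :: "'a::euclidean_space \<Rightarrow> real"
  assumes "(f has_derivative f') (at x)"
  shows "GDERIV f x :> (\<Sum>b\<in>Basis. f' b *\<^sub>R b)"
proof -
  have lin: "linear f'" using assms has_derivative_linear by blast
  have "f' h = h \<bullet> (\<Sum>b\<in>Basis. f' b *\<^sub>R b)" for h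
  proof -
    have "f' (\<Sum>b\<in>Basis. (h \<bullet> b) *\<^sub>R b) = (\<Sum>b\<in>Basis. (h \<bullet> b) * f' b)"
      by (simp add: linear_sum[OF lin] linear_cmul[OF lin])
    then show ?thesis
      by (simp add: euclidean_representation inner_sum_right mult.commute)
  qed
  then have "f' = (\<lambda>h. h \<bullet> (\<Sum>b\<in>Basis. f' b *\<^sub>R b))" by (rule ext)
  then show ?thesis using assms unfolding gderiv_def by simp
qed

lemma orthogonal_projection_exists:
  fixes E :: "'a::euclidean_space set"
  assumes "subspace E"
  obtains P where "linear P" "\<And>x. P x \<in> E" "\<And>x v. v \<in> E \<Longrightarrow> (x - P x) \<bullet> v = 0"
proof -
  obtain B where B: "B \<subseteq> E" "pairwise orthogonal B" "\<And>x. x \<in> B \<Longrightarrow> norm x = 1" "independent B" "span B = E"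
    using orthonormal_basis_subspace[OF assms] by metis
  have fin: "finite B" using B(4) independent_imp_finite by blast
  define P where "P x = (\<Sum>b\<in>B. (x \<bullet> b) *\<^sub>R b)" for x
  have lin: "linear P"
    unfolding P_def
    by (rule linearI) (simp_all add: inner_add_left scaleR_add_left sum.distrib scaleR_sum_right)
  have E: "P x \<in> E" for x
    unfolding P_def by (rule subspace_sum[OF assms]) (use B(1) assms subspace_scale in blast)
  have perp: "(x - P x) \<bullet> c = 0" if c: "c \<in> B" for x c
  proof -
    have "b \<bullet> c = (if b = c then 1 else 0)" if "b \<in> B" for b
      using B(2,3) c that by (auto simp: pairwise_def orthogonal_def norm_eq_1)
    then have "P x \<bullet> c = (\<Sum>b\<in>B. if b = c then x \<bullet> b else 0)"
      unfolding P_def inner_sum_left by (intro sum.cong) auto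
    then show ?thesis
      using c fin by (simp add: inner_diff_left)
  qed
  have "(x - P x) \<bullet> v = 0" if "v \<in> E" for x v
  proof -
    have "orthogonal (x - P x) v"
      by (rule orthogonal_to_span[of v B]) (use that B(5) perp in \<open>auto simp: orthogonal_def\<close>)
    then show ?thesis by (simp add: orthogonal_def)
  qed
  then show ?thesis using that lin E by blast
qed

lemma prod_linear_factors_deriv_zero:
  fixes N :: nat
  shows "((\<lambda>t. \<Prod>i<N. 1 + t * \<mu> i) has_field_derivative (\<Sum>i<N. \<mu> i :: real)) (at 0)"
proof (induction N)
  case (Suc N)
  have "((\<lambda>t. (\<Prod>i<N. 1 + t * \<mu> i) * (1 + t * \<mu> N)) has_field_derivative
      (\<Sum>i<N. \<mu> i) * (1 + 0 * \<mu> N) + \<mu> N * (\<Prod>i<N. 1 + 0 * \<mu> i)) (at 0)"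
    by (rule DERIV_mult[OF Suc]) (auto intro!: derivative_eq_intros)
  then show ?case by simp
qed simp


section \<open>The cone and its edge\<close>

context garding_cone
begin

abbreviation "E \<equiv> edge \<Gamma>"
abbreviation "F \<equiv> grad_log g"

lemma cone_scale: "a \<in> \<Gamma> \<Longrightarrow> t > 0 \<Longrightarrow> t *\<^sub>R a \<in> \<Gamma>"
proof -
  assume a: "a \<in> \<Gamma>" and t: "t > 0"
  have "a + (t - 1) *\<^sub>R a \<in> \<Gamma>"
  proof (rule reach[OF a])
    fix u :: real assume u: "0 \<le> u" "u \<le> 1"
    have "a + u *\<^sub>R (t - 1) *\<^sub>R a = ((1 - u) + u * t) *\<^sub>R a"
      by (simp add: algebra_simps)
    moreover have "(1 - u) + u * t > 0"
      using u t by (cases "u = 1") (auto intro: add_pos_nonneg)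
    ultimately show "g (a + u *\<^sub>R (t - 1) *\<^sub>R a) > 0"
      using positive[OF a] by (simp add: homogeneous)
  qed
  then show ?thesis by (simp add: algebra_simps)
qed

lemma cone_add: "a \<in> \<Gamma> \<Longrightarrow> b \<in> \<Gamma> \<Longrightarrow> a + b \<in> \<Gamma>"
proof -
  assume "a \<in> \<Gamma>" "b \<in> \<Gamma>"
  then have "(1/2) *\<^sub>R a + (1/2) *\<^sub>R b \<in> \<Gamma>"
    using convex_cone by (auto simp: convex_def)
  then have "2 *\<^sub>R ((1/2) *\<^sub>R a + (1/2) *\<^sub>R b) \<in> \<Gamma>"
    by (rule cone_scale) simp
  then show ?thesis by (simp add: scaleR_add_right)
qed

lemma cone_add_closure:
  assumes a: "a \<in> \<Gamma>" and c: "c \<in> closure \<Gamma>"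
  shows "a + c \<in> \<Gamma>"
proof -
  obtain r where r: "r > 0" "ball a r \<subseteq> \<Gamma>"
    using open_cone a openE by blast
  obtain y where y: "y \<in> \<Gamma>" "dist y c < r"
    using c r(1) closure_approachable by blast
  have "a + (c - y) \<in> \<Gamma>"
    using r(2) y(2) by (auto simp: subset_iff dist_norm norm_minus_commute)
  then have "(a + (c - y)) + y \<in> \<Gamma>" using y(1) cone_add by blast
  then show ?thesis by simp
qed

lemma cone_add_closure_scaled:
  assumes "a \<in> \<Gamma>" "c \<in> closure \<Gamma>" "t \<ge> 0"
  shows "a + t *\<^sub>R c \<in> \<Gamma>"
proof (cases "t = 0")
  case False
  then have "(1 / t) *\<^sub>R a + c \<in> \<Gamma>"
    using assms by (intro cone_add_closure cone_scale) auto
  then have "t *\<^sub>R ((1 / t) *\<^sub>R a + c) \<in> \<Gamma>"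
    using False assms(3) by (intro cone_scale) auto
  then show ?thesis using False by (simp add: scaleR_add_right)
qed (use assms in simp)

lemma in_closure_coneI:
  assumes "\<And>\<epsilon>. \<epsilon> > 0 \<Longrightarrow> v + \<epsilon> *\<^sub>R a \<in> \<Gamma>"
  shows "v \<in> closure \<Gamma>"
  unfolding closure_approachable
proof (intro allI impI)
  fix d :: real assume d: "d > 0"
  let ?\<epsilon> = "d / (norm a + 1)"
  have n: "norm a + 1 > 0" by (simp add: add_nonneg_pos)
  have "norm (?\<epsilon> *\<^sub>R a) < d"
    using d n by (simp add: pos_divide_less_eq mult_strict_left_mono)
  then have "dist (v + ?\<epsilon> *\<^sub>R a) v < d" by (simp add: dist_norm)
  moreover have "v + ?\<epsilon> *\<^sub>R a \<in> \<Gamma>" using assms d n by simp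
  ultimately show "\<exists>y\<in>\<Gamma>. dist y v < d" by blast
qed

lemma edgeI:
  assumes "a \<in> \<Gamma>" "\<And>t. a + t *\<^sub>R v \<in> \<Gamma>"
  shows "v \<in> E"
proof -
  have *: "s *\<^sub>R v \<in> closure \<Gamma>" for s
  proof (rule in_closure_coneI)
    fix \<epsilon> :: real assume e: "\<epsilon> > 0"
    then have "\<epsilon> *\<^sub>R (a + (s / \<epsilon>) *\<^sub>R v) \<in> \<Gamma>"
      using assms(2) cone_scale by blast
    then show "s *\<^sub>R v + \<epsilon> *\<^sub>R a \<in> \<Gamma>" using e by (simp add: scaleR_add_right add.commute)
  qed
  have "v \<in> closure \<Gamma>" "- v \<in> closure \<Gamma>" using *[of 1] *[of "-1"] by auto
  then show ?thesis
    unfolding edge_def by (auto intro!: image_eqI[of _ _ "- v"])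
qed

lemma edgeD:
  assumes "v \<in> E"
  shows "v \<in> closure \<Gamma>" "- v \<in> closure \<Gamma>"
  using assms unfolding edge_def by auto

lemma cone_add_edge:
  assumes "a \<in> \<Gamma>" "v \<in> E"
  shows "a + v \<in> \<Gamma>" "a - v \<in> \<Gamma>" "a + t *\<^sub>R v \<in> \<Gamma>"
proof -
  have *: "a + t *\<^sub>R v \<in> \<Gamma>" for t
    using cone_add_closure_scaled[OF assms(1) edgeD(1)[OF assms(2)], of t]
      cone_add_closure_scaled[OF assms(1) edgeD(2)[OF assms(2)], of "- t"] by (cases "t \<ge> 0") auto
  show "a + v \<in> \<Gamma>" "a - v \<in> \<Gamma>" "a + t *\<^sub>R v \<in> \<Gamma>"
    using *[of 1] *[of "-1"] *[of t] by auto
qed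

lemma subspace_edge: "subspace E"
proof -
  obtain a where a: "a \<in> \<Gamma>" using nonempty by blast
  show ?thesis
    unfolding subspace_def
  proof (intro conjI ballI allI)
    show "0 \<in> E" by (rule edgeI[OF a]) (use a in simp)
    fix x y assume x: "x \<in> E" and y: "y \<in> E"
    show "x + y \<in> E"
    proof (rule edgeI[OF a])
      fix t
      have "(a + t *\<^sub>R x) + t *\<^sub>R y \<in> \<Gamma>" using a x y cone_add_edge(3) by blast
      then show "a + t *\<^sub>R (x + y) \<in> \<Gamma>" by (simp add: scaleR_add_right add.assoc)
    qed
  next
    fix c x assume x: "x \<in> E"
    show "c *\<^sub>R x \<in> E"
    proof (rule edgeI[OF a])
      show "a + t *\<^sub>R c *\<^sub>R x \<in> \<Gamma>" for t
        using cone_add_edge(3)[OF a x, of "t * c"] by simp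
    qed
  qed
qed

lemma closure_cone_add_edge:
  assumes "c \<in> closure \<Gamma>" "v \<in> E"
  shows "c + v \<in> closure \<Gamma>"
proof -
  obtain a where a: "a \<in> \<Gamma>" using nonempty by blast
  show ?thesis
  proof (rule in_closure_coneI)
    fix \<epsilon> :: real assume "\<epsilon> > 0"
    then have "(\<epsilon> *\<^sub>R a + c) + v \<in> \<Gamma>"
      using a assms by (intro cone_add_edge(1) cone_add_closure cone_scale)
    then show "c + v + \<epsilon> *\<^sub>R a \<in> \<Gamma>" by (simp add: algebra_simps)
  qed
qed

text \<open>
  Otherwise \<open>x\<close> could be reached from the cone along a segment on which \<open>g\<close> is positive.
\<close>

lemma boundary_zero:
  assumes "x \<in> closure \<Gamma>" "x \<notin> \<Gamma>"
  shows "g x = 0"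
proof -
  have "closed {x. g x \<ge> 0}"
    using closed_Collect_le[of "\<lambda>x. 0" g] Ck_on_imp_continuous_on[OF Ck_on_real_polynomial_function[OF open_UNIV polynomial]]
    by simp
  moreover have "\<Gamma> \<subseteq> {x. g x \<ge> 0}" using positive less_imp_le by blast
  ultimately have "g x \<ge> 0" using assms(1) closure_minimal by blast
  moreover have "\<not> g x > 0"
  proof
    assume gx: "g x > 0"
    obtain a where a: "a \<in> \<Gamma>" using nonempty by blast
    have "(a + x) + (- a) \<in> \<Gamma>"
    proof (rule reach)
      show "a + x \<in> \<Gamma>" using a assms(1) by (rule cone_add_closure)
      fix t :: real assume t: "0 \<le> t" "t \<le> 1"
      show "g (a + x + t *\<^sub>R - a) > 0"
      proof (cases "t = 1")
        case False
        then have "(1 - t) *\<^sub>R a + x \<in> \<Gamma>"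
          using a assms(1) t by (intro cone_add_closure cone_scale) auto
        then show ?thesis using positive by (simp add: algebra_simps)
      qed (use gx in simp)
    qed
    then show False using assms(2) by simp
  qed
  ultimately show ?thesis by simp
qed


section \<open>The logarithmic gradient along a line\<close>

text \<open>
  Along \<open>a + t v\<close> the polynomial is \<open>g a\<close> times the product of the \<open>1 + t \<mu>\<^sub>i\<close>.  The numbers
  \<open>\<mu>\<^sub>i\<close> decide everything: they are nonnegative for \<open>v\<close> in the closed cone, and they all vanish
  iff \<open>v\<close> lies in the edge.
\<close>

lemma factor_nonzero:
  assumes "a \<in> \<Gamma>" "\<And>t. g (a + t *\<^sub>R v) = g a * (\<Prod>i<N. 1 + t * \<mu> i)" "a + s *\<^sub>R v \<in> \<Gamma>" "i < N"
  shows "1 + s * \<mu> i \<noteq> 0"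
proof
  assume "1 + s * \<mu> i = 0"
  then have "(\<Prod>i<N. 1 + s * \<mu> i) = 0" using assms(4) by auto
  then have "g (a + s *\<^sub>R v) = 0" using assms(2) by simp
  then show False using positive[OF assms(3)] by simp
qed

lemma factors_nonneg:
  assumes "a \<in> \<Gamma>" "\<And>t. g (a + t *\<^sub>R v) = g a * (\<Prod>i<N. 1 + t * \<mu> i)" "v \<in> closure \<Gamma>" "i < N"
  shows "\<mu> i \<ge> 0"
proof (rule ccontr)
  assume "\<not> \<mu> i \<ge> 0"
  then have "1 + (- 1 / \<mu> i) * \<mu> i \<noteq> 0"
    by (intro factor_nonzero[OF assms(1,2) _ assms(4)] cone_add_closure_scaled[OF assms(1,3)])
      (simp add: divide_nonpos_neg)
  then show False using \<open>\<not> \<mu> i \<ge> 0\<close> by simp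
qed

lemma edge_if_factors_zero:
  assumes "a \<in> \<Gamma>" "\<And>t. g (a + t *\<^sub>R v) = g a * (\<Prod>i<N. 1 + t * \<mu> i)" "\<And>i. i < N \<Longrightarrow> \<mu> i = 0"
  shows "v \<in> E"
proof (rule edgeI[OF assms(1)])
  have const: "g (a + t *\<^sub>R v) = g a" for t using assms(2,3) by simp
  fix t show "a + t *\<^sub>R v \<in> \<Gamma>"
    by (rule reach[OF assms(1)]) (simp add: const positive[OF assms(1)])
qed

text \<open>
  The whole line \<open>a + t v\<close> lies in the cone, so the polynomial has no zero on it.
\<close>

lemma add_edge_invariant:
  assumes "a \<in> \<Gamma>" "v \<in> E"
  shows "g (a + v) = g a"
proof -
  obtain \<mu> where \<mu>: "\<And>t. g (a + t *\<^sub>R v) = g a * (\<Prod>i<N. 1 + t * \<mu> i)"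
    using factorization[OF assms(1)] by blast
  have "\<mu> i = 0" if "i < N" for i
  proof (rule ccontr)
    assume "\<mu> i \<noteq> 0"
    have "1 + (- 1 / \<mu> i) * \<mu> i \<noteq> 0"
      by (rule factor_nonzero[OF assms(1) \<mu> _ that]) (rule cone_add_edge(3)[OF assms])
    then show False using \<open>\<mu> i \<noteq> 0\<close> by simp
  qed
  then show ?thesis using \<mu>[of 1] by simp
qed

lemma GDERIV_g: "GDERIV g x :> grad g x"
proof -
  have "Ck_on (Suc 0) UNIV g" using Ck_on_real_polynomial_function[OF open_UNIV polynomial] .
  then have "(g has_derivative frechet_derivative g (at x)) (at x)"
    by (rule Ck_on_SucD) simp
  from GDERIV_frechet[OF this] show ?thesis
    by (simp only: grad_eqI)
qed

lemma GDERIV_log_g: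
  assumes "x \<in> \<Gamma>"
  shows "GDERIV (\<lambda>x. ln (g x)) x :> (1 / g x) *\<^sub>R grad g x"
  by (rule GDERIV_DERIV_compose[OF GDERIV_g]) (use DERIV_ln_divide positive[OF assms] in simp)

lemma F_eq: "x \<in> \<Gamma> \<Longrightarrow> F x = (1 / g x) *\<^sub>R grad g x"
  unfolding grad_log_def by (rule grad_eqI) (rule GDERIV_log_g)

lemma F_inner:
  assumes "a \<in> \<Gamma>" "\<And>t. g (a + t *\<^sub>R v) = g a * (\<Prod>i<N. 1 + t * \<mu> i)"
  shows "F a \<bullet> v = (\<Sum>i<N. \<mu> i)"
proof -
  have "((\<lambda>t. g (a + t *\<^sub>R v)) has_derivative (\<lambda>t. (t *\<^sub>R v) \<bullet> grad g a)) (at 0)"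
    by (rule has_derivative_compose[of "\<lambda>t. a + t *\<^sub>R v" "\<lambda>t. t *\<^sub>R v" 0 UNIV g])
      (use GDERIV_g[of a] in \<open>auto simp: gderiv_def intro!: derivative_eq_intros\<close>)
  then have "((\<lambda>t. g (a + t *\<^sub>R v)) has_field_derivative v \<bullet> grad g a) (at 0)"
    by (simp add: has_field_derivative_def mult.commute[of _ "v \<bullet> grad g a"])
  moreover have "((\<lambda>t. g (a + t *\<^sub>R v)) has_field_derivative g a * (\<Sum>i<N. \<mu> i)) (at 0)"
    unfolding assms(2) by (rule DERIV_cmult[OF prod_linear_factors_deriv_zero])
  ultimately have "v \<bullet> grad g a = g a * (\<Sum>i<N. \<mu> i)" by (rule DERIV_unique)
  then show ?thesis
    using positive[OF assms(1)] by (simp add: F_eq[OF assms(1)] inner_commute)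
qed

lemma F_inner_shifted:
  assumes a: "a \<in> \<Gamma>" and \<mu>: "\<And>t. g (a + t *\<^sub>R v) = g a * (\<Prod>i<N. 1 + t * \<mu> i)" and s: "a + s *\<^sub>R v \<in> \<Gamma>"
  shows "F (a + s *\<^sub>R v) \<bullet> v = (\<Sum>i<N. \<mu> i / (1 + s * \<mu> i))"
proof (rule F_inner[OF s])
  fix t
  have "g (a + s *\<^sub>R v + t *\<^sub>R v) = g (a + (s + t) *\<^sub>R v)"
    by (simp add: algebra_simps)
  also have "\<dots> = g a * (\<Prod>i<N. (1 + s * \<mu> i) * (1 + t * (\<mu> i / (1 + s * \<mu> i))))"
    unfolding \<mu>
  proof (intro arg_cong2[of _ _ _ _ "(*)"] refl prod.cong)
    fix i assume "i \<in> {..<N}"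
    then have "1 + s * \<mu> i \<noteq> 0" using factor_nonzero[OF a \<mu> s] by simp
    then show "1 + (s + t) * \<mu> i = (1 + s * \<mu> i) * (1 + t * (\<mu> i / (1 + s * \<mu> i)))"
      by (simp add: field_simps)
  qed
  also have "\<dots> = g (a + s *\<^sub>R v) * (\<Prod>i<N. 1 + t * (\<mu> i / (1 + s * \<mu> i)))"
    by (simp add: \<mu> prod.distrib)
  finally show "g (a + s *\<^sub>R v + t *\<^sub>R v) = g (a + s *\<^sub>R v) * (\<Prod>i<N. 1 + t * (\<mu> i / (1 + s * \<mu> i)))" .
qed

lemma F_euler: "x \<in> \<Gamma> \<Longrightarrow> F x \<bullet> x = real N"
proof -
  assume x: "x \<in> \<Gamma>"
  have "g (x + t *\<^sub>R x) = g x * (\<Prod>i<N. 1 + t * 1)" for t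
    using homogeneous[of "1 + t" x] by (simp add: scaleR_add_left)
  from F_inner[OF x this] show ?thesis by simp
qed

lemma F_nonneg:
  assumes "x \<in> \<Gamma>" "v \<in> closure \<Gamma>"
  shows "F x \<bullet> v \<ge> 0" "F x \<bullet> v = 0 \<Longrightarrow> v \<in> E"
proof -
  obtain \<mu> where \<mu>: "\<And>t. g (x + t *\<^sub>R v) = g x * (\<Prod>i<N. 1 + t * \<mu> i)"
    using factorization[OF assms(1)] by blast
  have nonneg: "\<mu> i \<ge> 0" if "i < N" for i using factors_nonneg[OF assms(1) \<mu> assms(2) that] .
  then show "F x \<bullet> v \<ge> 0"
    unfolding F_inner[OF assms(1) \<mu>] by (intro sum_nonneg) simp
  assume "F x \<bullet> v = 0"
  then have "\<forall>i\<in>{..<N}. \<mu> i = 0"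
    using nonneg unfolding F_inner[OF assms(1) \<mu>] by (subst (asm) sum_nonneg_eq_0_iff) auto
  then have "\<mu> i = 0" if "i < N" for i
    using that by simp
  then show "v \<in> E" by (rule edge_if_factors_zero[OF assms(1) \<mu>])
qed

lemma F_add_edge:
  assumes "x \<in> \<Gamma>" "v \<in> E"
  shows "F (x + v) = F x"
proof -
  have "((\<lambda>y. g (y + v)) has_derivative (\<lambda>h. h \<bullet> grad g (x + v))) (at x)"
    by (rule has_derivative_compose[of "\<lambda>y. y + v" "\<lambda>h. h" x UNIV g])
      (use GDERIV_g[of "x + v"] in \<open>auto simp: gderiv_def intro!: derivative_eq_intros\<close>)
  then have "(g has_derivative (\<lambda>h. h \<bullet> grad g (x + v))) (at x)"
    by (rule has_derivative_transform_within_open[OF _ open_cone assms(1)])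
      (use add_edge_invariant assms(2) in simp)
  then have "grad g x = grad g (x + v)"
    by (intro grad_eqI) (simp add: gderiv_def)
  then show ?thesis
    using F_eq assms cone_add_edge(1) add_edge_invariant by simp
qed

text \<open>
  The difference of the logarithmic derivatives at the ends of the segment is the sum of the
  \<open>\<mu>\<^sub>i\<^sup>2 / (1 + \<mu>\<^sub>i)\<close>, with positive denominators.
\<close>

lemma F_eq_iff:
  assumes x: "x \<in> \<Gamma>" and y: "y \<in> \<Gamma>"
  shows "F x = F y \<longleftrightarrow> x - y \<in> E"
proof
  assume "x - y \<in> E"
  then show "F x = F y" using F_add_edge[OF y, of "x - y"] by simp
next
  assume eq: "F x = F y"
  let ?v = "x - y"
  obtain \<mu> where \<mu>: "\<And>t. g (y + t *\<^sub>R ?v) = g y * (\<Prod>i<N. 1 + t * \<mu> i)"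
    using factorization[OF y] by blast
  have seg: "y + t *\<^sub>R ?v \<in> \<Gamma>" if "0 \<le> t" "t \<le> 1" for t
  proof -
    have "(1 - t) *\<^sub>R y + t *\<^sub>R x \<in> \<Gamma>"
      using convex_cone x y that by (simp add: convex_alt)
    then show ?thesis by (simp add: algebra_simps)
  qed
  have pos: "1 + \<mu> i > 0" if i: "i < N" for i
  proof (rule ccontr)
    assume "\<not> 1 + \<mu> i > 0"
    then have m: "\<mu> i \<le> -1" by simp
    have "1 + (- 1 / \<mu> i) * \<mu> i \<noteq> 0"
      by (rule factor_nonzero[OF y \<mu> seg i]) (use m in \<open>simp_all add: divide_simps\<close>)
    then show False using m by simp
  qed
  have "F y \<bullet> ?v = (\<Sum>i<N. \<mu> i)" by (rule F_inner[OF y \<mu>])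
  moreover have "F x \<bullet> ?v = (\<Sum>i<N. \<mu> i / (1 + \<mu> i))"
    using F_inner_shifted[OF y \<mu>, of 1] x by simp
  ultimately have "(\<Sum>i<N. \<mu> i - \<mu> i / (1 + \<mu> i)) = 0"
    using eq by (simp add: sum_subtractf)
  also have "(\<Sum>i<N. \<mu> i - \<mu> i / (1 + \<mu> i)) = (\<Sum>i<N. (\<mu> i)\<^sup>2 / (1 + \<mu> i))"
  proof (rule sum.cong[OF refl])
    fix i assume "i \<in> {..<N}"
    then have "1 + \<mu> i \<noteq> 0" using pos by fastforce
    then show "\<mu> i - \<mu> i / (1 + \<mu> i) = (\<mu> i)\<^sup>2 / (1 + \<mu> i)"
      by (simp add: divide_simps) (simp add: power2_eq_square algebra_simps)
  qed
  finally have "\<forall>i\<in>{..<N}. (\<mu> i)\<^sup>2 / (1 + \<mu> i) = 0"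
    using pos by (subst (asm) sum_nonneg_eq_0_iff) (auto intro: divide_nonneg_pos)
  then have "\<mu> i = 0" if "i < N" for i
    using pos[OF that] that by auto
  then show "?v \<in> E" by (rule edge_if_factors_zero[OF y \<mu>])
qed

lemma Ck_on_F: "Ck_on k \<Gamma> F"
proof (rule Ck_on_cong[OF open_cone])
  let ?D = "\<lambda>x. frechet_derivative g (at x)"
  have Ck: "Ck_on m \<Gamma> g" for m by (rule Ck_on_real_polynomial_function[OF open_cone polynomial])
  show "Ck_on k \<Gamma> (\<lambda>x. \<Sum>b\<in>Basis. (inverse (g x) * ?D x b) *\<^sub>R b)"
  proof (intro Ck_on_sum[OF open_cone] Ck_on_scaleR[OF open_cone] Ck_on_mult[OF open_cone]
      Ck_on_inverse[OF open_cone] Ck_on_const[OF open_cone] Ck)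
    show "Ck_on k \<Gamma> (\<lambda>x. ?D x b)" for b using Ck[of "Suc k"] by simp
    show "g x \<noteq> 0" if "x \<in> \<Gamma>" for x using positive[OF that] by simp
  qed
  fix x assume x: "x \<in> \<Gamma>"
  have "grad g x = (\<Sum>b\<in>Basis. ?D x b *\<^sub>R b)"
    using grad_eqI[OF GDERIV_frechet[OF Ck_on_SucD[OF Ck x]]] .
  then show "(\<Sum>b\<in>Basis. (inverse (g x) * ?D x b) *\<^sub>R b) = F x"
    by (simp add: F_eq[OF x] scaleR_sum_right divide_inverse)
qed

text \<open>The second derivative of \<open>log g\<close> along \<open>x + t v\<close> is minus the sum of the \<open>\<mu>\<^sub>i\<^sup>2\<close>.\<close>

lemma F_derivative_negative:
  assumes x: "x \<in> \<Gamma>"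
  shows "frechet_derivative F (at x) v \<bullet> v \<le> 0"
    and "frechet_derivative F (at x) v \<bullet> v = 0 \<Longrightarrow> v \<in> E"
proof -
  let ?D = "frechet_derivative F (at x)"
  obtain \<mu> where \<mu>: "\<And>t. g (x + t *\<^sub>R v) = g x * (\<Prod>i<N. 1 + t * \<mu> i)"
    using factorization[OF x] by blast
  have "(F has_derivative ?D) (at x)" using Ck_on_SucD[OF Ck_on_F x] .
  then have "((\<lambda>t. F (x + t *\<^sub>R v)) has_derivative (\<lambda>t. ?D (t *\<^sub>R v))) (at 0)"
    by (intro has_derivative_compose[of "\<lambda>t. x + t *\<^sub>R v" "\<lambda>t. t *\<^sub>R v" 0 UNIV F])
      (auto intro!: derivative_eq_intros)
  then have 1: "((\<lambda>t. F (x + t *\<^sub>R v) \<bullet> v) has_derivative (\<lambda>t. ?D (t *\<^sub>R v) \<bullet> v)) (at 0)"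
    by (rule has_derivative_inner_left)
  have "((\<lambda>t. \<Sum>i<N. \<mu> i / (1 + t * \<mu> i)) has_field_derivative (\<Sum>i<N. - (\<mu> i)\<^sup>2)) (at 0)"
    by (auto intro!: derivative_eq_intros sum.cong simp: power2_eq_square)
  then have 2: "((\<lambda>t. \<Sum>i<N. \<mu> i / (1 + t * \<mu> i)) has_derivative (\<lambda>t. (\<Sum>i<N. - (\<mu> i)\<^sup>2) * t)) (at 0)"
    by (simp add: has_field_derivative_def)
  have op: "open ((\<lambda>t. x + t *\<^sub>R v) -` \<Gamma>)"
    by (intro open_vimage open_cone continuous_intros)
  have "((\<lambda>t. F (x + t *\<^sub>R v) \<bullet> v) has_derivative (\<lambda>t. (\<Sum>i<N. - (\<mu> i)\<^sup>2) * t)) (at 0)"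
    by (rule has_derivative_transform_within_open[OF 2 op])
      (use x F_inner_shifted[OF x \<mu>] in auto)
  with 1 have "(\<lambda>t. ?D (t *\<^sub>R v) \<bullet> v) = (\<lambda>t. (\<Sum>i<N. - (\<mu> i)\<^sup>2) * t)"
    by (rule has_derivative_unique)
  from fun_cong[OF this, of 1] have eq: "?D v \<bullet> v = - (\<Sum>i<N. (\<mu> i)\<^sup>2)"
    by (simp add: sum_negf)
  then show "?D v \<bullet> v \<le> 0" by (simp add: sum_nonneg)
  assume "?D v \<bullet> v = 0"
  then have "\<mu> i = 0" if "i < N" for i
    using eq that by (simp add: sum_nonneg_eq_0_iff)
  then show "v \<in> E" by (rule edge_if_factors_zero[OF x \<mu>])
qed


section \<open>The polar cone and the inverse of the gradient map\<close>

lemma polar_inner_closure: "y \<in> polar \<Gamma> \<Longrightarrow> v \<in> closure \<Gamma> \<Longrightarrow> y \<bullet> v \<ge> 0"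
proof -
  assume y: "y \<in> polar \<Gamma>" and v: "v \<in> closure \<Gamma>"
  have "closed {v. y \<bullet> v \<ge> 0}" by (rule closed_halfspace_ge)
  moreover have "\<Gamma> \<subseteq> {v. y \<bullet> v \<ge> 0}" using y by (auto simp: polar_def)
  ultimately show ?thesis using v closure_minimal by blast
qed

lemma polar_inner_edge: "y \<in> polar \<Gamma> \<Longrightarrow> v \<in> E \<Longrightarrow> y \<bullet> v = 0"
  using polar_inner_closure[of y v] polar_inner_closure[of y "- v"] edgeD[of v] by simp

lemma span_polar_inner_edge: "y \<in> span (polar \<Gamma>) \<Longrightarrow> v \<in> E \<Longrightarrow> y \<bullet> v = 0"
proof -
  assume y: "y \<in> span (polar \<Gamma>)" and v: "v \<in> E"
  have "orthogonal v y"
    by (rule orthogonal_to_span[OF y]) (use polar_inner_edge v in \<open>auto simp: orthogonal_def inner_commute\<close>)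
  then show ?thesis by (simp add: orthogonal_def inner_commute)
qed

text \<open>By compactness of the unit sphere of the orthogonal complement of the edge.\<close>

lemma inner_bound_transversal:
  assumes "\<And>v. v \<in> closure \<Gamma> \<Longrightarrow> y \<bullet> v \<ge> 0" "\<And>v. v \<in> closure \<Gamma> \<Longrightarrow> y \<bullet> v = 0 \<Longrightarrow> v \<in> E"
  shows "\<exists>c>0. \<forall>v\<in>closure \<Gamma>. (\<forall>w\<in>E. v \<bullet> w = 0) \<longrightarrow> y \<bullet> v \<ge> c * norm v"
proof -
  let ?S = "closure \<Gamma> \<inter> {v. \<forall>w\<in>E. v \<bullet> w = 0}" and ?K = "closure \<Gamma> \<inter> {v. \<forall>w\<in>E. v \<bullet> w = 0} \<inter> sphere 0 1"
  have "closed {v. \<forall>w\<in>E. v \<bullet> w = 0}"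
  proof -
    have "{v. \<forall>w\<in>E. v \<bullet> w = 0} = (\<Inter>w\<in>E. {v. w \<bullet> v = 0})" by (auto simp: inner_commute)
    then show ?thesis by (simp add: closed_INT closed_hyperplane)
  qed
  then have K: "compact ?K" by (simp add: closed_Int_compact closed_Int)
  have scale: "(1 / norm v) *\<^sub>R v \<in> ?K" if v: "v \<in> ?S" "v \<noteq> 0" for v
  proof -
    have "(1 / norm v) *\<^sub>R v \<in> closure \<Gamma>"
    proof -
      obtain a where a: "a \<in> \<Gamma>" using nonempty by blast
      show ?thesis
      proof (rule in_closure_coneI)
        fix \<epsilon> :: real assume "\<epsilon> > 0"
        then have "\<epsilon> *\<^sub>R a + (1 / norm v) *\<^sub>R v \<in> \<Gamma>"
          using a v by (intro cone_add_closure_scaled cone_scale) auto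
        then show "(1 / norm v) *\<^sub>R v + \<epsilon> *\<^sub>R a \<in> \<Gamma>" by (simp add: add.commute)
      qed
    qed
    then show ?thesis using v by auto
  qed
  show ?thesis
  proof (cases "?K = {}")
    case True
    then have "v = 0" if "v \<in> ?S" for v using scale that by blast
    then have "\<forall>v\<in>closure \<Gamma>. (\<forall>w\<in>E. v \<bullet> w = 0) \<longrightarrow> y \<bullet> v \<ge> 1 * norm v" by force
    then show ?thesis by (intro exI[of _ 1]) simp
  next
    case False
    obtain k where k: "k \<in> ?K" "\<And>v. v \<in> ?K \<Longrightarrow> y \<bullet> k \<le> y \<bullet> v"
      using continuous_attains_inf[OF K False continuous_on_inner[OF continuous_on_const continuous_on_id]] by blast
    have "y \<bullet> k > 0"
    proof -
      have "y \<bullet> k \<noteq> 0"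
      proof
        assume "y \<bullet> k = 0"
        then have "k \<in> E" using assms(2) k(1) by blast
        then have "k \<bullet> k = 0" using k(1) by blast
        then show False using k(1) by simp
      qed
      then show ?thesis using assms(1)[of k] k(1) by force
    qed
    moreover have "y \<bullet> v \<ge> (y \<bullet> k) * norm v" if "v \<in> ?S" for v
    proof (cases "v = 0")
      case False
      then have "y \<bullet> k \<le> y \<bullet> ((1 / norm v) *\<^sub>R v)" using scale that k(2) by blast
      then show ?thesis using False by (simp add: field_simps)
    qed simp
    ultimately show ?thesis by blast
  qed
qed

definition edge_projection :: "'v \<Rightarrow> 'v" where
  "edge_projection = (SOME P. linear P \<and> (\<forall>x. P x \<in> E) \<and> (\<forall>x. \<forall>v\<in>E. (x - P x) \<bullet> v = 0))"

lemma edge_projection: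
  shows linear_edge_projection: "linear edge_projection"
    and edge_projection_in_edge: "edge_projection x \<in> E"
    and edge_projection_orthogonal: "v \<in> E \<Longrightarrow> (x - edge_projection x) \<bullet> v = 0"
proof -
  have "\<exists>P. linear P \<and> (\<forall>x. P x \<in> E) \<and> (\<forall>x. \<forall>v\<in>E. (x - P x) \<bullet> v = 0)"
  proof (rule orthogonal_projection_exists[OF subspace_edge])
    fix P assume "linear P" "\<And>x. P x \<in> E" "\<And>x v. v \<in> E \<Longrightarrow> (x - P x) \<bullet> v = 0"
    then show ?thesis by (intro exI[of _ P]) simp
  qed
  from someI_ex[OF this, folded edge_projection_def]
  show "linear edge_projection" "edge_projection x \<in> E" "v \<in> E \<Longrightarrow> (x - edge_projection x) \<bullet> v = 0"
    by simp_all
qed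

lemma edge_projection_eq_zero:
  assumes "\<And>v. v \<in> E \<Longrightarrow> x \<bullet> v = 0"
  shows "edge_projection x = 0"
proof -
  let ?p = "edge_projection x"
  have "?p \<bullet> ?p = 0"
    using edge_projection_orthogonal[OF edge_projection_in_edge, of x x] assms[OF edge_projection_in_edge, of x]
    by (simp add: inner_diff_left)
  then show ?thesis by simp
qed

lemma edge_projection_of_edge:
  assumes "v \<in> E"
  shows "edge_projection v = v"
proof -
  have "v - edge_projection v \<in> E"
    using assms edge_projection_in_edge subspace_diff[OF subspace_edge] by blast
  then have "(v - edge_projection v) \<bullet> (v - edge_projection v) = 0"
    by (rule edge_projection_orthogonal)
  then show ?thesis by simp
qed

text \<open>
  Transversally to the edge \<open>y\<close> dominates a positive multiple of the norm, and the points of the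
  span of the polar vanish on the edge; so those close to \<open>y\<close> remain nonnegative on the cone.
\<close>

lemma open_polarI:
  assumes y: "y \<in> polar \<Gamma>" and zero: "\<And>v. v \<in> closure \<Gamma> \<Longrightarrow> y \<bullet> v = 0 \<Longrightarrow> v \<in> E"
  shows "y \<in> open_polar \<Gamma>"
proof -
  obtain c where c: "c > 0" "\<forall>v\<in>closure \<Gamma>. (\<forall>w\<in>E. v \<bullet> w = 0) \<longrightarrow> y \<bullet> v \<ge> c * norm v"
    using inner_bound_transversal[OF polar_inner_closure[OF y] zero] by blast
  let ?P = edge_projection
  note P = edge_projection_in_edge edge_projection_orthogonal
  let ?T = "span (polar \<Gamma>) \<inter> ball y c"
  have "openin (top_of_set (span (polar \<Gamma>))) ?T" by (simp add: openin_open_Int)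
  moreover have "y \<in> ?T" using y c(1) span_base by force
  moreover have "?T \<subseteq> polar \<Gamma>"
  proof
    fix z assume z: "z \<in> ?T"
    have "z \<bullet> x \<ge> 0" if x: "x \<in> \<Gamma>" for x
    proof -
      let ?v = "x - ?P x"
      have "x \<in> closure \<Gamma>" using x closure_subset by blast
      then have "?v \<in> closure \<Gamma>"
        using closure_cone_add_edge[of x "- ?P x"] P(1) subspace_neg[OF subspace_edge] by simp
      then have "y \<bullet> ?v \<ge> c * norm ?v" using c(2) P(2) by blast
      moreover have "\<bar>(y - z) \<bullet> ?v\<bar> \<le> norm (y - z) * norm ?v" by (rule Cauchy_Schwarz_ineq2)
      moreover have "norm (y - z) * norm ?v \<le> c * norm ?v"
        using z by (intro mult_right_mono) (auto simp: dist_norm)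
      ultimately have "z \<bullet> ?v \<ge> 0" by (simp add: inner_diff_left)
      moreover have "z \<bullet> ?P x = 0" using span_polar_inner_edge z P(1) by blast
      ultimately show ?thesis by (simp add: inner_diff_right)
    qed
    then show "z \<in> polar \<Gamma>" by (simp add: polar_def)
  qed
  ultimately show ?thesis
    unfolding open_polar_def interior_of_def by blast
qed

lemma F_in_open_polar: "x \<in> \<Gamma> \<Longrightarrow> F x \<in> open_polar \<Gamma>"
  using F_nonneg[of x] closure_subset[of \<Gamma>] by (intro open_polarI) (auto simp: polar_def subset_iff)

lemma open_polar_subset: "open_polar \<Gamma> \<subseteq> polar \<Gamma>"
  unfolding open_polar_def by (rule interior_of_subset)

text \<open>
  A point \<open>y\<close> of the open polar stays in the polar after subtraction of a small multiple of a point
  \<open>F a\<close>; so \<open>y\<close> can vanish only where \<open>F a\<close> does.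
\<close>

lemma open_polar_zero:
  assumes y: "y \<in> open_polar \<Gamma>" and v: "v \<in> closure \<Gamma>" "y \<bullet> v = 0"
  shows "v \<in> E"
proof -
  obtain a where a: "a \<in> \<Gamma>" using nonempty by blast
  obtain T where "openin (top_of_set (span (polar \<Gamma>))) T" "y \<in> T" "T \<subseteq> polar \<Gamma>"
    using y unfolding open_polar_def interior_of_def by blast
  then obtain d where d: "d > 0" "ball y d \<inter> span (polar \<Gamma>) \<subseteq> polar \<Gamma>"
    unfolding openin_contains_ball by blast
  have Fa: "F a \<in> polar \<Gamma>" using F_in_open_polar[OF a] open_polar_subset by blast
  have yp: "y \<in> polar \<Gamma>" using y open_polar_subset by blast
  let ?\<epsilon> = "d / (norm (F a) + 1)"
  have n: "norm (F a) + 1 > 0" by (simp add: add_nonneg_pos)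
  have "norm (?\<epsilon> *\<^sub>R F a) < d"
    using d(1) n by (simp add: pos_divide_less_eq mult_strict_left_mono)
  moreover have "y - ?\<epsilon> *\<^sub>R F a \<in> span (polar \<Gamma>)"
    using Fa yp by (intro span_diff span_scale span_base)
  ultimately have "y - ?\<epsilon> *\<^sub>R F a \<in> polar \<Gamma>"
    using d(2) by (auto simp: dist_norm subset_iff)
  then have "(y - ?\<epsilon> *\<^sub>R F a) \<bullet> v \<ge> 0" using polar_inner_closure v(1) by blast
  then have "?\<epsilon> * (F a \<bullet> v) \<le> 0" using v(2) by (simp add: inner_diff_left)
  then have "F a \<bullet> v \<le> 0" using d(1) n by (simp add: mult_le_0_iff divide_le_0_iff)
  then show ?thesis using F_nonneg[OF a v(1)] by simp
qed

text \<open>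
  To find \<open>x\<close> with \<open>F x = y\<close>, maximise \<open>g\<close> on the compact slice of the closed cone, transversal to
  the edge, where \<open>y\<close> takes the value \<open>N\<close>.  The maximum is positive, hence not attained on the boundary of the
  cone, and the multiplier rule makes \<open>F x\<close> a multiple of \<open>y\<close>; Euler's identity
  \<open>F x \<bullet> x = N\<close> makes the multiple equal to one.
\<close>

lemma F_surjective:
  assumes N: "N \<ge> 1" and y: "y \<in> open_polar \<Gamma>"
  obtains x where "x \<in> \<Gamma>" "F x = y" "\<And>w. w \<in> E \<Longrightarrow> x \<bullet> w = 0"
proof -
  have yp: "y \<in> polar \<Gamma>" using y open_polar_subset by blast
  obtain c where c: "c > 0" "\<forall>v\<in>closure \<Gamma>. (\<forall>w\<in>E. v \<bullet> w = 0) \<longrightarrow> y \<bullet> v \<ge> c * norm v"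
    using inner_bound_transversal[OF polar_inner_closure[OF yp] open_polar_zero[OF y]] by blast
  let ?P = edge_projection
  note P = edge_projection_in_edge edge_projection_orthogonal
  let ?K = "closure \<Gamma> \<inter> {v. \<forall>w\<in>E. v \<bullet> w = 0} \<inter> {v. y \<bullet> v = real N}"
  have "closed {v. \<forall>w\<in>E. v \<bullet> w = 0}"
  proof -
    have "{v. \<forall>w\<in>E. v \<bullet> w = 0} = (\<Inter>w\<in>E. {v. w \<bullet> v = 0})" by (auto simp: inner_commute)
    then show ?thesis by (simp add: closed_INT closed_hyperplane)
  qed
  then have "closed ?K" by (simp add: closed_Int closed_hyperplane)
  moreover have "norm v \<le> real N / c" if "v \<in> ?K" for v
    using bspec[OF c(2), of v] c(1) that by (simp add: field_simps)
  then have "bounded ?K" unfolding bounded_iff by blast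
  ultimately have K: "compact ?K" using compact_eq_bounded_closed by blast
  obtain a where a: "a \<in> \<Gamma>" using nonempty by blast
  \<comment> \<open>No point of the cone lies in the edge, because \<open>g (a - a) = 0 \<noteq> g a\<close>.\<close>
  have "a \<notin> E"
  proof
    assume "a \<in> E"
    then have "0 \<in> \<Gamma>" using cone_add_edge(2)[OF a] by fastforce
    then have "g 0 > 0" by (rule positive)
    moreover have "g 0 = 0" using homogeneous[of 0 0] N by (simp add: power_0_left)
    ultimately show False by simp
  qed
  define b where "b = (real N / (y \<bullet> a)) *\<^sub>R (a - ?P a)"
  have "y \<bullet> a > 0"
    using polar_inner_closure[OF yp, of a] open_polar_zero[OF y] a closure_subset \<open>a \<notin> E\<close>
    by (metis less_eq_real_def subsetD)
  then have b\<Gamma>: "b \<in> \<Gamma>"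
    unfolding b_def using N a P(1) by (intro cone_scale cone_add_edge(2)) auto
  have "b \<in> ?K"
    using b\<Gamma> closure_subset[of \<Gamma>] P \<open>y \<bullet> a > 0\<close> polar_inner_edge[OF yp]
    by (auto simp: b_def inner_diff_right)
  moreover have contg: "continuous_on ?K g"
    by (rule continuous_on_subset[OF Ck_on_imp_continuous_on[OF Ck_on_real_polynomial_function[OF open_UNIV polynomial]]]) simp
  ultimately obtain x where x: "x \<in> ?K" "\<And>z. z \<in> ?K \<Longrightarrow> g z \<le> g x"
    using continuous_attains_sup[OF K _ contg] by blast
  have "g x > 0" using x(2)[OF \<open>b \<in> ?K\<close>] positive[OF b\<Gamma>] by simp
  then have x\<Gamma>: "x \<in> \<Gamma>" using boundary_zero[of x] x(1) by force
  have crit: "F x \<bullet> w = 0" if w: "\<And>v. v \<in> E \<Longrightarrow> w \<bullet> v = 0" "y \<bullet> w = 0" for w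
  proof -
    obtain \<mu> where \<mu>: "\<And>t. g (x + t *\<^sub>R w) = g x * (\<Prod>i<N. 1 + t * \<mu> i)"
      using factorization[OF x\<Gamma>] by blast
    have der: "((\<lambda>t. g (x + t *\<^sub>R w)) has_field_derivative g x * (\<Sum>i<N. \<mu> i)) (at 0)"
      unfolding \<mu> by (rule DERIV_cmult[OF prod_linear_factors_deriv_zero])
    have op: "open ((\<lambda>t. x + t *\<^sub>R w) -` \<Gamma>)"
      by (intro open_vimage open_cone continuous_intros)
    have zero: "0 \<in> (\<lambda>t. x + t *\<^sub>R w) -` \<Gamma>" using x\<Gamma> by simp
    obtain d where d: "d > 0" "ball 0 d \<subseteq> (\<lambda>t. x + t *\<^sub>R w) -` \<Gamma>"
      by (rule openE[OF op zero])
    have "g (x + t *\<^sub>R w) \<le> g (x + 0 *\<^sub>R w)" if "\<bar>0 - t\<bar> < d" for t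
    proof -
      have "x + t *\<^sub>R w \<in> \<Gamma>" using d(2) that by (auto simp: dist_real_def subset_iff)
      then have "x + t *\<^sub>R w \<in> ?K"
        using x(1) w closure_subset[of \<Gamma>] by (auto simp: inner_add_left inner_add_right)
      then show ?thesis using x(2) by simp
    qed
    then have "g x * (\<Sum>i<N. \<mu> i) = 0"
      using DERIV_local_max[OF der d(1)] by blast
    then show ?thesis using \<open>g x > 0\<close> F_inner[OF x\<Gamma> \<mu>] by simp
  qed
  have Fp: "F x \<in> polar \<Gamma>" using F_in_open_polar[OF x\<Gamma>] open_polar_subset by blast
  define D where "D = F x - y"
  have Dx: "D \<bullet> x = 0"
    using F_euler[OF x\<Gamma>] x(1) by (simp add: D_def inner_diff_left)
  define w where "w = D - ((y \<bullet> D) / N) *\<^sub>R x"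
  have wE: "w \<bullet> v = 0" if "v \<in> E" for v
    using that x(1) polar_inner_edge Fp yp by (simp add: w_def D_def inner_diff_left)
  have yw: "y \<bullet> w = 0"
    using x(1) N by (simp add: w_def inner_diff_right)
  have "D \<bullet> w = 0"
    using crit[OF wE yw] yw by (simp add: D_def inner_diff_left)
  then have "D \<bullet> D = 0"
    using Dx by (simp add: w_def inner_diff_right)
  then have "F x = y" by (simp add: D_def)
  then show ?thesis using that x\<Gamma> x(1) by blast
qed

lemma F_image:
  assumes N: "N \<ge> 1" shows "F ` \<Gamma> = open_polar \<Gamma>"
proof (intro subset_antisym subsetI)
  fix y assume y: "y \<in> open_polar \<Gamma>"
  show "y \<in> F ` \<Gamma>"
    by (rule F_surjective[OF N y]) blast
qed (use F_in_open_polar in blast)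

text \<open>
  Subtracting the orthogonal projection \<open>P\<close> onto the edge from \<open>F\<close> gives a map with negative
  definite derivative on the open set \<open>\<Gamma>\<close>, so the inverse function theorem applies; it agrees
  with \<open>F\<close> on the part of \<open>\<Gamma>\<close> orthogonal to the edge.
\<close>

lemma smooth_section:
  assumes N: "N \<ge> 1"
  obtains G where "smooth_map_on (open_polar \<Gamma>) G" "\<And>y. y \<in> open_polar \<Gamma> \<Longrightarrow> G y \<in> \<Gamma> \<and> F (G y) = y"
proof -
  let ?P = edge_projection
  define \<Phi> where "\<Phi> x = F x + - edge_projection x" for x
  have linP: "linear (\<lambda>x. - ?P x)" using linear_edge_projection by (rule linear_compose_neg)
  have Ck: "Ck_on k \<Gamma> \<Phi>" for k
    unfolding \<Phi>_def by (intro Ck_on_add open_cone Ck_on_F Ck_on_linear linP)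
  have der: "frechet_derivative \<Phi> (at x) = (\<lambda>v. frechet_derivative F (at x) v + - ?P v)" if "x \<in> \<Gamma>" for x
  proof -
    have "bounded_linear (\<lambda>x. - ?P x)" using linP linear_conv_bounded_linear by blast
    from bounded_linear_imp_has_derivative[OF this]
    have "(\<Phi> has_derivative (\<lambda>v. frechet_derivative F (at x) v + - ?P v)) (at x)"
      unfolding \<Phi>_def using Ck_on_SucD[OF Ck_on_F that] by (intro has_derivative_add)
    then show ?thesis by (rule frechet_derivative_at[symmetric])
  qed
  have FE: "F x \<bullet> v = 0" if "x \<in> \<Gamma>" "v \<in> E" for x v
    using F_in_open_polar open_polar_subset polar_inner_edge that by blast
  have inj: "inj_on \<Phi> \<Gamma>"
  proof (rule inj_onI)
    fix x z assume xz: "x \<in> \<Gamma>" "z \<in> \<Gamma>" "\<Phi> x = \<Phi> z"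
    let ?p = "?P x - ?P z"
    have pE: "?p \<in> E" using edge_projection_in_edge subspace_diff[OF subspace_edge] by blast
    have "F x - F z = ?p" using xz(3) by (simp add: \<Phi>_def algebra_simps)
    moreover from this have "?p \<bullet> ?p = 0"
      using FE[OF xz(1) pE] FE[OF xz(2) pE] by (metis inner_diff_left diff_self)
    ultimately have "F x = F z" "?P (x - z) = 0" using linear_diff[OF linear_edge_projection] by simp_all
    then have "x - z \<in> E" using F_eq_iff xz by blast
    then show "x = z" using edge_projection_of_edge[of "x - z"] \<open>?P (x - z) = 0\<close> by simp
  qed
  have inj': "inj (frechet_derivative \<Phi> (at x))" if x: "x \<in> \<Gamma>" for x
  proof -
    have lin: "linear (frechet_derivative \<Phi> (at x))"
      using Ck_on_SucD[OF Ck x] has_derivative_linear by blast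
    have "v = 0" if v: "frechet_derivative \<Phi> (at x) v = 0" for v
    proof -
      let ?D = "frechet_derivative F (at x) v"
      have "?P v \<bullet> v = ?P v \<bullet> ?P v"
        using edge_projection_orthogonal[OF edge_projection_in_edge, of v v] by (simp add: inner_diff_left) (simp add: inner_commute)
      moreover have "(?D + - ?P v) \<bullet> v = 0" using v der[OF x] by simp
      ultimately have "?D \<bullet> v = ?P v \<bullet> ?P v" by (simp add: inner_diff_left)
      moreover from this have "?P v \<bullet> ?P v = 0"
        using F_derivative_negative(1)[OF x, of v] inner_ge_zero[of "?P v"] by linarith
      ultimately have "?D \<bullet> v = 0" "?P v = 0" by simp_all
      then show "v = 0" using F_derivative_negative(2)[OF x] edge_projection_of_edge[of v] by simp
    qed
    then show ?thesis using linear_injective_0[OF lin] by blast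
  qed
  let ?G = "inv_into \<Gamma> \<Phi>"
  have op: "open (\<Phi> ` \<Gamma>)" and smooth: "Ck_on k (\<Phi> ` \<Gamma>) ?G" for k
    using Ck_on_inverse_function[OF open_cone Ck inj inj'] by blast+
  have sec: "y \<in> \<Phi> ` \<Gamma> \<and> ?G y \<in> \<Gamma> \<and> F (?G y) = y" if y: "y \<in> open_polar \<Gamma>" for y
  proof -
    obtain x where x: "x \<in> \<Gamma>" "F x = y" "\<And>w. w \<in> E \<Longrightarrow> x \<bullet> w = 0"
      using F_surjective[OF N y] by blast
    then have "\<Phi> x = y" using edge_projection_eq_zero by (simp add: \<Phi>_def)
    then have "?G y = x" using inj x(1) inv_into_f_f by metis
    moreover have "y \<in> \<Phi> ` \<Gamma>" by (rule image_eqI[where x = x]) (simp_all add: \<open>\<Phi> x = y\<close> x(1))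
    ultimately show ?thesis using x(1,2) by simp
  qed
  have "smooth_map_on (open_polar \<Gamma>) ?G"
    by (rule smooth_map_onI[OF op _ smooth]) (use sec in blast)
  then show ?thesis using that sec by blast
qed

end

section \<open>Linear pull backs\<close>

lemma induces_diffeomorphismI:
  assumes E: "subspace E" and fib: "\<And>x x'. x \<in> U \<Longrightarrow> x' \<in> U \<Longrightarrow> f x = f x' \<longleftrightarrow> x - x' \<in> E"
    and f: "smooth_map_on U f" and s: "smooth_map_on S s"
    and fS: "\<And>x. x \<in> U \<Longrightarrow> f x \<in> S" and sec: "\<And>y. y \<in> S \<Longrightarrow> s y \<in> U \<and> f (s y) = y"
  shows "induces_diffeomorphism U E S f"
proof -
  define h where "h C = f (SOME x. x \<in> C \<inter> U)" for C
  let ?cl = "\<lambda>x. modulo E `` {x}"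
  have self: "x \<in> ?cl x" for x
    using subspace_0[OF E] by (simp add: modulo_def)
  have cl_eq: "?cl x = ?cl x'" if "x - x' \<in> E" for x x'
  proof -
    have "x - y \<in> E \<longleftrightarrow> x' - y \<in> E" for y
      using subspace_diff[OF E, of "x - y" "x - x'"] subspace_add[OF E, of "x' - y" "x - x'"] that by auto
    then show ?thesis by (auto simp: modulo_def)
  qed
  have h: "h (?cl x) = f x" if x: "x \<in> U" for x
  proof -
    let ?z = "SOME z. z \<in> ?cl x \<inter> U"
    have "?z \<in> ?cl x \<inter> U"
      by (rule someI[of _ x]) (use self x in blast)
    then have "x - ?z \<in> E" "?z \<in> U" by (auto simp: modulo_def)
    then show ?thesis using fib[OF x] unfolding h_def by metis
  qed
  have quot: "U // modulo E = ?cl ` U" by (auto simp: quotient_def)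
  have inj: "inj_on h (U // modulo E)"
    unfolding quot by (rule inj_onI) (use h fib cl_eq in force)
  have img: "h ` (U // modulo E) = S"
    unfolding quot
  proof (intro subset_antisym subsetI)
    fix y assume "y \<in> S"
    then show "y \<in> h ` ?cl ` U" using sec[of y] h[of "s y"] by (metis image_eqI)
  qed (use h fS in auto)
  have "s y \<in> inv_into (U // modulo E) h y" if y: "y \<in> S" for y
  proof -
    have "inv_into (U // modulo E) h y = ?cl (s y)"
      by (rule inv_into_f_eq[OF inj]) (use sec[OF y] h quot in auto)
    then show ?thesis using self by simp
  qed
  then show ?thesis
    unfolding induces_diffeomorphism_def bij_betw_def using h inj img f s by blast
qed

lemma closed_polar: "closed (polar S)"
proof -
  have "polar S = (\<Inter>x\<in>S. {y. x \<bullet> y \<ge> 0})" by (auto simp: polar_def inner_commute)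
  then show ?thesis by (simp add: closed_INT closed_halfspace_ge)
qed

lemma (in garding_cone) pull_back:
  fixes L :: "'x::euclidean_space \<Rightarrow> 'v"
  assumes L: "linear L" and ne: "L -` \<Gamma> \<noteq> {}"
  shows "garding_cone (g \<circ> L) (L -` \<Gamma>) N"
proof
  have bl: "bounded_linear L" using L linear_conv_bounded_linear by blast
  show "real_polynomial_function (g \<circ> L)"
    using polynomial_function_bounded_linear[OF bl] polynomial by (rule real_polynomial_function_compose)
  show "(g \<circ> L) (t *\<^sub>R x) = t ^ N * (g \<circ> L) x" for t x
    by (simp add: linear_cmul[OF L] homogeneous)
  show "L -` \<Gamma> \<noteq> {}" by fact
  show "open (L -` \<Gamma>)"
    using open_vimage[OF open_cone] linear_continuous_on[OF bl] by blast
  show "convex (L -` \<Gamma>)" by (rule convex_linear_vimage[OF L convex_cone])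
  show "(g \<circ> L) x > 0" if "x \<in> L -` \<Gamma>" for x using positive that by simp
  show "\<exists>\<mu>. \<forall>t. (g \<circ> L) (a + t *\<^sub>R v) = (g \<circ> L) a * (\<Prod>i<N. 1 + t * \<mu> i)" if "a \<in> L -` \<Gamma>" for a v
    using factorization[of "L a" "L v"] that by (simp add: linear_add[OF L] linear_cmul[OF L])
  show "a + v \<in> L -` \<Gamma>" if "a \<in> L -` \<Gamma>"
    "\<And>t. 0 \<le> t \<Longrightarrow> t \<le> 1 \<Longrightarrow> (g \<circ> L) (a + t *\<^sub>R v) > 0" for a v
    using reach[of "L a" "L v"] that by (simp add: linear_add[OF L] linear_cmul[OF L])
qed

lemma (in garding_cone) dual_fun_F:
  assumes x: "x \<in> \<Gamma>"
  shows "dual_fun g \<Gamma> (F x) = 1 / g x"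
  unfolding dual_fun_def
proof (rule the_equality)
  fix r assume "\<exists>z\<in>\<Gamma>. F z = F x \<and> r = 1 / g z"
  then obtain z where z: "z \<in> \<Gamma>" "F z = F x" "r = 1 / g z" by blast
  then have "z - x \<in> E" using F_eq_iff x by blast
  then have "g z = g x" using add_edge_invariant[OF x, of "z - x"] by simp
  then show "r = 1 / g x" using z(3) by simp
qed (use x in blast)

locale garding_pull_back = garding_cone g \<Gamma> N
  for g :: "'w::euclidean_space \<Rightarrow> real" and \<Gamma> N +
  fixes L :: "'x::euclidean_space \<Rightarrow> 'w"
  assumes linear_L: "linear L" and pull_back_nonempty: "L -` \<Gamma> \<noteq> {}" and degree_pos: "N \<ge> 1"
begin

sublocale pb: garding_cone "g \<circ> L" "L -` \<Gamma>" N
  by (rule pull_back[OF linear_L pull_back_nonempty])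

abbreviation "\<Sigma> \<equiv> (F \<circ> L) ` (L -` \<Gamma>)"
abbreviation "L\<^sub>t \<equiv> adjoint L"

lemmas L_simps = linear_add[OF linear_L] linear_diff[OF linear_L] linear_cmul[OF linear_L]

lemma adjoint_inner: "L\<^sub>t z \<bullet> x = z \<bullet> L x"
  by (rule adjoint_clauses(2)[OF linear_L])

lemma pull_back_edge: "v \<in> pb.E \<longleftrightarrow> L v \<in> E"
proof -
  obtain a where a: "L a \<in> \<Gamma>" using pull_back_nonempty by blast
  show ?thesis
  proof
    assume "v \<in> pb.E"
    then have "L a + t *\<^sub>R L v \<in> \<Gamma>" for t
      using pb.cone_add_edge(3)[of a v t] a by (simp add: L_simps)
    then show "L v \<in> E" by (rule edgeI[OF a])
  next
    assume "L v \<in> E"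
    then have "a + t *\<^sub>R v \<in> L -` \<Gamma>" for t
      using cone_add_edge(3)[OF a] by (simp add: L_simps)
    then show "v \<in> pb.E" using pb.edgeI[of a v] a by simp
  qed
qed

lemma grad_pull_back: "grad (g \<circ> L) x = L\<^sub>t (grad g (L x))"
proof (rule grad_eqI)
  have "bounded_linear L" using linear_L linear_conv_bounded_linear by blast
  from has_derivative_compose[OF bounded_linear_imp_has_derivative[OF this], of g _ x]
  have "((\<lambda>x. g (L x)) has_derivative (\<lambda>h. L h \<bullet> grad g (L x))) (at x)"
    using GDERIV_g[of "L x"] by (simp add: gderiv_def)
  then show "GDERIV (g \<circ> L) x :> L\<^sub>t (grad g (L x))"
    by (simp add: gderiv_def comp_def adjoint_works[OF linear_L])
qed

lemma F_pull_back: "x \<in> L -` \<Gamma> \<Longrightarrow> pb.F x = L\<^sub>t (F (L x))"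
  using pb.F_eq[of x] F_eq[of "L x"] by (simp add: grad_pull_back linear_cmul[OF adjoint_linear[OF linear_L]])

lemma open_polar_pull_back: "open_polar (L -` \<Gamma>) = L\<^sub>t ` open_polar \<Gamma>"
proof (intro subset_antisym subsetI)
  fix y assume "y \<in> open_polar (L -` \<Gamma>)"
  then obtain x where "x \<in> L -` \<Gamma>" "y = pb.F x"
    using pb.F_image[OF degree_pos] by blast
  then show "y \<in> L\<^sub>t ` open_polar \<Gamma>"
    using F_in_open_polar F_pull_back by auto
next
  fix y assume "y \<in> L\<^sub>t ` open_polar \<Gamma>"
  then obtain z where z: "y = L\<^sub>t z" "z \<in> open_polar \<Gamma>" by blast
  have zp: "z \<in> polar \<Gamma>" using z(2) open_polar_subset by blast
  show "y \<in> open_polar (L -` \<Gamma>)"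
  proof (rule pb.open_polarI)
    show "y \<in> polar (L -` \<Gamma>)"
      using zp by (auto simp: polar_def z(1) adjoint_inner)
    fix v assume v: "v \<in> closure (L -` \<Gamma>)" "y \<bullet> v = 0"
    obtain a where a: "a \<in> L -` \<Gamma>" using pull_back_nonempty by blast
    have "L v \<in> closure \<Gamma>"
    proof (rule in_closure_coneI)
      fix \<epsilon> :: real assume "\<epsilon> > 0"
      then have "\<epsilon> *\<^sub>R a + v \<in> L -` \<Gamma>"
        using a v(1) by (intro pb.cone_add_closure pb.cone_scale)
      then show "L v + \<epsilon> *\<^sub>R L a \<in> \<Gamma>" by (simp add: L_simps add.commute)
    qed
    moreover have "z \<bullet> L v = 0" using v(2) by (simp add: z(1) adjoint_inner)
    ultimately show "v \<in> pb.E" using open_polar_zero[OF z(2)] pull_back_edge by blast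
  qed
qed

text \<open>
  \<open>y\<close> is the limit of points \<open>y + \<epsilon> y\<^sub>0\<close> of the open polar.  These are images of points of the polar
  of \<open>\<Gamma>\<close> that are bounded on an interior point of \<open>\<Gamma>\<close>; such points form a compact set.
\<close>

lemma polar_pull_back: "polar (L -` \<Gamma>) = L\<^sub>t ` polar \<Gamma>"
proof (intro subset_antisym subsetI)
  fix y assume "y \<in> L\<^sub>t ` polar \<Gamma>"
  then show "y \<in> polar (L -` \<Gamma>)" by (auto simp: polar_def adjoint_inner)
next
  fix y assume y: "y \<in> polar (L -` \<Gamma>)"
  obtain a where a: "a \<in> L -` \<Gamma>" using pull_back_nonempty by blast
  let ?y0 = "pb.F a" and ?c = "y \<bullet> a + real N"
  let ?B = "polar \<Gamma> \<inter> {z. L a \<bullet> z \<le> ?c}"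
  have y0: "?y0 \<in> open_polar (L -` \<Gamma>)" using pb.F_in_open_polar[OF a] .
  then have y0p: "?y0 \<in> polar (L -` \<Gamma>)" using pb.open_polar_subset by blast
  obtain r where r: "r > 0" "cball (L a) r \<subseteq> \<Gamma>"
    using open_cone a open_contains_cball by blast
  have "norm z \<le> ?c / r" if z: "z \<in> ?B" for z
  proof (cases "z = 0")
    case True
    have "y \<bullet> a \<ge> 0" using y a by (auto simp: polar_def)
    then show ?thesis using True r(1) by simp
  next
    case False
    let ?u = "(r / norm z) *\<^sub>R z"
    have "L a - ?u \<in> \<Gamma>" using r False by (auto simp: subset_iff dist_norm)
    then have "z \<bullet> (L a - ?u) \<ge> 0" using z by (auto simp: polar_def)
    moreover have "z \<bullet> ?u = r * norm z"
      using False by (simp add: power2_norm_eq_inner[symmetric] power2_eq_square)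
    ultimately have "r * norm z \<le> ?c" using z by (simp add: inner_diff_right inner_commute)
    then show ?thesis using r(1) by (simp add: field_simps)
  qed
  then have "bounded ?B" unfolding bounded_iff by blast
  moreover have "closed ?B" by (intro closed_Int closed_polar closed_halfspace_le)
  ultimately have "compact ?B" by (simp add: compact_eq_bounded_closed)
  then have "compact (L\<^sub>t ` ?B)"
    using compact_continuous_image linear_continuous_on adjoint_linear[OF linear_L] linear_conv_bounded_linear
    by blast
  then have closed: "closed (L\<^sub>t ` ?B)" by (rule compact_imp_closed)
  have mem: "y + \<epsilon> *\<^sub>R ?y0 \<in> L\<^sub>t ` ?B" if e: "0 < \<epsilon>" "\<epsilon> \<le> 1" for \<epsilon>
  proof -
    have "y + \<epsilon> *\<^sub>R ?y0 \<in> open_polar (L -` \<Gamma>)"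
    proof (rule pb.open_polarI)
      show "y + \<epsilon> *\<^sub>R ?y0 \<in> polar (L -` \<Gamma>)"
        using y y0p e by (auto simp: polar_def inner_add_left)
      fix v assume v: "v \<in> closure (L -` \<Gamma>)" "(y + \<epsilon> *\<^sub>R ?y0) \<bullet> v = 0"
      have "y \<bullet> v \<ge> 0" "?y0 \<bullet> v \<ge> 0"
        using pb.polar_inner_closure v(1) y y0p by blast+
      moreover have "y \<bullet> v + \<epsilon> * (?y0 \<bullet> v) = 0" using v(2) by (simp add: inner_add_left)
      ultimately have "?y0 \<bullet> v = 0"
        using e(1) by (metis add_nonneg_eq_0_iff less_imp_le mult_eq_0_iff mult_nonneg_nonneg less_irrefl)
      then show "v \<in> pb.E" using pb.open_polar_zero[OF y0 v(1)] by simp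
    qed
    then obtain z where z: "y + \<epsilon> *\<^sub>R ?y0 = L\<^sub>t z" "z \<in> open_polar \<Gamma>"
      using open_polar_pull_back by blast
    have "z \<bullet> L a = y \<bullet> a + \<epsilon> * N"
      using adjoint_inner[of z a] pb.F_euler[OF a] by (simp add: inner_add_left flip: z(1))
    moreover have "\<epsilon> * N \<le> real N" using mult_right_mono[OF e(2), of "real N"] by simp
    ultimately have "z \<in> ?B"
      using z(2) open_polar_subset by (auto simp: inner_commute)
    then show ?thesis using z(1) by blast
  qed
  have "y \<in> closure (L\<^sub>t ` ?B)"
    unfolding closure_approachable
  proof (intro allI impI)
    fix d :: real assume d: "d > 0"
    let ?\<epsilon> = "min 1 (d / (norm ?y0 + 1))"
    have n: "norm ?y0 + 1 > 0" by (simp add: add_nonneg_pos)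
    have e: "0 < ?\<epsilon>" "?\<epsilon> \<le> 1" using d n by auto
    have "?\<epsilon> * norm ?y0 \<le> (d / (norm ?y0 + 1)) * norm ?y0"
      by (rule mult_right_mono) auto
    also have "\<dots> < d" using d n by (simp add: pos_divide_less_eq mult_strict_left_mono)
    finally have "dist (y + ?\<epsilon> *\<^sub>R ?y0) y < d" using e by (simp add: dist_norm)
    then show "\<exists>z\<in>L\<^sub>t ` ?B. dist z y < d" using mem[OF e] by blast
  qed
  then show "y \<in> L\<^sub>t ` polar \<Gamma>" using closed by auto
qed

text \<open>
  A generalised inverse of the linear map induced by \<open>L\<close> modulo the edges.  It turns a section of the
  gradient map of \<open>g\<close> into one of \<open>F \<circ> L\<close>.
\<close>

lemma transversal_inverse:
  obtains B where "linear B" "\<And>e. e \<in> E \<Longrightarrow> B e = 0" "\<And>x. L (B (L x)) - L x \<in> E"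
proof -
  define Q where "Q w = w - edge_projection w" for w
  have linQ: "linear Q"
    unfolding Q_def by (intro linear_compose_sub linear_edge_projection linear_ident)
  have QE: "Q e = 0" if "e \<in> E" for e using edge_projection_of_edge[OF that] by (simp add: Q_def)
  have EQ: "w \<in> E" if "Q w = 0" for w using that edge_projection_in_edge[of w] by (simp add: Q_def)
  have linM: "linear (Q \<circ> L)" using linear_L linQ by (rule linear_compose)
  obtain H where H: "linear H" "\<And>x. Q (L (H (Q (L x)))) = Q (L x)"
    using linear_exists_right_inverse_on[OF linM subspace_UNIV] by auto
  have "Q (L (H (Q (L x))) - L x) = 0" for x
    using H(2)[of x] by (simp add: linear_diff[OF linQ])
  then show ?thesis
    using that[of "H \<circ> Q"] linear_compose[OF linQ H(1)] QE EQ linear_0[OF H(1)] by simp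
qed

text \<open>
  All the maps in question are composed of linear maps, the smooth map \<open>F\<close> and smooth sections
  of the gradient maps of \<open>g\<close> and \<open>g \<circ> L\<close>.
\<close>

theorem gradient_factorization:
  shows "induces_diffeomorphism (L -` \<Gamma>) pb.E (open_polar (L -` \<Gamma>)) pb.F"
    and "induces_diffeomorphism (L -` \<Gamma>) pb.E \<Sigma> (F \<circ> L)"
    and "diffeomorphism \<Sigma> (open_polar (L -` \<Gamma>)) L\<^sub>t"
    and "submanifold \<Sigma>"
proof -
  obtain G where G: "smooth_map_on (open_polar \<Gamma>) G" "\<And>y. y \<in> open_polar \<Gamma> \<Longrightarrow> G y \<in> \<Gamma> \<and> F (G y) = y"
    by (rule smooth_section[OF degree_pos]) blast
  obtain H where H: "smooth_map_on (open_polar (L -` \<Gamma>)) H"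
      "\<And>y. y \<in> open_polar (L -` \<Gamma>) \<Longrightarrow> H y \<in> L -` \<Gamma> \<and> pb.F (H y) = y"
    by (rule pb.smooth_section[OF degree_pos]) blast
  obtain B where B: "linear B" "\<And>e. e \<in> E \<Longrightarrow> B e = 0" "\<And>x. L (B (L x)) - L x \<in> E"
    by (rule transversal_inverse) blast
  have smF: "smooth_map_on \<Gamma> F" by (rule smooth_map_onI[OF open_cone _ Ck_on_F]) simp
  have smFL: "smooth_map_on (L -` \<Gamma>) (F \<circ> L)"
    using smooth_map_on_compose[OF smooth_map_on_linear[OF linear_L, of "L -` \<Gamma>"] smF] by (auto simp: comp_def)
  have smpbF: "smooth_map_on (L -` \<Gamma>) pb.F" by (rule smooth_map_onI[OF pb.open_cone _ pb.Ck_on_F]) simp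
  show "induces_diffeomorphism (L -` \<Gamma>) pb.E (open_polar (L -` \<Gamma>)) pb.F"
    by (rule induces_diffeomorphismI[OF pb.subspace_edge pb.F_eq_iff smpbF H(1) pb.F_in_open_polar H(2)])

  have \<Sigma>_sub: "\<Sigma> \<subseteq> open_polar \<Gamma>" using F_in_open_polar by auto
  have fibre: "(F \<circ> L) x = (F \<circ> L) x' \<longleftrightarrow> x - x' \<in> pb.E" if "x \<in> L -` \<Gamma>" "x' \<in> L -` \<Gamma>" for x x'
    using F_eq_iff[of "L x" "L x'"] that by (simp add: pull_back_edge L_simps)
  have BG: "B (G (F (L x))) = B (L x)" if "x \<in> L -` \<Gamma>" for x
  proof -
    have "F (L x) \<in> open_polar \<Gamma>" using F_in_open_polar that by simp
    then have "G (F (L x)) - L x \<in> E" using F_eq_iff[of "G (F (L x))" "L x"] G(2) that by simp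
    then show ?thesis using B(2) linear_diff[OF B(1)] by fastforce
  qed
  have LB: "L (B (L x)) \<in> \<Gamma>" "F (L (B (L x))) = F (L x)" if "x \<in> L -` \<Gamma>" for x
  proof -
    have "L x \<in> \<Gamma>" using that by simp
    from cone_add_edge(1)[OF this B(3)[of x]] F_add_edge[OF this B(3)[of x]]
    show "L (B (L x)) \<in> \<Gamma>" "F (L (B (L x))) = F (L x)" by simp_all
  qed
  have smBG: "smooth_map_on \<Sigma> (\<lambda>y. B (G y))"
    by (rule smooth_map_on_compose[OF smooth_map_on_cong[OF G(1) \<Sigma>_sub refl] smooth_map_on_linear[OF B(1)] subset_UNIV])
  show "induces_diffeomorphism (L -` \<Gamma>) pb.E \<Sigma> (F \<circ> L)"
  proof (rule induces_diffeomorphismI[OF pb.subspace_edge fibre smFL smBG])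
    fix y assume "y \<in> \<Sigma>"
    then obtain x where "x \<in> L -` \<Gamma>" "y = F (L x)" by auto
    then show "B (G y) \<in> L -` \<Gamma> \<and> (F \<circ> L) (B (G y)) = y" using BG LB by simp
  qed (assumption | rule imageI)+

  have Lt: "L\<^sub>t (F (L x)) = pb.F x" if "x \<in> L -` \<Gamma>" for x using F_pull_back[OF that] by simp
  have inj: "inj_on L\<^sub>t \<Sigma>"
  proof (rule inj_onI)
    fix y y' assume "y \<in> \<Sigma>" "y' \<in> \<Sigma>" and eq: "L\<^sub>t y = L\<^sub>t y'"
    then obtain x x' where x: "x \<in> L -` \<Gamma>" "y = F (L x)" "x' \<in> L -` \<Gamma>" "y' = F (L x')" by auto
    then have "x - x' \<in> pb.E" using eq Lt pb.F_eq_iff by simp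
    then show "y = y'" using fibre x by simp
  qed
  have img: "L\<^sub>t ` \<Sigma> = open_polar (L -` \<Gamma>)"
    unfolding pb.F_image[OF degree_pos, symmetric] using Lt by (force simp: image_comp)
  have inv: "inv_into \<Sigma> L\<^sub>t y = (F \<circ> L) (H y)" if "y \<in> open_polar (L -` \<Gamma>)" for y
    by (rule inv_into_f_eq[OF inj]) (use H(2)[OF that] Lt in auto)
  have "smooth_map_on (open_polar (L -` \<Gamma>)) (inv_into \<Sigma> L\<^sub>t)"
    by (rule smooth_map_on_cong[OF smooth_map_on_compose[OF H(1) smFL] subset_refl inv]) (use H(2) in auto)
  then show "diffeomorphism \<Sigma> (open_polar (L -` \<Gamma>)) L\<^sub>t"
    unfolding diffeomorphism_def bij_betw_def
    using inj img smooth_map_on_linear[OF adjoint_linear[OF linear_L]] by blast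

  \<comment> \<open>One chart suffices: \<open>F\<close> on a complement, within \<open>L (X)\<close>, of the intersection with the edge.\<close>
  let ?T = "range (\<lambda>x. L (B (L x)))"
  let ?O = "?T \<inter> \<Gamma>"
  have LBt: "L (B t) = t" if "t \<in> ?T" for t
  proof -
    obtain x where t: "t = L (B (L x))" using \<open>t \<in> ?T\<close> by blast
    have "B (L (B (L x)) - L x) = 0" using B(2,3) by blast
    then have "B t = B (L x)" by (simp add: t linear_diff[OF B(1)])
    then show ?thesis by (simp add: t)
  qed
  have T: "subspace ?T"
  proof -
    have "linear (L \<circ> (B \<circ> L))" using linear_L B(1) by (intro linear_compose)
    from linear_subspace_image[OF this subspace_UNIV] show ?thesis by (simp add: comp_def)
  qed
  have injF: "inj_on F ?O"
  proof (rule inj_onI)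
    fix t t' assume t: "t \<in> ?O" "t' \<in> ?O" "F t = F t'"
    then have "B (t - t') = 0" using F_eq_iff B(2) by blast
    then have "L (B t) = L (B t')" by (simp add: linear_diff[OF B(1)])
    then show "t = t'" using LBt[OF IntD1[OF t(1)]] LBt[OF IntD1[OF t(2)]] by (simp only:)
  qed
  have imgF: "F ` ?O = \<Sigma>"
  proof (intro subset_antisym subsetI)
    fix y assume "y \<in> \<Sigma>"
    then obtain x where "x \<in> L -` \<Gamma>" "y = F (L x)" by auto
    then show "y \<in> F ` ?O" using LB[of x] by (intro image_eqI[of _ _ "L (B (L x))"]) auto
  qed auto
  have invF: "inv_into ?O F y = L (B (G y))" if y: "y \<in> \<Sigma>" for y
  proof (rule inv_into_f_eq[OF injF])
    obtain x where x: "x \<in> L -` \<Gamma>" "y = F (L x)" using y by auto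
    then show "L (B (G y)) \<in> ?O" "F (L (B (G y))) = y" using BG LB by auto
  qed
  have "smooth_map_on \<Sigma> (inv_into ?O F)"
    by (rule smooth_map_on_cong[OF smooth_map_on_compose[OF smBG smooth_map_on_linear[OF linear_L] subset_UNIV] subset_refl invF])
  moreover have "smooth_map_on ?O F" by (rule smooth_map_on_cong[OF smF]) auto
  ultimately have "diffeomorphism ?O \<Sigma> F"
    unfolding diffeomorphism_def bij_betw_def using injF imgF by blast
  moreover have "openin (top_of_set ?T) ?O" using open_cone by (rule openin_open_Int)
  ultimately show "submanifold \<Sigma>"
    unfolding submanifold_def using T
    by (intro exI[of _ "dim ?T"] ballI exI[of _ UNIV] exI[of _ ?T] exI[of _ ?O] exI[of _ F]) simp
qed

lemma dual_fun_pull_back: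
  assumes y: "y \<in> open_polar (L -` \<Gamma>)"
  shows "dual_fun (g \<circ> L) (L -` \<Gamma>) y = dual_fun g \<Gamma> (inv_into \<Sigma> L\<^sub>t y)"
proof -
  obtain x where x: "x \<in> L -` \<Gamma>" "y = pb.F x" using y pb.F_image[OF degree_pos] by blast
  have "inj_on L\<^sub>t \<Sigma>" using gradient_factorization(3) by (simp add: diffeomorphism_def bij_betw_def)
  then have "inv_into \<Sigma> L\<^sub>t y = F (L x)"
    by (rule inv_into_f_eq) (use x F_pull_back in auto)
  then show ?thesis using pb.dual_fun_F[OF x(1)] dual_fun_F[of "L x"] x by simp
qed

text \<open>
  For a self-dual open cone \<open>C\<close>, the inclusions of \<open>C\<close> in the polar of the cone \<open>L -` \<Gamma>\<close> and of
  \<open>L -` \<Gamma>\<close> in \<open>C\<close> are dual to each other.  The edge is orthogonal to the polar, so it is zero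
  once the polar contains an open set, and the edge contains the kernel of \<open>L\<close>.
\<close>

lemma subset_open_polar_iff:
  assumes C: "open C" "C \<noteq> {}" "interior (polar C) = C"
  shows "C \<subseteq> open_polar (L -` \<Gamma>) \<longleftrightarrow> inj L \<and> \<Gamma> \<inter> range L \<subseteq> L ` C"
proof
  assume sub: "C \<subseteq> open_polar (L -` \<Gamma>)"
  then have subp: "C \<subseteq> polar (L -` \<Gamma>)" using pb.open_polar_subset by blast
  have "L -` \<Gamma> \<subseteq> polar C"
  proof
    fix x assume "x \<in> L -` \<Gamma>"
    then have "y \<bullet> x \<ge> 0" if "y \<in> C" for y using subp that by (auto simp: polar_def)
    then show "x \<in> polar C" by (simp add: polar_def inner_commute)
  qed
  then have "L -` \<Gamma> \<subseteq> C" using interior_maximal[OF _ pb.open_cone] C(3) by blast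
  moreover have "x = 0" if "L x = 0" for x
  proof -
    have "x \<in> pb.E" using that subspace_0[OF subspace_edge] by (simp add: pull_back_edge)
    then have zero: "y \<bullet> x = 0" if "y \<in> C" for y using pb.polar_inner_edge subp that by blast
    obtain y where y: "y \<in> C" using C(2) by blast
    obtain d where d: "d > 0" "cball y d \<subseteq> C" using C(1) y open_contains_cball by blast
    show ?thesis
    proof (rule ccontr)
      assume x: "x \<noteq> 0"
      then have "y + (d / norm x) *\<^sub>R x \<in> C" using d by (auto simp: subset_iff dist_norm)
      then have "(d / norm x) * (x \<bullet> x) = 0"
        using zero[of "y + (d / norm x) *\<^sub>R x"] zero[OF y] by (simp add: inner_add_left)
      then show False using x d(1) by simp
    qed
  qed
  ultimately show "inj L \<and> \<Gamma> \<inter> range L \<subseteq> L ` C"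
    using linear_injective_0[OF linear_L] by blast
next
  assume R: "inj L \<and> \<Gamma> \<inter> range L \<subseteq> L ` C"
  then have sub: "L -` \<Gamma> \<subseteq> C" by (auto dest: injD)
  have CC: "C \<subseteq> polar C" using C(3) interior_subset by metis
  then have pol: "C \<subseteq> polar (L -` \<Gamma>)" using sub by (auto simp: polar_def)
  show "C \<subseteq> open_polar (L -` \<Gamma>)"
  proof
    fix y assume y: "y \<in> C"
    show "y \<in> open_polar (L -` \<Gamma>)"
    proof (rule pb.open_polarI)
      show "y \<in> polar (L -` \<Gamma>)" using pol y by blast
      fix v assume v: "v \<in> closure (L -` \<Gamma>)" "y \<bullet> v = 0"
      obtain d where d: "d > 0" "cball y d \<subseteq> C" using C(1) y open_contains_cball by blast
      have "v = 0"
      proof (rule ccontr)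
        assume nz: "v \<noteq> 0"
        then have "y - (d / norm v) *\<^sub>R v \<in> C" using d by (auto simp: subset_iff dist_norm)
        then have "(y - (d / norm v) *\<^sub>R v) \<bullet> v \<ge> 0" using pol pb.polar_inner_closure v(1) by blast
        then have "(d / norm v) * (v \<bullet> v) \<le> 0" using v(2) by (simp add: inner_diff_left)
        moreover have "(d / norm v) * (v \<bullet> v) > 0" using nz d(1) by simp
        ultimately show False by linarith
      qed
      then show "v \<in> pb.E" using subspace_0[OF pb.subspace_edge] by simp
    qed
  qed
qed

end

section \<open>The test cones are self-dual\<close>

lemma limit_nonneg:
  assumes "\<And>\<epsilon>. \<epsilon> > 0 \<Longrightarrow> a + \<epsilon> * b \<ge> (0::real)"
  shows "a \<ge> 0"
proof (rule ccontr)
  assume a: "\<not> a \<ge> 0"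
  have b: "\<bar>b\<bar> + 1 > 0" by simp
  let ?\<epsilon> = "- a / (2 * (\<bar>b\<bar> + 1))"
  have e: "?\<epsilon> > 0" using a b by (intro divide_pos_pos) auto
  have "?\<epsilon> * b \<le> ?\<epsilon> * (\<bar>b\<bar> + 1)" using e by (intro mult_left_mono) auto
  also have "\<dots> = - a / 2" using b by (simp add: field_simps)
  finally show False using assms[OF e] a by linarith
qed

lemma interior_shift:
  assumes "x \<in> interior S"
  obtains \<epsilon> where "\<epsilon> > 0" "x - \<epsilon> *\<^sub>R (u::'a::real_normed_vector) \<in> S"
proof -
  obtain d where d: "d > 0" "ball x d \<subseteq> S" using assms mem_interior by blast
  let ?\<epsilon> = "d / (norm u + 1)"
  have n: "norm u + 1 > 0" by (simp add: add_nonneg_pos)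
  have "norm (?\<epsilon> *\<^sub>R u) < d" using d(1) n by (simp add: pos_divide_less_eq mult_strict_left_mono)
  then have "x - ?\<epsilon> *\<^sub>R u \<in> S" using d(2) by (auto simp: subset_iff dist_norm)
  then show ?thesis using that[of ?\<epsilon>] d(1) n by simp
qed

lemma open_pos_orthant: "open (pos_orthant :: (real^'n) set)"
proof -
  have "open {x :: real^'n. 0 < x $ i}" for i
    by (intro open_Collect_less continuous_intros)
  then have "open (\<Inter>i. {x :: real^'n. 0 < x $ i})"
    by (intro open_INT ballI) simp_all
  moreover have "(\<Inter>i. {x :: real^'n. 0 < x $ i}) = pos_orthant"
    by (auto simp: pos_orthant_def)
  ultimately show ?thesis by metis
qed

lemma interior_polar_pos_orthant: "interior (polar pos_orthant) = (pos_orthant :: (real^'n) set)"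
proof (intro subset_antisym subsetI)
  fix x :: "real^'n" assume x: "x \<in> pos_orthant"
  have "pos_orthant \<subseteq> polar (pos_orthant :: (real^'n) set)"
    by (auto simp: polar_def pos_orthant_def inner_vec_def less_imp_le intro!: sum_nonneg)
  then show "x \<in> interior (polar pos_orthant)"
    using interior_maximal[OF _ open_pos_orthant] x by blast
next
  have nonneg: "y $ i \<ge> 0" if y: "y \<in> polar pos_orthant" for y :: "real^'n" and i
  proof (rule limit_nonneg)
    fix \<epsilon> :: real assume "\<epsilon> > 0"
    then have "axis i 1 + \<epsilon> *\<^sub>R 1 \<in> pos_orthant"
      by (auto simp: pos_orthant_def axis_def)
    then have "y \<bullet> (axis i 1 + \<epsilon> *\<^sub>R 1) \<ge> 0" using y by (simp add: polar_def)
    then show "y $ i + \<epsilon> * (y \<bullet> 1) \<ge> 0" by (simp add: inner_add_right inner_axis)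
  qed
  fix x :: "real^'n" assume x: "x \<in> interior (polar pos_orthant)"
  have "x $ i > 0" for i
  proof -
    obtain \<epsilon> where "\<epsilon> > 0" "x - \<epsilon> *\<^sub>R axis i 1 \<in> polar pos_orthant" using x by (rule interior_shift)
    then show ?thesis using nonneg[of "x - \<epsilon> *\<^sub>R axis i 1" i] by simp
  qed
  then show "x \<in> pos_orthant" by (simp add: pos_orthant_def)
qed

lemma pos_orthant_nonempty: "(pos_orthant :: (real^'n) set) \<noteq> {}"
proof -
  have "1 \<in> (pos_orthant :: (real^'n) set)" by (simp add: pos_orthant_def)
  then show ?thesis by blast
qed

text \<open>
  Pairing with \<open>v v\<^sup>T\<close> evaluates the quadratic form of a matrix at \<open>v\<close>.
\<close>

definition rank_one :: "real^'n \<Rightarrow> real^'n^'n" where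
  "rank_one v = (\<chi> i j. v $ i * v $ j)"

lemma rank_one_symmetric: "transpose (rank_one v) = rank_one v"
  by (simp add: rank_one_def transpose_def vec_eq_iff mult.commute)

lemma inner_rank_one: "M \<bullet> rank_one v = v \<bullet> (M *v v)"
  by (simp add: rank_one_def inner_vec_def matrix_vector_mult_def sum_distrib_left mult_ac)

lemma rank_one_quadratic: "v \<bullet> (rank_one w *v v) = (w \<bullet> v)\<^sup>2"
proof -
  have "rank_one w *v v = (w \<bullet> v) *\<^sub>R w"
    by (simp add: rank_one_def inner_vec_def matrix_vector_mult_def vec_eq_iff sum_distrib_left mult_ac)
  then show ?thesis by (simp add: inner_commute power2_eq_square)
qed

lemma symmetric_quadratic:
  fixes M :: "real^'n^'n"
  assumes "transpose M = M"
  shows "v \<bullet> (M *v w) = w \<bullet> (M *v v)"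
  using dot_lmul_matrix[of v M w] transpose_matrix_vector[of M v] assms by (simp add: inner_commute)

text \<open>
  \<open>M - M\<^sub>i M\<^sub>i\<^sup>T / M\<^sub>i\<^sub>i\<close> is again positive semidefinite and has one nonzero diagonal entry less.
  Iteration writes \<open>M\<close> as a sum of positive multiples of rank one matrices \<open>w w\<^sup>T\<close>, and the
  inner product of \<open>w w\<^sup>T\<close> with \<open>K\<close> is \<open>w \<bullet> K w\<close>.
\<close>

lemma inner_psd_nonneg:
  fixes M K :: "real^'n^'n"
  assumes "transpose M = M" "\<And>v. v \<bullet> (M *v v) \<ge> 0" "\<And>v. v \<bullet> (K *v v) \<ge> 0"
  shows "M \<bullet> K \<ge> 0"
  using assms(1,2)
proof (induction "card {i. M $ i $ i \<noteq> 0}" arbitrary: M rule: less_induct)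
  case less
  have diag: "axis i 1 \<bullet> (M *v axis i 1) = M $ i $ i" for i and M :: "real^'n^'n"
    by (simp add: inner_axis' matrix_vector_mul_component inner_axis)
  show ?case
  proof (cases "\<exists>i. M $ i $ i \<noteq> 0")
    case False
    have "M $ i $ j = 0" for i j
    proof -
      have "(axis i 1 + s *\<^sub>R axis j 1) \<bullet> (M *v (axis i 1 + s *\<^sub>R axis j 1)) = 2 * s * (M $ i $ j)" for s
        using False symmetric_quadratic[OF less.prems(1), of "axis i 1" "axis j 1"]
        by (simp add: matrix_vector_right_distrib matrix_vector_mult_scaleR inner_add_left inner_add_right diag)
          (simp add: inner_axis' matrix_vector_mul_component inner_axis)
      then have "2 * s * (M $ i $ j) \<ge> 0" for s using less.prems(2) by metis
      from this[of 1] this[of "-1"] show ?thesis by simp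
    qed
    then have "M = 0" by (simp add: vec_eq_iff)
    then show ?thesis by simp
  next
    case True
    then obtain i where "M $ i $ i \<noteq> 0" by blast
    then have pos: "M $ i $ i > 0" using less.prems(2)[of "axis i 1"] by (simp add: diag)
    let ?m = "M $ i $ i"
    define M' where "M' = M - (1 / ?m) *\<^sub>R rank_one (M $ i)"
    have sym: "transpose M' = M'"
      using less.prems(1) rank_one_symmetric[of "M $ i"]
      by (simp add: M'_def transpose_def vec_eq_iff)
    have quad: "v \<bullet> (M' *v v) = v \<bullet> (M *v v) - (M $ i \<bullet> v)\<^sup>2 / ?m" for v
      by (simp add: M'_def matrix_vector_mult_diff_rdistrib scaleR_matrix_vector_assoc[symmetric]
          inner_diff_right rank_one_quadratic)
    have psd: "v \<bullet> (M' *v v) \<ge> 0" for v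
    proof -
      let ?s = "(M $ i \<bullet> v) / ?m"
      have row: "axis i 1 \<bullet> (M *v v) = M $ i \<bullet> v"
        by (simp add: inner_axis' matrix_vector_mul_component)
      have "0 \<le> (v - ?s *\<^sub>R axis i 1) \<bullet> (M *v (v - ?s *\<^sub>R axis i 1))" by (rule less.prems(2))
      also have "\<dots> = v \<bullet> (M *v v) - 2 * ?s * (M $ i \<bullet> v) + ?s\<^sup>2 * ?m"
        using symmetric_quadratic[OF less.prems(1), of v "axis i 1"]
        by (simp add: matrix_vector_mult_diff_distrib matrix_vector_mult_scaleR inner_diff_left inner_diff_right
            diag row power2_eq_square algebra_simps)
      also have "\<dots> = v \<bullet> (M' *v v)"
        using pos by (simp add: quad power2_eq_square field_simps)
      finally show ?thesis .
    qed
    have diag': "M' $ j $ j = M $ j $ j - (M $ i $ j)\<^sup>2 / ?m" for j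
      by (simp add: M'_def rank_one_def power2_eq_square)
    have "M' $ i $ i = 0" using pos by (simp add: diag' power2_eq_square)
    moreover have "M' $ j $ j = 0" if "M $ j $ j = 0" for j
    proof -
      have "M' $ j $ j \<ge> 0" using psd[of "axis j 1"] by (simp add: diag)
      moreover have "(M $ i $ j)\<^sup>2 / ?m \<ge> 0" using pos by simp
      ultimately show ?thesis using diag'[of j] that by linarith
    qed
    ultimately have "{j. M' $ j $ j \<noteq> 0} \<subset> {j. M $ j $ j \<noteq> 0}" using pos by force
    then have "card {j. M' $ j $ j \<noteq> 0} < card {j. M $ j $ j \<noteq> 0}" by (intro psubset_card_mono) auto
    then have "M' \<bullet> K \<ge> 0" using less.hyps sym psd by blast
    moreover have "M \<bullet> K = M' \<bullet> K + (1 / ?m) * (K \<bullet> rank_one (M $ i))"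
      by (simp add: M'_def inner_diff_left) (simp add: inner_commute)
    moreover have "(1 / ?m) * (K \<bullet> rank_one (M $ i)) \<ge> 0"
      using pos assms(3) by (simp add: inner_rank_one)
    ultimately show ?thesis by linarith
  qed
qed

lemma mat_of_symmetric: "transpose (mat_of A) = mat_of A"
  using mat_of[of A] by simp

lemma mat_of_Symmat: "transpose M = M \<Longrightarrow> mat_of (Symmat M) = M"
  by (rule Symmat_inverse) simp

lemma inner_Symmat_rank_one: "A \<bullet> Symmat (rank_one v) = v \<bullet> (mat_of A *v v)"
  by (simp add: inner_symmat_eq mat_of_Symmat rank_one_symmetric inner_rank_one)

lemma quadratic_linear_simps:
  "v \<bullet> (mat_of (A + B) *v v) = v \<bullet> (mat_of A *v v) + v \<bullet> (mat_of B *v v)"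
  "v \<bullet> (mat_of (A - B) *v v) = v \<bullet> (mat_of A *v v) - v \<bullet> (mat_of B *v v)"
  "v \<bullet> (mat_of (c *\<^sub>R A) *v v) = c * (v \<bullet> (mat_of A *v v))"
  by (simp_all add: inner_add_left inner_diff_left flip: inner_Symmat_rank_one)

definition id_symmat :: "'n::finite symmat" where
  "id_symmat = Symmat (mat 1)"

lemma id_symmat_quadratic: "v \<bullet> (mat_of id_symmat *v v) = v \<bullet> v"
  by (simp add: id_symmat_def mat_of_Symmat)

lemma id_symmat_pos_def: "id_symmat \<in> pos_def_cone"
  by (simp add: pos_def_cone_def id_symmat_quadratic)

text \<open>
  The quadratic form of a positive definite \<open>A\<close> has a positive minimum \<open>c\<close> on the unit sphere, and a
  perturbation of norm below \<open>c\<close> changes its values there by less than \<open>c\<close>.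
\<close>

lemma open_pos_def_cone: "open (pos_def_cone :: 'n::finite symmat set)"
  unfolding open_dist
proof
  fix A :: "'n symmat" assume A: "A \<in> pos_def_cone"
  have "continuous_on (sphere 0 1) (\<lambda>v :: real^'n. v \<bullet> (mat_of A *v v))"
    by (intro continuous_intros)
  moreover have "sphere 0 1 \<noteq> ({} :: (real^'n) set)" by simp
  ultimately obtain u :: "real^'n" where u: "norm u = 1"
    "\<And>v. norm v = 1 \<Longrightarrow> u \<bullet> (mat_of A *v u) \<le> v \<bullet> (mat_of A *v v)"
    using continuous_attains_inf[OF compact_sphere, of 0 1 "\<lambda>v :: real^'n. v \<bullet> (mat_of A *v v)"]
    by (auto simp: sphere_def dist_norm)
  let ?c = "u \<bullet> (mat_of A *v u)"
  have "u \<noteq> 0" using u(1) by auto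
  then have c: "?c > 0" using A by (simp add: pos_def_cone_def)
  have "B \<in> pos_def_cone" if B: "dist B A < ?c" for B
  proof -
    have "v \<bullet> (mat_of B *v v) > 0" if v: "v \<noteq> 0" for v
    proof -
      let ?w = "(1 / norm v) *\<^sub>R v"
      have nw: "norm ?w = 1" using v by simp
      have "norm (Symmat (rank_one ?w)) = 1"
        using nw by (simp only: norm_eq_1 inner_Symmat_rank_one mat_of_Symmat[OF rank_one_symmetric]
            rank_one_quadratic power_one)
      moreover have "\<bar>(B - A) \<bullet> Symmat (rank_one ?w)\<bar> \<le> norm (B - A) * norm (Symmat (rank_one ?w))"
        by (rule Cauchy_Schwarz_ineq2)
      ultimately have "\<bar>?w \<bullet> (mat_of B *v ?w) - ?w \<bullet> (mat_of A *v ?w)\<bar> < ?c"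
        using B unfolding inner_Symmat_rank_one quadratic_linear_simps by (simp add: dist_norm)
      moreover have "?c \<le> ?w \<bullet> (mat_of A *v ?w)" using u(2) nw by blast
      ultimately have "?w \<bullet> (mat_of B *v ?w) > 0" by linarith
      then have "(1 / norm v) * (1 / norm v) * (v \<bullet> (mat_of B *v v)) > 0"
        by (simp add: matrix_vector_mult_scaleR)
      then show ?thesis by (simp add: zero_less_divide_iff zero_less_mult_iff)
    qed
    then show ?thesis by (simp add: pos_def_cone_def)
  qed
  then show "\<exists>e>0. \<forall>B. dist B A < e \<longrightarrow> B \<in> pos_def_cone" using c by blast
qed

lemma interior_polar_pos_def_cone: "interior (polar pos_def_cone) = (pos_def_cone :: 'n::finite symmat set)"
proof (intro subset_antisym subsetI)
  fix A :: "'n symmat" assume A: "A \<in> pos_def_cone"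
  have psd: "v \<bullet> (mat_of B *v v) \<ge> 0" if "B \<in> pos_def_cone" for B :: "'n symmat" and v
    using that by (cases "v = 0") (auto simp: pos_def_cone_def less_imp_le)
  have "pos_def_cone \<subseteq> polar (pos_def_cone :: 'n symmat set)"
    using inner_psd_nonneg[OF mat_of_symmetric psd psd] by (auto simp: polar_def inner_symmat_eq)
  then show "A \<in> interior (polar pos_def_cone)"
    using interior_maximal[OF _ open_pos_def_cone] A by blast
next
  have nonneg: "v \<bullet> (mat_of B *v v) \<ge> 0" if B: "B \<in> polar pos_def_cone" for B :: "'n symmat" and v
  proof (rule limit_nonneg)
    fix \<epsilon> :: real assume e: "\<epsilon> > 0"
    have "w \<bullet> (mat_of (Symmat (rank_one v) + \<epsilon> *\<^sub>R id_symmat) *v w) = (v \<bullet> w)\<^sup>2 + \<epsilon> * (w \<bullet> w)" for w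
      by (simp add: quadratic_linear_simps mat_of_Symmat rank_one_symmetric rank_one_quadratic id_symmat_quadratic)
    then have "Symmat (rank_one v) + \<epsilon> *\<^sub>R id_symmat \<in> pos_def_cone"
      using e by (simp add: pos_def_cone_def add_nonneg_pos)
    then have "B \<bullet> (Symmat (rank_one v) + \<epsilon> *\<^sub>R id_symmat) \<ge> 0" using B by (simp add: polar_def)
    then show "v \<bullet> (mat_of B *v v) + \<epsilon> * (B \<bullet> id_symmat) \<ge> 0"
      by (simp add: inner_add_right inner_Symmat_rank_one)
  qed
  fix A :: "'n symmat" assume "A \<in> interior (polar pos_def_cone)"
  then obtain \<epsilon> where e: "\<epsilon> > 0" "A - \<epsilon> *\<^sub>R id_symmat \<in> polar pos_def_cone" by (rule interior_shift)
  have "v \<bullet> (mat_of A *v v) > 0" if "v \<noteq> 0" for v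
  proof -
    have "v \<bullet> (mat_of A *v v) \<ge> \<epsilon> * (v \<bullet> v)"
      using nonneg[OF e(2), of v] by (simp add: quadratic_linear_simps id_symmat_quadratic)
    moreover have "\<epsilon> * (v \<bullet> v) > 0" using e(1) that by simp
    ultimately show ?thesis by linarith
  qed
  then show "A \<in> pos_def_cone" by (simp add: pos_def_cone_def)
qed


section \<open>The dual pair of a pull back\<close>

lemma garding_pull_backI:
  assumes "N \<ge> 1" "garding_pair N g \<Gamma>" "linear L" "L -` \<Gamma> \<noteq> {}"
  shows "garding_pull_back g \<Gamma> N L"
  using assms garding_pair_imp_garding_cone
  by (simp add: garding_pull_back_def garding_pull_back_axioms_def)

theorem theorem13p2:
  fixes g :: "'w::euclidean_space \<Rightarrow> real" and \<Gamma> :: "'w set" and N :: nat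
  assumes N: "N \<ge> 1"
    and garding: "garding_pair N g \<Gamma>"
  shows
    "(\<forall>L :: 'x::euclidean_space \<Rightarrow> 'w. linear L \<longrightarrow> L -` \<Gamma> \<noteq> {} \<longrightarrow>
       (let L\<^sub>t = adjoint L; g\<^sub>L = g \<circ> L; \<Gamma>\<^sub>L = L -` \<Gamma>; E\<^sub>L = edge \<Gamma>\<^sub>L;
            F = grad_log g; F\<^sub>L = grad_log g\<^sub>L; \<Sigma> = (F \<circ> L) ` \<Gamma>\<^sub>L
        in
          (open_polar \<Gamma>\<^sub>L = L\<^sub>t ` open_polar \<Gamma> \<and> polar \<Gamma>\<^sub>L = L\<^sub>t ` polar \<Gamma>) \<and>
          (\<forall>x\<in>\<Gamma>\<^sub>L. grad g\<^sub>L x = L\<^sub>t (grad g (L x))) \<and>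
          (\<forall>x\<in>\<Gamma>\<^sub>L. F\<^sub>L x = (L\<^sub>t \<circ> F \<circ> L) x) \<and>
          induces_diffeomorphism \<Gamma>\<^sub>L E\<^sub>L (open_polar \<Gamma>\<^sub>L) F\<^sub>L \<and>
          (\<Sigma> \<subseteq> open_polar \<Gamma> \<and> submanifold \<Sigma>) \<and>
          induces_diffeomorphism \<Gamma>\<^sub>L E\<^sub>L \<Sigma> (F \<circ> L) \<and>
          diffeomorphism \<Sigma> (open_polar \<Gamma>\<^sub>L) L\<^sub>t \<and>
          (\<forall>y\<in>open_polar \<Gamma>\<^sub>L. dual_fun g\<^sub>L \<Gamma>\<^sub>L y = dual_fun g \<Gamma> (inv_into \<Sigma> L\<^sub>t y))))
     \<and>
     (\<forall>L :: real^'n \<Rightarrow> 'w. linear L \<longrightarrow> L -` \<Gamma> \<noteq> {} \<longrightarrow>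
       (elliptic_vec (open_polar (L -` \<Gamma>)) \<longleftrightarrow> pos_orthant \<subseteq> adjoint L ` open_polar \<Gamma>) \<and>
       (elliptic_vec (open_polar (L -` \<Gamma>)) \<longleftrightarrow> inj L \<and> \<Gamma> \<inter> range L \<subseteq> L ` pos_orthant) \<and>
       (bij L \<longrightarrow> (elliptic_vec (open_polar (L -` \<Gamma>)) \<longleftrightarrow> \<Gamma> \<subseteq> L ` pos_orthant)))
     \<and>
     (\<forall>L :: 'n symmat \<Rightarrow> 'w. linear L \<longrightarrow> L -` \<Gamma> \<noteq> {} \<longrightarrow>
       (elliptic_mat (open_polar (L -` \<Gamma>)) \<longleftrightarrow> pos_def_cone \<subseteq> adjoint L ` open_polar \<Gamma>) \<and>
       (elliptic_mat (open_polar (L -` \<Gamma>)) \<longleftrightarrow> inj L \<and> \<Gamma> \<inter> range L \<subseteq> L ` pos_def_cone) \<and>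
       (bij L \<longrightarrow> (elliptic_mat (open_polar (L -` \<Gamma>)) \<longleftrightarrow> \<Gamma> \<subseteq> L ` pos_def_cone)))"
proof (intro conjI allI impI)
  fix L :: "'x \<Rightarrow> 'w" assume L: "linear L" "L -` \<Gamma> \<noteq> {}"
  interpret garding_pull_back g \<Gamma> N L by (rule garding_pull_backI[OF N garding L])
  show "let L\<^sub>t = adjoint L; g\<^sub>L = g \<circ> L; \<Gamma>\<^sub>L = L -` \<Gamma>; E\<^sub>L = edge \<Gamma>\<^sub>L;
            F = grad_log g; F\<^sub>L = grad_log g\<^sub>L; \<Sigma> = (F \<circ> L) ` \<Gamma>\<^sub>L
        in
          (open_polar \<Gamma>\<^sub>L = L\<^sub>t ` open_polar \<Gamma> \<and> polar \<Gamma>\<^sub>L = L\<^sub>t ` polar \<Gamma>) \<and>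
          (\<forall>x\<in>\<Gamma>\<^sub>L. grad g\<^sub>L x = L\<^sub>t (grad g (L x))) \<and>
          (\<forall>x\<in>\<Gamma>\<^sub>L. F\<^sub>L x = (L\<^sub>t \<circ> F \<circ> L) x) \<and>
          induces_diffeomorphism \<Gamma>\<^sub>L E\<^sub>L (open_polar \<Gamma>\<^sub>L) F\<^sub>L \<and>
          (\<Sigma> \<subseteq> open_polar \<Gamma> \<and> submanifold \<Sigma>) \<and>
          induces_diffeomorphism \<Gamma>\<^sub>L E\<^sub>L \<Sigma> (F \<circ> L) \<and>
          diffeomorphism \<Sigma> (open_polar \<Gamma>\<^sub>L) L\<^sub>t \<and>
          (\<forall>y\<in>open_polar \<Gamma>\<^sub>L. dual_fun g\<^sub>L \<Gamma>\<^sub>L y = dual_fun g \<Gamma> (inv_into \<Sigma> L\<^sub>t y))"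
    unfolding Let_def
  proof (intro conjI ballI)
    show "open_polar (L -` \<Gamma>) = L\<^sub>t ` open_polar \<Gamma>" by (rule open_polar_pull_back)
    show "polar (L -` \<Gamma>) = L\<^sub>t ` polar \<Gamma>" by (rule polar_pull_back)
    show "grad (g \<circ> L) x = L\<^sub>t (grad g (L x))" for x by (rule grad_pull_back)
    show "pb.F x = (L\<^sub>t \<circ> F \<circ> L) x" if "x \<in> L -` \<Gamma>" for x using F_pull_back[OF that] by simp
    show "\<Sigma> \<subseteq> open_polar \<Gamma>" using F_in_open_polar by auto
  qed (fact gradient_factorization dual_fun_pull_back)+
next
  fix L :: "real^'n \<Rightarrow> 'w" assume L: "linear L" "L -` \<Gamma> \<noteq> {}"
  interpret garding_pull_back g \<Gamma> N L by (rule garding_pull_backI[OF N garding L])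
  show "elliptic_vec (open_polar (L -` \<Gamma>)) \<longleftrightarrow> pos_orthant \<subseteq> adjoint L ` open_polar \<Gamma>"
    by (simp add: elliptic_vec_def open_polar_pull_back)
  show *: "elliptic_vec (open_polar (L -` \<Gamma>)) \<longleftrightarrow> inj L \<and> \<Gamma> \<inter> range L \<subseteq> L ` pos_orthant"
    unfolding elliptic_vec_def
    by (rule subset_open_polar_iff[OF open_pos_orthant pos_orthant_nonempty interior_polar_pos_orthant])
  show "elliptic_vec (open_polar (L -` \<Gamma>)) \<longleftrightarrow> \<Gamma> \<subseteq> L ` pos_orthant" if "bij L"
    using that unfolding * by (simp add: bij_def)
next
  fix L :: "'n symmat \<Rightarrow> 'w" assume L: "linear L" "L -` \<Gamma> \<noteq> {}"
  interpret garding_pull_back g \<Gamma> N L by (rule garding_pull_backI[OF N garding L])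
  have ne: "pos_def_cone \<noteq> ({} :: 'n symmat set)" using id_symmat_pos_def by blast
  show "elliptic_mat (open_polar (L -` \<Gamma>)) \<longleftrightarrow> pos_def_cone \<subseteq> adjoint L ` open_polar \<Gamma>"
    by (simp add: elliptic_mat_def open_polar_pull_back)
  show *: "elliptic_mat (open_polar (L -` \<Gamma>)) \<longleftrightarrow> inj L \<and> \<Gamma> \<inter> range L \<subseteq> L ` pos_def_cone"
    unfolding elliptic_mat_def
    by (rule subset_open_polar_iff[OF open_pos_def_cone ne interior_polar_pos_def_cone])
  show "elliptic_mat (open_polar (L -` \<Gamma>)) \<longleftrightarrow> \<Gamma> \<subseteq> L ` pos_def_cone" if "bij L"
    using that unfolding * by (simp add: bij_def)
qed

end
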